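(* Let $b,\omega:\mathbb{R}\to\mathbb{R}^+$ be continuous functions such that $0<b_0\le b(t)\le b_1$ and $0\le\omega_0\le\omega(t)\le\omega_1$ for all $t\in\mathbb{R}$, with $\omega_1<\pi^2$. Let $H^+=\{v\in L^2(0,1):v(x)\ge0\text{ for a.a. }x\in(0,1)\}$ and let $U^+$ be the multivalued process on $H^+$ generated by all non-negative strong solutions of $$\frac{\partial u}{\partial t}-\frac{\partial^2u}{\partial x^2}\in b(t)H_0(u)+\omega(t)u\ \text{ on }(\tau,\infty)\times(0,1),\qquad u(t,0)=u(t,1)=0,\qquad u(\tau,x)=u_\tau(x),$$ where $H_0(u)=\{1\}$ if $u>0$, $H_0(0)=[-1,1]$, $H_0(u)=\{-1\}$ if $u<0$. Let $\mathcal{A}^+=\{\mathcal{A}^+(t)\}_{t\in\mathbb{R}}$ be the pullback attractor of $U^+$. Then $\mathcal{A}^+$ is a forward attractor of $U^+$.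
   Context: Let $H=L^2(0,1)$ with norm $\|\cdot\|$, and $A=-\frac{d^2}{dx^2}$ with $D(A)=H^2(0,1)\cap H_0^1(0,1)$. A strong solution with $u_\tau\in H$ is $u\in C([\tau,+\infty),H)$ with $u(\tau)=u_\tau$, absolutely continuous on $[T_1,T_2]$ for all $\tau<T_1<T_2$, $u(t)\in D(A)$ for a.a. $t\in(T_1,T_2)$, and such that there is $r\in L^2_{loc}([\tau,+\infty);H)$ with $r(t,x)\in b(t)H_0(u(t,x))$ for a.a. $(t,x)\in(\tau,+\infty)\times(0,1)$ and $\frac{du}{dt}+Au(t)=r(t)+\omega(t)u(t)$ in $H$ for a.a. $t>\tau$. It is non-negative if $u(t)\in H^+$ for all $t\ge\tau$. $U^+(t,\tau,u_\tau)=\{u(t):u\text{ is a non-negative strong solution with }u(\tau)=u_\tau\}$ for $u_\tau\in H^+$, $t\ge\tau$; $U^+(t,\tau,B)=\bigcup_{x\in B}U^+(t,\tau,x)$. The phase space is $H^+$ with the metric of $H$, and $dist(A,B)=\sup_{y\in A}\inf_{x\in B}\|y-x\|$. The pullback attractor is the family of non-empty compact negatively invariant sets ($\mathcal{A}^+(t)\subset U^+(t,s,\mathcal{A}^+(s))$ for $t\ge s$) which is the minimal family of closed sets satisfying $dist(U^+(t,t_0,B),\mathcal{A}^+(t))\to0$ as $t_0\to-\infty$ for every bounded $B\subset H^+$ and every fixed $t$; it is known to exist. A forward attractor is a family of non-empty compact negatively invariant sets with $dist(U^+(t,t_0,B),\mathcal{A}^+(t))\to0$ as $t\to+\infty$ for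 every bounded $B\subset H^+$ and every fixed $t_0$. *)

theory Defs
  imports "HOL-Analysis.Analysis"
begin

section \<open>The Hilbert space of square integrable functions on the open unit interval\<close>

abbreviation I01 :: "real measure" where
  "I01 \<equiv> restrict_space lborel {0<..<1}"

definition square_integrable :: "(real \<Rightarrow> real) \<Rightarrow> bool" where
  "square_integrable f \<longleftrightarrow> f \<in> borel_measurable I01 \<and> integrable I01 (\<lambda>x. (f x)\<^sup>2)"

lemma square_integrable_0: "square_integrable (\<lambda>x. 0)"
  by (simp add: square_integrable_def)

lemma square_integrable_mult:
  assumes "square_integrable f" "square_integrable g"
  shows "integrable I01 (\<lambda>x. f x * g x)"
proof (rule Bochner_Integration.integrable_bound)
  show "integrable I01 (\<lambda>x. (f x)\<^sup>2 + (g x)\<^sup>2)"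
    using assms by (auto simp: square_integrable_def)
  show "(\<lambda>x. f x * g x) \<in> borel_measurable I01"
    using assms by (auto simp: square_integrable_def)
  have "\<bar>f x * g x\<bar> \<le> (f x)\<^sup>2 + (g x)\<^sup>2" for x
  proof -
    have "2 * (\<bar>f x\<bar> * \<bar>g x\<bar>) \<le> (f x)\<^sup>2 + (g x)\<^sup>2"
      using sum_squares_bound[of "\<bar>f x\<bar>" "\<bar>g x\<bar>"] by (simp add: mult.assoc)
    moreover have "0 \<le> \<bar>f x\<bar> * \<bar>g x\<bar>" by simp
    ultimately show ?thesis unfolding abs_mult by linarith
  qed
  then show "AE x in I01. norm (f x * g x) \<le> norm ((f x)\<^sup>2 + (g x)\<^sup>2)"
    by (auto intro!: AE_I2)
qed

lemma square_integrable_add: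
  assumes "square_integrable f" "square_integrable g"
  shows "square_integrable (\<lambda>x. f x + g x)"
  using assms square_integrable_mult[OF assms]
  by (auto simp: square_integrable_def power2_sum mult.assoc)

lemma square_integrable_scale:
  assumes "square_integrable f"
  shows "square_integrable (\<lambda>x. c * f x)"
  using assms by (auto simp: square_integrable_def power_mult_distrib)

lemma square_integrable_minus:
  assumes "square_integrable f"
  shows "square_integrable (\<lambda>x. - f x)"
  using square_integrable_scale[OF assms, of "-1"] by simp

lemma square_integrable_diff:
  assumes "square_integrable f" "square_integrable g"
  shows "square_integrable (\<lambda>x. f x - g x)"
  using square_integrable_add[OF assms(1) square_integrable_minus[OF assms(2)]] by simp

definition l2_rel :: "(real \<Rightarrow> real) \<Rightarrow> (real \<Rightarrow> real) \<Rightarrow> bool" where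
  "l2_rel f g \<longleftrightarrow> square_integrable f \<and> square_integrable g \<and> (AE x in I01. f x = g x)"

lemma part_equivp_l2_rel: "part_equivp l2_rel"
proof (rule part_equivpI)
  show "\<exists>f. l2_rel f f"
    using square_integrable_0 by (auto simp: l2_rel_def)
  show "symp l2_rel"
    by (auto simp: symp_def l2_rel_def eq_commute)
  show "transp l2_rel"
  proof (rule transpI)
    fix f g h assume "l2_rel f g" "l2_rel g h"
    then show "l2_rel f h"
      unfolding l2_rel_def by (auto elim: AE_mp)
  qed
qed

quotient_type l2 = "real \<Rightarrow> real" / partial: l2_rel
  by (rule part_equivp_l2_rel)

lemma l2_rel_rep: "l2_rel (rep_l2 v) (rep_l2 v)"
  by (metis Quotient_l2 Quotient_rep_reflp)

lemma square_integrable_rep: "square_integrable (rep_l2 v)"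
  using l2_rel_rep[of v] by (simp add: l2_rel_def)

lemma rep_abs_l2:
  assumes "square_integrable f"
  shows "AE x in I01. rep_l2 (abs_l2 f) x = f x"
proof -
  have "l2_rel f f" using assms by (simp add: l2_rel_def)
  then have "l2_rel (rep_l2 (abs_l2 f)) f"
    using Quotient_l2 by (metis Quotient_rep_abs)
  then show ?thesis by (simp add: l2_rel_def)
qed

instantiation l2 :: real_inner
begin

lift_definition zero_l2 :: l2 is "\<lambda>x. 0"
  by (auto simp: l2_rel_def square_integrable_0)

lift_definition plus_l2 :: "l2 \<Rightarrow> l2 \<Rightarrow> l2" is "\<lambda>f g x. f x + g x"
  by (auto simp: l2_rel_def intro: square_integrable_add)

lift_definition minus_l2 :: "l2 \<Rightarrow> l2 \<Rightarrow> l2" is "\<lambda>f g x. f x - g x"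
  by (auto simp: l2_rel_def intro: square_integrable_diff)

lift_definition uminus_l2 :: "l2 \<Rightarrow> l2" is "\<lambda>f x. - f x"
  by (auto simp: l2_rel_def intro: square_integrable_minus)

lift_definition scaleR_l2 :: "real \<Rightarrow> l2 \<Rightarrow> l2" is "\<lambda>c f x. c * f x"
  by (auto simp: l2_rel_def intro: square_integrable_scale)

lift_definition inner_l2 :: "l2 \<Rightarrow> l2 \<Rightarrow> real" is "\<lambda>f g. \<integral>x. f x * g x \<partial>I01"
proof -
  fix f f' g g' assume "l2_rel f f'" "l2_rel g g'"
  then show "(\<integral>x. f x * g x \<partial>I01) = (\<integral>x. f' x * g' x \<partial>I01)"
    by (intro integral_cong_AE) (auto simp: l2_rel_def square_integrable_def)
qed

definition norm_l2 :: "l2 \<Rightarrow> real" where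
  "norm_l2 v = sqrt (inner v v)"

definition sgn_l2 :: "l2 \<Rightarrow> l2" where
  "sgn_l2 v = inverse (norm v) *\<^sub>R v"

definition dist_l2 :: "l2 \<Rightarrow> l2 \<Rightarrow> real" where
  "dist_l2 v w = norm (v - w)"

definition uniformity_l2 :: "(l2 \<times> l2) filter" where
  "uniformity_l2 = (INF e\<in>{0<..}. principal {(v, w). dist v w < e})"

definition open_l2 :: "l2 set \<Rightarrow> bool" where
  "open_l2 S \<longleftrightarrow> (\<forall>v\<in>S. \<forall>\<^sub>F (v', w) in uniformity. v' = v \<longrightarrow> w \<in> S)"

instance
proof
  fix u v w :: l2 and a c :: real and S :: "l2 set"
  show "u + v + w = u + (v + w)"
    by transfer (auto simp: l2_rel_def add.assoc intro: square_integrable_add)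
  show "u + v = v + u"
    by transfer (auto simp: l2_rel_def add.commute intro: square_integrable_add)
  show "0 + u = u"
    by transfer (auto simp: l2_rel_def)
  show "- u + u = 0"
    by transfer (auto simp: l2_rel_def square_integrable_0)
  show "u - v = u + - v"
    by transfer (auto simp: l2_rel_def intro: square_integrable_diff)
  show "c *\<^sub>R (u + v) = c *\<^sub>R u + c *\<^sub>R v"
    by transfer (auto simp: l2_rel_def distrib_left
        intro!: square_integrable_add square_integrable_scale)
  show "(a + c) *\<^sub>R u = a *\<^sub>R u + c *\<^sub>R u"
    by transfer (auto simp: l2_rel_def distrib_right
        intro!: square_integrable_add square_integrable_scale)
  show "a *\<^sub>R c *\<^sub>R u = (a * c) *\<^sub>R u"
    by transfer (auto simp: l2_rel_def mult.assoc intro!: square_integrable_scale)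
  show "1 *\<^sub>R u = u"
    by transfer (auto simp: l2_rel_def)
  show "dist u v = norm (u - v)"
    by (fact dist_l2_def)
  show "sgn u = inverse (norm u) *\<^sub>R u"
    by (fact sgn_l2_def)
  show "uniformity = (INF e\<in>{0<..}. principal {(v, w :: l2). dist v w < e})"
    by (fact uniformity_l2_def)
  show "open S \<longleftrightarrow> (\<forall>v\<in>S. \<forall>\<^sub>F (v', w) in uniformity. v' = v \<longrightarrow> w \<in> S)"
    by (fact open_l2_def)
  show "inner u v = inner v u"
    by transfer (simp add: mult.commute)
  show "inner (u + v) w = inner u w + inner v w"
    by transfer (auto simp: l2_rel_def distrib_right
        intro!: Bochner_Integration.integral_add square_integrable_mult)
  show "inner (c *\<^sub>R u) v = c * inner u v"
    by transfer (simp add: mult.assoc)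
  show "0 \<le> inner u u"
    by transfer (auto intro!: integral_nonneg_AE)
  show "inner u u = 0 \<longleftrightarrow> u = 0"
  proof transfer
    fix f assume "l2_rel f f"
    then have f: "square_integrable f" by (simp add: l2_rel_def)
    have "(\<integral>x. f x * f x \<partial>I01) = 0 \<longleftrightarrow> (AE x in I01. f x * f x = 0)"
      using square_integrable_mult[OF f f] by (intro integral_nonneg_eq_0_iff_AE) auto
    then show "(\<integral>x. f x * f x \<partial>I01) = 0 \<longleftrightarrow> l2_rel f (\<lambda>x. 0)"
      using f by (simp add: l2_rel_def square_integrable_0)
  qed
  show "norm u = sqrt (inner u u)"
    by (fact norm_l2_def)
qed

end

definition Hplus :: "l2 set" where
  "Hplus = {v. AE x in I01. 0 \<le> rep_l2 v x}"


section \<open>Sobolev spaces and the Dirichlet Laplacian\<close>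

text \<open>Smooth functions with compact support in the open unit interval.\<close>

definition test_functions :: "(real \<Rightarrow> real) set" where
  "test_functions = {\<phi>. (\<forall>k. (deriv ^^ k) \<phi> differentiable_on UNIV) \<and>
     compact (closure {x. \<phi> x \<noteq> 0}) \<and> closure {x. \<phi> x \<noteq> 0} \<subseteq> {0<..<1}}"

definition has_weak_deriv :: "l2 \<Rightarrow> l2 \<Rightarrow> bool" where
  "has_weak_deriv v g \<longleftrightarrow> (\<forall>\<phi>\<in>test_functions.
     (\<integral>x. rep_l2 v x * deriv \<phi> x \<partial>I01) = - (\<integral>x. rep_l2 g x * \<phi> x \<partial>I01))"

text \<open>The weak derivative, when it exists in \<open>L\<^sup>2\<close>, is unique; the choice below is only
  meaningful on \<open>H1\<close>.\<close>

definition weak_deriv :: "l2 \<Rightarrow> l2" where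
  "weak_deriv v = (SOME g. has_weak_deriv v g)"

definition H1 :: "l2 set" where
  "H1 = {v. \<exists>g. has_weak_deriv v g}"

definition H2 :: "l2 set" where
  "H2 = {v \<in> H1. weak_deriv v \<in> H1}"

definition H1_norm :: "l2 \<Rightarrow> real" where
  "H1_norm v = sqrt ((norm v)\<^sup>2 + (norm (weak_deriv v))\<^sup>2)"

text \<open>The closure of the test functions in \<open>H1\<close>.\<close>

definition H1_0 :: "l2 set" where
  "H1_0 = {v \<in> H1. \<forall>\<epsilon>>0. \<exists>\<phi>\<in>test_functions. H1_norm (v - abs_l2 \<phi>) < \<epsilon>}"

definition dom_A :: "l2 set" where
  "dom_A = H2 \<inter> H1_0"

definition op_A :: "l2 \<Rightarrow> l2" where
  "op_A v = - weak_deriv (weak_deriv v)"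


section \<open>Strong solutions of the differential inclusion\<close>

definition H0 :: "real \<Rightarrow> real set" where
  "H0 s = (if s > 0 then {1} else if s = 0 then {-1..1} else {-1})"

definition abs_continuous_on :: "real \<Rightarrow> real \<Rightarrow> (real \<Rightarrow> 'a::real_normed_vector) \<Rightarrow> bool" where
  "abs_continuous_on T1 T2 u \<longleftrightarrow> (\<forall>\<epsilon>>0. \<exists>\<delta>>0. \<forall>(n::nat) l r.
     (\<forall>i<n. T1 \<le> l i \<and> l i \<le> r i \<and> r i \<le> T2) \<and>
     disjoint_family_on (\<lambda>i. {l i<..<r i}) {..<n} \<and> (\<Sum>i<n. r i - l i) < \<delta>
     \<longrightarrow> (\<Sum>i<n. norm (u (r i) - u (l i))) < \<epsilon>)"

text \<open>Square integrability on \<open>[\<tau>, T]\<close> for all \<open>T\<close>. As \<open>L\<^sup>2(0,1)\<close> is separable, Borel and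
  strong measurability coincide.\<close>

definition L2_loc :: "real \<Rightarrow> (real \<Rightarrow> l2) \<Rightarrow> bool" where
  "L2_loc \<tau> r \<longleftrightarrow> set_borel_measurable lborel {\<tau>..} r \<and>
     (\<forall>T>\<tau>. set_integrable lborel {\<tau>..T} (\<lambda>t. (norm (r t))\<^sup>2))"

text \<open>A statement about \<open>v(t,x)\<close> for almost all \<open>(t,x)\<close>, where \<open>v\<close> is a (strongly measurable)
  \<open>L\<^sup>2(0,1)\<close>-valued function of time, refers to a jointly measurable function of
  \<open>(t,x)\<close> representing \<open>v\<close>. Such a function exists and, by Fubini, is unique up to null sets of
  \<open>(\<tau>,\<infinity>) \<times> (0,1)\<close>.\<close>

definition space_time_rep :: "real \<Rightarrow> (real \<Rightarrow> l2) \<Rightarrow> (real \<times> real \<Rightarrow> real) \<Rightarrow> bool" where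
  "space_time_rep \<tau> v f \<longleftrightarrow> f \<in> borel_measurable borel \<and>
     (AE t in lborel. \<tau> < t \<longrightarrow> (AE x in I01. rep_l2 (v t) x = f (t, x)))"

definition inclusion_ae ::
    "(real \<Rightarrow> real) \<Rightarrow> real \<Rightarrow> (real \<Rightarrow> l2) \<Rightarrow> (real \<Rightarrow> l2) \<Rightarrow> bool" where
  "inclusion_ae b \<tau> u r \<longleftrightarrow> (\<exists>fu fr. space_time_rep \<tau> u fu \<and> space_time_rep \<tau> r fr \<and>
     (AE (t, x) in lborel. \<tau> < t \<and> 0 < x \<and> x < 1 \<longrightarrow>
        fr (t, x) \<in> (\<lambda>y. b t * y) ` H0 (fu (t, x))))"

definition strong_solution ::
    "(real \<Rightarrow> real) \<Rightarrow> (real \<Rightarrow> real) \<Rightarrow> real \<Rightarrow> l2 \<Rightarrow> (real \<Rightarrow> l2) \<Rightarrow> bool" where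
  "strong_solution b \<omega> \<tau> u\<^sub>\<tau> u \<longleftrightarrow>
     continuous_on {\<tau>..} u \<and> u \<tau> = u\<^sub>\<tau> \<and>
     (\<forall>T1 T2. \<tau> < T1 \<and> T1 < T2 \<longrightarrow> abs_continuous_on T1 T2 u \<and>
        (AE t in lborel. T1 < t \<and> t < T2 \<longrightarrow> u t \<in> dom_A)) \<and>
     (\<exists>r. L2_loc \<tau> r \<and> inclusion_ae b \<tau> u r \<and>
        (AE t in lborel. \<tau> < t \<longrightarrow>
           (\<exists>u'. (u has_vector_derivative u') (at t) \<and> u' + op_A (u t) = r t + \<omega> t *\<^sub>R u t)))"

definition nonneg_strong_solution ::
    "(real \<Rightarrow> real) \<Rightarrow> (real \<Rightarrow> real) \<Rightarrow> real \<Rightarrow> l2 \<Rightarrow> (real \<Rightarrow> l2) \<Rightarrow> bool" where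
  "nonneg_strong_solution b \<omega> \<tau> u\<^sub>\<tau> u \<longleftrightarrow>
     strong_solution b \<omega> \<tau> u\<^sub>\<tau> u \<and> (\<forall>t\<ge>\<tau>. u t \<in> Hplus)"

text \<open>Only meaningful for \<open>\<tau> \<le> t\<close> and \<open>u\<^sub>\<tau> \<in> Hplus\<close>.\<close>

definition Uplus :: "(real \<Rightarrow> real) \<Rightarrow> (real \<Rightarrow> real) \<Rightarrow> real \<Rightarrow> real \<Rightarrow> l2 \<Rightarrow> l2 set" where
  "Uplus b \<omega> t \<tau> u\<^sub>\<tau> = {u t | u. nonneg_strong_solution b \<omega> \<tau> u\<^sub>\<tau> u}"


section \<open>Pullback and forward attractors of multivalued processes\<close>

text \<open>Taken in \<open>ennreal\<close>, so that the supremum exists without boundedness of \<open>A\<close>.\<close>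

definition semidist :: "'a::metric_space set \<Rightarrow> 'a set \<Rightarrow> ennreal" where
  "semidist A B = (SUP y\<in>A. INF x\<in>B. ennreal (dist y x))"

text \<open>In the following, \<open>X\<close> is the phase space, a subset of the ambient type with the induced
  metric, and \<open>U t \<tau> x\<close> is the set of states at time \<open>t\<close> reachable from \<open>x\<close> at time \<open>\<tau>\<close>.\<close>

definition negatively_invariant ::
    "(real \<Rightarrow> real \<Rightarrow> 'a \<Rightarrow> 'a set) \<Rightarrow> (real \<Rightarrow> 'a set) \<Rightarrow> bool" where
  "negatively_invariant U K \<longleftrightarrow> (\<forall>s t. s \<le> t \<longrightarrow> K t \<subseteq> (\<Union>x\<in>K s. U t s x))"

definition pullback_attracting ::
    "'a::metric_space set \<Rightarrow> (real \<Rightarrow> real \<Rightarrow> 'a \<Rightarrow> 'a set) \<Rightarrow> (real \<Rightarrow> 'a set) \<Rightarrow> bool" where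
  "pullback_attracting X U K \<longleftrightarrow> (\<forall>B t. bounded B \<and> B \<subseteq> X \<longrightarrow>
     ((\<lambda>t0. semidist (\<Union>x\<in>B. U t t0 x) (K t)) \<longlongrightarrow> 0) at_bot)"

definition forward_attracting ::
    "'a::metric_space set \<Rightarrow> (real \<Rightarrow> real \<Rightarrow> 'a \<Rightarrow> 'a set) \<Rightarrow> (real \<Rightarrow> 'a set) \<Rightarrow> bool" where
  "forward_attracting X U K \<longleftrightarrow> (\<forall>B t0. bounded B \<and> B \<subseteq> X \<longrightarrow>
     ((\<lambda>t. semidist (\<Union>x\<in>B. U t t0 x) (K t)) \<longlongrightarrow> 0) at_top)"

definition pullback_attractor ::
    "'a::metric_space set \<Rightarrow> (real \<Rightarrow> real \<Rightarrow> 'a \<Rightarrow> 'a set) \<Rightarrow> (real \<Rightarrow> 'a set) \<Rightarrow> bool" where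
  "pullback_attractor X U \<A> \<longleftrightarrow>
     (\<forall>t. \<A> t \<subseteq> X \<and> \<A> t \<noteq> {} \<and> compact (\<A> t)) \<and>
     negatively_invariant U \<A> \<and> pullback_attracting X U \<A> \<and>
     (\<forall>K. (\<forall>t. closedin (top_of_set X) (K t)) \<and> pullback_attracting X U K
        \<longrightarrow> (\<forall>t. \<A> t \<subseteq> K t))"

definition forward_attractor ::
    "'a::metric_space set \<Rightarrow> (real \<Rightarrow> real \<Rightarrow> 'a \<Rightarrow> 'a set) \<Rightarrow> (real \<Rightarrow> 'a set) \<Rightarrow> bool" where
  "forward_attractor X U \<A> \<longleftrightarrow>
     (\<forall>t. \<A> t \<subseteq> X \<and> \<A> t \<noteq> {} \<and> compact (\<A> t)) \<and>
     negatively_invariant U \<A> \<and> forward_attracting X U \<A>"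

end

theory Submission
  imports Defs
begin

text \<open>A nonnegative solution vanishes up to some time and is then positive almost everywhere, since the
  Dirichlet heat kernel is strictly positive. While it is positive the inclusion is the linear
  equation \<open>u' + A u = b + \<omega> u\<close>, and two solutions of this equation approach each other like
  \<open>exp (- (\<pi>\<^sup>2 - \<omega>1) t)\<close>. The linear solution \<open>z\<close> starting from zero at time \<open>s\<close>, extended by zero
  to the past, is itself a nonnegative solution starting from zero at every earlier time; pullback
  attraction therefore puts \<open>z t\<close> (and 0) into the pullback attractor at time \<open>t\<close>. Hence every
  solution is exponentially close to a point of the attractor, uniformly on bounded sets of
  initial values.

  Everything is computed in the basis of eigenfunctions. Positivity of the heat kernel follows from
  the product representation of the theta function, in which each factor is decreasing on
  \<open>[0, \<pi>]\<close>.\<close>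

text \<open>Where \<open>u\<close> vanishes, the inclusion leaves the forcing \<open>r\<close>
  undetermined in \<open>[-b, b]\<close>. The equation settles it: on the zero set of the
  nonnegative \<open>u\<close> both the time derivative and \<open>A u\<close> vanish almost
  everywhere, so \<open>r\<close> is 0 there. This puts \<open>r\<close> in the positive cone, and
  only then does positivity of the heat kernel apply to the nonlinear problem. Strong solutions are
  merely absolutely continuous in time, so they are tested with finite sums of eigenfunctions: this
  gives real functions, for which a bound on the derivative almost everywhere can be integrated. The
  price is that truncated heat kernels are not positive; the defect is a tail of the eigenfunction
  series, uniformly small as long as the time argument stays away from 0. A solution that leaves
  zero at a time \<open>s\<close> after its start coincides with \<open>z\<close> from then on. A
  positive distance to this comparison solution can only come from a nonzero initial value, and it
  contracts at the rate given by the first eigenvalue \<open>pi\<^sup>2\<close> minus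
  \<open>\<omega>1\<close>.\<close>

lemma measurable_I01: "f \<in> borel_measurable borel \<Longrightarrow> f \<in> borel_measurable I01"
  for f :: "real \<Rightarrow> 'a::topological_space"
  by (rule measurable_restrict_space1) simp

lemma emeasure_I01_space: "emeasure I01 (space I01) = 1"
  by (subst emeasure_restrict_space) (auto simp: space_restrict_space)

interpretation I01: finite_measure I01
  by standard (unfold emeasure_I01_space, simp)

lemma measure_I01_space [simp]: "measure I01 (space I01) = 1"
  unfolding measure_def emeasure_I01_space by simp

lemma space_I01: "space I01 = {0<..<1}"
  by (simp add: space_restrict_space)

lemma square_integrable_bounded:
  assumes "f \<in> borel_measurable I01" "\<And>x. 0 < x \<Longrightarrow> x < 1 \<Longrightarrow> \<bar>f x\<bar> \<le> C"
  shows "square_integrable f"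
  unfolding square_integrable_def
proof (intro conjI assms(1))
  show "integrable I01 (\<lambda>x. (f x)\<^sup>2)"
    using assms
    by (intro I01.integrable_const_bound[where B = "C\<^sup>2"])
       (auto intro!: AE_I2 simp: space_I01 abs_le_square_iff[symmetric] intro: order.trans[OF _ abs_ge_self])
qed

lemma square_integrable_integrable:
  assumes "square_integrable f" shows "integrable I01 f"
  using square_integrable_mult[OF assms square_integrable_bounded[of "\<lambda>x. 1" 1]] by simp

lemma square_integrable_rep' [simp]: "square_integrable (rep_l2 v)"
  by (rule square_integrable_rep)

lemma rep_measurable [measurable, simp]: "rep_l2 v \<in> borel_measurable I01"
  using square_integrable_rep[of v] by (simp add: square_integrable_def)

section \<open>Representatives, inner products and norms in the quotient space\<close>

lemma l2_eq_iff: "v = w \<longleftrightarrow> (AE x in I01. rep_l2 v x = rep_l2 w x)"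
proof
  assume "AE x in I01. rep_l2 v x = rep_l2 w x"
  then have "l2_rel (rep_l2 v) (rep_l2 w)" by (simp add: l2_rel_def)
  then have "abs_l2 (rep_l2 v) = abs_l2 (rep_l2 w)"
    using Quotient_l2 by (metis Quotient_rel_abs)
  then show "v = w" using Quotient_l2 by (metis Quotient_abs_rep)
qed simp

lemma abs_rep_l2 [simp]: "abs_l2 (rep_l2 v) = v"
  using Quotient_l2 by (metis Quotient_abs_rep)

lemma l2_rel_refl: "square_integrable f \<Longrightarrow> l2_rel f f"
  by (simp add: l2_rel_def)

lemma rep_0: "AE x in I01. rep_l2 0 x = 0"
  unfolding zero_l2_def by (rule rep_abs_l2) (rule square_integrable_0)

lemma rep_add: "AE x in I01. rep_l2 (v + w) x = rep_l2 v x + rep_l2 w x"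
proof -
  have "v + w = abs_l2 (\<lambda>x. rep_l2 v x + rep_l2 w x)"
    using plus_l2.abs_eq[of "rep_l2 v" "rep_l2 w"] by (simp add: l2_rel_refl)
  then show ?thesis using rep_abs_l2 square_integrable_add square_integrable_rep by metis
qed

lemma rep_scaleR: "AE x in I01. rep_l2 (c *\<^sub>R v) x = c * rep_l2 v x"
proof -
  have "c *\<^sub>R v = abs_l2 (\<lambda>x. c * rep_l2 v x)"
    using scaleR_l2.abs_eq[of "rep_l2 v" c] by (simp add: l2_rel_refl)
  then show ?thesis using rep_abs_l2 square_integrable_scale square_integrable_rep by metis
qed

lemma rep_uminus: "AE x in I01. rep_l2 (- v) x = - rep_l2 v x"
  using rep_scaleR[of "-1" v] by simp

lemma rep_diff: "AE x in I01. rep_l2 (v - w) x = rep_l2 v x - rep_l2 w x"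
  using rep_add[of v "-w"] rep_uminus[of w] by auto

lemma inner_rep: "inner v w = (\<integral>x. rep_l2 v x * rep_l2 w x \<partial>I01)"
  using inner_l2.abs_eq[of "rep_l2 v" "rep_l2 w"] by (simp add: l2_rel_refl)

lemma inner_abs: "square_integrable f \<Longrightarrow> inner v (abs_l2 f) = (\<integral>x. rep_l2 v x * f x \<partial>I01)"
  using inner_l2.abs_eq[of "rep_l2 v" f] by (simp add: l2_rel_refl)

lemma inner_abs_abs:
  "square_integrable f \<Longrightarrow> square_integrable g \<Longrightarrow> inner (abs_l2 f) (abs_l2 g) = (\<integral>x. f x * g x \<partial>I01)"
  using inner_l2.abs_eq[of f g] by (simp add: l2_rel_refl)

lemma integrable_rep_mult:
  "square_integrable f \<Longrightarrow> integrable I01 (\<lambda>x. rep_l2 v x * f x)"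
  by (rule square_integrable_mult) auto

lemma integrable_rep [simp]: "integrable I01 (rep_l2 v)"
  by (rule square_integrable_integrable) simp

lemma norm_abs_l2: "square_integrable f \<Longrightarrow> (norm (abs_l2 f))\<^sup>2 = (\<integral>x. (f x)\<^sup>2 \<partial>I01)"
  unfolding power2_norm_eq_inner by (simp add: inner_abs_abs power2_eq_square)

lemma norm_rep_l2: "(norm v)\<^sup>2 = (\<integral>x. (rep_l2 v x)\<^sup>2 \<partial>I01)"
  unfolding power2_norm_eq_inner by (simp add: inner_rep power2_eq_square)

lemma abs_l2_eqI:
  assumes "AE x in I01. rep_l2 v x = f x" "square_integrable f" shows "abs_l2 f = v"
  using assms rep_abs_l2[OF assms(2)] by (auto simp: l2_eq_iff)

lemma abs_l2_add: "square_integrable f \<Longrightarrow> square_integrable g \<Longrightarrow>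
    abs_l2 (\<lambda>x. f x + g x) = abs_l2 f + abs_l2 g"
  using plus_l2.abs_eq[of f g] by (simp add: l2_rel_refl)

lemma abs_l2_diff: "square_integrable f \<Longrightarrow> square_integrable g \<Longrightarrow>
    abs_l2 (\<lambda>x. f x - g x) = abs_l2 f - abs_l2 g"
  using minus_l2.abs_eq[of f g] by (simp add: l2_rel_refl)

lemma abs_l2_scale: "square_integrable f \<Longrightarrow> abs_l2 (\<lambda>x. c * f x) = c *\<^sub>R abs_l2 f"
  using scaleR_l2.abs_eq[of f c] by (simp add: l2_rel_refl)

lemma square_integrable_abs: "square_integrable f \<Longrightarrow> square_integrable (\<lambda>x. \<bar>f x\<bar>)"
  by (auto simp: square_integrable_def intro: borel_measurable_abs)

lemma square_integrable_sum:
  "(\<And>i. i \<in> A \<Longrightarrow> square_integrable (f i)) \<Longrightarrow> square_integrable (\<lambda>x. \<Sum>i\<in>A. f i x)"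
  by (induction A rule: infinite_finite_induct)
     (auto simp: square_integrable_0 intro: square_integrable_add)

lemma abs_l2_sum:
  "(\<And>i. i \<in> A \<Longrightarrow> square_integrable (f i)) \<Longrightarrow>
    abs_l2 (\<lambda>x. \<Sum>i\<in>A. f i x) = (\<Sum>i\<in>A. abs_l2 (f i))"
  by (induction A rule: infinite_finite_induct)
     (auto simp: abs_l2_add square_integrable_sum zero_l2_def[symmetric])

section \<open>The fundamental theorem of calculus on the unit interval\<close>

lemma I01_integral_FTC:
  fixes F f :: "real \<Rightarrow> real"
  assumes "0 \<le> a" "a \<le> c" "c \<le> 1"
    and "\<And>x. (F has_real_derivative f x) (at x)" and "continuous_on UNIV f"
  shows "(\<integral>x. f x * indicator {a..c} x \<partial>I01) = F c - F a"
proof -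
  have "(\<integral>x. f x * indicator {a..c} x \<partial>I01) = (\<integral>x. indicator {0<..<1} x *\<^sub>R (f x * indicator {a..c} x) \<partial>lborel)"
    by (subst integral_restrict_space) auto
  also have "\<dots> = (\<integral>x. f x * indicator {a..c} x \<partial>lborel)"
  proof (rule integral_cong_AE)
    have [measurable]: "f \<in> borel_measurable borel"
      using assms(5) by (rule borel_measurable_continuous_onI)
    show "(\<lambda>x. indicator {0<..<1} x *\<^sub>R (f x * indicator {a..c} x)) \<in> borel_measurable lborel" 
      "(\<lambda>x. f x * indicator {a..c} x) \<in> borel_measurable lborel" by measurable
    \<comment> \<open>The open interval misses at most the two end points of
      \<open>{a..c}\<close>.\<close>
    have "AE x in lborel. x \<noteq> 0 \<and> x \<noteq> (1::real)"
      using AE_lborel_singleton[of "0::real"] AE_lborel_singleton[of "1::real"] by auto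
    then show "AE x in lborel. indicator {0<..<1} x *\<^sub>R (f x * indicator {a..c} x) = f x * indicator {a..c} x"
      by (rule AE_mp) (use assms(1-3) in \<open>auto intro!: AE_I2 simp: indicator_def\<close>)
  qed
  also have "\<dots> = F c - F a"
    using assms by (intro integral_FTC_Icc_real)
      (auto simp: continuous_on_eq_continuous_at)
  finally show ?thesis .
qed

lemma I01_integral_FTC_full:
  fixes F f :: "real \<Rightarrow> real"
  assumes "\<And>x. (F has_real_derivative f x) (at x)" and "continuous_on UNIV f"
  shows "(\<integral>x. f x \<partial>I01) = F 1 - F 0"
proof -
  have "(\<integral>x. f x \<partial>I01) = (\<integral>x. f x * indicator {0..1} x \<partial>I01)"
    by (intro Bochner_Integration.integral_cong) (auto simp: space_I01)
  then show ?thesis using I01_integral_FTC[of 0 1 F f] assms by simp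
qed

lemma Hplus_inner_nonneg:
  assumes "v \<in> Hplus" "w \<in> Hplus" shows "0 \<le> inner v w"
  unfolding inner_rep using assms by (intro integral_nonneg_AE) (auto simp: Hplus_def)

section \<open>The Jacobi triple product\<close>

text \<open>The q-Pochhammer symbol (q; q)_n.\<close>

definition qfac :: "real \<Rightarrow> nat \<Rightarrow> real" where
  "qfac q n = (\<Prod>j<n. 1 - q ^ Suc j)"

lemma qfac_0 [simp]: "qfac q 0 = 1" by (simp add: qfac_def)
lemma qfac_Suc: "qfac q (Suc n) = qfac q n * (1 - q ^ Suc n)" by (simp add: qfac_def)

lemma qfac_pos: "0 < q \<Longrightarrow> q < 1 \<Longrightarrow> 0 < qfac q n"
  unfolding qfac_def by (intro prod_pos) (auto simp: power_Suc_less_one simp del: power_Suc)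

lemma qfac_decseq: "0 < q \<Longrightarrow> q < 1 \<Longrightarrow> decseq (qfac q)"
  by (intro decseq_SucI) (use qfac_pos[of q] in \<open>auto simp: qfac_Suc mult_le_cancel_left1 simp del: power_Suc\<close>)

text \<open>The series of the \<open>q ^ Suc j\<close> converges, so the infinite product converges
  to a nonzero limit; as the partial products decrease, this limit bounds all of them from
  below.\<close>

lemma qfac_limit:
  assumes "0 < q" "q < 1"
  obtains p where "0 < p" "qfac q \<longlonglongrightarrow> p" "\<And>n. p \<le> qfac q n"
proof -
  let ?f = "\<lambda>j. 1 - q ^ Suc j"
  have "summable (\<lambda>j. norm (?f j - 1))"
    using assms by (auto intro!: summable_mult simp: summable_geometric_iff)
  then have c: "convergent_prod ?f"
    by (intro abs_convergent_prod_imp_convergent_prod summable_imp_abs_convergent_prod)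
  have nz: "?f j \<noteq> 0" for j
    using power_Suc_less_one[of q j] assms by auto
  have "(\<lambda>n. \<Prod>i\<le>n. ?f i) \<longlonglongrightarrow> prodinf ?f"
    using c by (rule convergent_prod_LIMSEQ)
  then have "(\<lambda>n. qfac q (Suc n)) \<longlonglongrightarrow> prodinf ?f"
    by (simp add: qfac_def lessThan_Suc_atMost)
  then have lim: "qfac q \<longlonglongrightarrow> prodinf ?f"
    by (simp add: filterlim_sequentially_Suc)
  have le: "prodinf ?f \<le> qfac q n" for n
    using decseq_ge[OF qfac_decseq[OF assms] lim] .
  have "prodinf ?f \<ge> 0"
    using lim by (rule LIMSEQ_le_const) (use qfac_pos[OF assms] in \<open>auto intro: less_imp_le\<close>)
  with prodinf_nonzero[OF c nz] have "prodinf ?f > 0" by simp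
  with lim le that show ?thesis by blast
qed

text \<open>The Fourier coefficients of the finite Jacobi triple product
  \<open>\<Prod>n<N. (1 + q\<^bsup>2n+1\<^esup> w) (1 + q\<^bsup>2n+1\<^esup> / w)\<close> with \<open>w = exp (\<i> \<theta>)\<close>; divided by the coefficient at 0
  they tend to those of the theta function as \<open>N \<rightarrow> \<infinity>\<close>.\<close>

definition jtp_coeff :: "real \<Rightarrow> nat \<Rightarrow> nat \<Rightarrow> real" where
  "jtp_coeff q N k = (if k \<le> N
     then q ^ (k\<^sup>2) * qfac (q\<^sup>2) (2 * N) / (qfac (q\<^sup>2) (N + k) * qfac (q\<^sup>2) (N - k)) else 0)"

lemma jtp_coeff_above: "N < k \<Longrightarrow> jtp_coeff q N k = 0"
  by (simp add: jtp_coeff_def)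

text \<open>For bringing quotients of q-factorials to one common denominator; \<open>u\<close> and
  \<open>v\<close> are the inserted factors.\<close>

lemma jtp_cancel:
  fixes c s P F m u v :: real
  assumes "u \<noteq> 0" "v \<noteq> 0"
  shows "c * s * P / (F * m) = c * P / (F * (m * u * v)) * (s * u * v)"
    and "c * s * P / (F * m) = c * P / ((F * u * v) * m) * (s * u * v)"
    and "c * P / (F * m) = c * P / ((F * u) * (m * v)) * (u * v)"
  using assms by (simp_all add: mult_ac)

text \<open>The recursion for the coefficients turns into a polynomial identity once all of them
  carry the same denominator, which has one factor more in each of its two q-factorials. This lemma
  and the next two do so for the upper neighbour, the lower neighbour and the coefficient
  itself.\<close>

lemma jtp_coeff_next:
  assumes "0 < q" "q < 1" "k \<le> N"
  shows "q ^ (2 * N + 1) * jtp_coeff q N (Suc k) =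
    q ^ (k\<^sup>2) * qfac (q\<^sup>2) (2 * N) / (qfac (q\<^sup>2) (Suc (N + k)) * qfac (q\<^sup>2) (Suc (N - k))) *
     ((q\<^sup>2) ^ Suc (N + k) * (1 - (q\<^sup>2) ^ (N - k)) * (1 - (q\<^sup>2) ^ Suc (N - k)))"
proof (cases "k = N")
  case False
  let ?Q = "q\<^sup>2"
  have Q: "0 < ?Q" "?Q < 1" using assms by (auto simp: power_less_one_iff)
  have neq: "qfac ?Q n \<noteq> 0" "1 - ?Q ^ Suc n \<noteq> 0" for n
    using qfac_pos[OF Q, of n] power_Suc_less_one[OF Q, of n] by auto
  define m where "m = N - Suc k"
  have N: "N = Suc (k + m)" using False assms(3) by (simp add: m_def)
  have "q ^ (2 * N + 1) * q ^ ((Suc k)\<^sup>2) = q ^ (k\<^sup>2) * ?Q ^ Suc (N + k)"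
    unfolding power_mult[symmetric] power_add[symmetric]
    by (rule arg_cong[where f = "\<lambda>n. q ^ n"]) (simp add: power2_eq_square)
  then have h1: "q ^ (2 * N + 1) * jtp_coeff q N (Suc k) =
     q ^ (k\<^sup>2) * ?Q ^ Suc (N + k) * qfac ?Q (2 * N) / (qfac ?Q (Suc (N + k)) * qfac ?Q m)"
    using N by (simp add: jtp_coeff_def del: power_Suc)
  have h2: "qfac ?Q (Suc (N - k)) = qfac ?Q m * (1 - ?Q ^ (N - k)) * (1 - ?Q ^ Suc (N - k))"
    using N by (simp add: qfac_Suc Suc_diff_le del: power_Suc)
  have h3: "1 - ?Q ^ (N - k) \<noteq> 0" using neq(2)[of m] N by simp
  show ?thesis unfolding h1 h2 by (rule jtp_cancel(1)[OF h3 neq(2)])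
\<comment> \<open>At \<open>k = N\<close> both sides are 0, the right one through the factor with
  \<open>N - k = 0\<close> in the exponent.\<close>
qed (simp add: jtp_coeff_def)

lemma jtp_coeff_prev:
  assumes "0 < q" "q < 1" "k < N"
  shows "q ^ (2 * N + 1) * jtp_coeff q N k =
    q ^ ((Suc k)\<^sup>2) * qfac (q\<^sup>2) (2 * N) / (qfac (q\<^sup>2) (Suc (N + Suc k)) * qfac (q\<^sup>2) (Suc (N - Suc k))) *
     ((q\<^sup>2) ^ Suc (N - Suc k) * (1 - (q\<^sup>2) ^ (N + Suc k)) * (1 - (q\<^sup>2) ^ Suc (N + Suc k)))"
proof -
  let ?Q = "q\<^sup>2"
  have Q: "0 < ?Q" "?Q < 1" using assms by (auto simp: power_less_one_iff)
  have neq: "qfac ?Q n \<noteq> 0" "1 - ?Q ^ Suc n \<noteq> 0" for n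
    using qfac_pos[OF Q, of n] power_Suc_less_one[OF Q, of n] by auto
  define m where "m = N - Suc k"
  have N: "N = Suc (k + m)" using assms(3) by (simp add: m_def)
  have "q ^ (2 * N + 1) * q ^ (k\<^sup>2) = q ^ ((Suc k)\<^sup>2) * ?Q ^ Suc m"
    unfolding power_mult[symmetric] power_add[symmetric]
    by (rule arg_cong[where f = "\<lambda>n. q ^ n"]) (simp add: power2_eq_square N)
  then have h1: "q ^ (2 * N + 1) * jtp_coeff q N k =
     q ^ ((Suc k)\<^sup>2) * ?Q ^ Suc m * qfac ?Q (2 * N) / (qfac ?Q (N + k) * qfac ?Q (Suc m))"
    using N by (simp add: jtp_coeff_def del: power_Suc)
  have h2: "qfac ?Q (Suc (N + Suc k)) = qfac ?Q (N + k) * (1 - ?Q ^ (N + Suc k)) * (1 - ?Q ^ Suc (N + Suc k))"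
    by (simp add: qfac_Suc del: power_Suc)
  have h3: "1 - ?Q ^ (N + Suc k) \<noteq> 0" using neq(2)[of "N + k"] by simp
  have h4: "Suc (N - Suc k) = Suc m" by (simp add: m_def)
  show ?thesis unfolding h1 h2 h4 by (rule jtp_cancel(2)[OF h3 neq(2)])
qed

lemma jtp_coeff_same:
  assumes "0 < q" "q < 1" "k \<le> N"
  defines "Q \<equiv> q\<^sup>2"
  defines "D \<equiv> q ^ (k\<^sup>2) * qfac Q (2 * N) / (qfac Q (Suc (N + k)) * qfac Q (Suc (N - k)))"
  shows "jtp_coeff q N k = D * ((1 - Q ^ Suc (N + k)) * (1 - Q ^ Suc (N - k)))"
    and "jtp_coeff q (Suc N) k = D * ((1 - Q * (Q ^ (N + k) * Q ^ (N - k))) * (1 - Q * (Q * (Q ^ (N + k) * Q ^ (N - k)))))"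
    and "q ^ (4 * N + 2) = Q * (Q ^ (N + k) * Q ^ (N - k))"
proof -
  have Q: "0 < Q" "Q < 1" using assms by (auto simp: power_less_one_iff)
  have neq: "qfac Q n \<noteq> 0" "1 - Q ^ Suc n \<noteq> 0" for n
    using qfac_pos[OF Q, of n] power_Suc_less_one[OF Q, of n] by auto
  show "jtp_coeff q N k = D * ((1 - Q ^ Suc (N + k)) * (1 - Q ^ Suc (N - k)))"
    using assms(3) unfolding D_def qfac_Suc jtp_cancel(3)[OF neq(2) neq(2), symmetric]
    by (simp add: jtp_coeff_def Q_def)
  have e: "Q ^ Suc (2 * N) = Q * (Q ^ (N + k) * Q ^ (N - k))"
     "Q ^ Suc (Suc (2 * N)) = Q * (Q * (Q ^ (N + k) * Q ^ (N - k)))"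
    using assms(3) by (simp_all add: power_add[symmetric] mult_2)
  show "jtp_coeff q (Suc N) k = D * ((1 - Q * (Q ^ (N + k) * Q ^ (N - k))) * (1 - Q * (Q * (Q ^ (N + k) * Q ^ (N - k)))))"
    using assms(3) unfolding D_def e[symmetric]
    by (simp add: jtp_coeff_def qfac_Suc Q_def[symmetric] Suc_diff_le mult.assoc power_Suc[of Q "Suc (2 * N)"] del: power_Suc)
  have "q ^ (4 * N + 2) = Q ^ Suc (2 * N)"
    unfolding Q_def power_mult[symmetric] by (rule arg_cong[where f = "\<lambda>n. q ^ n"]) simp
  then show "q ^ (4 * N + 2) = Q * (Q ^ (N + k) * Q ^ (N - k))" by (simp only: e(1))
qed

text \<open>The recursion for the coefficients over the common denominator, with \<open>X\<close>
  for \<open>Q ^ (N + k)\<close> and \<open>Y\<close> for \<open>Q ^ (N - k)\<close>.\<close>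

lemma jtp_identity:
  fixes D Q X Y :: real
  shows "D * ((1 - Q * (X * Y)) * (1 - Q * (Q * (X * Y)))) =
    (1 + Q * (X * Y)) * (D * ((1 - Q * X) * (1 - Q * Y))) +
    D * (Q * Y * (1 - X) * (1 - Q * X)) + D * (Q * X * (1 - Y) * (1 - Q * Y))"
  by (simp add: algebra_simps)

text \<open>Multiplying by the next factor of the product,
  \<open>1 + 2 * q ^ (2 * N + 1) * cos \<theta> + q ^ (4 * N + 2)\<close>, couples each frequency
  with its two neighbours. At frequency 0 these are -1 and 1, whose coefficients agree; hence the
  2.\<close>

lemma jtp_coeff_rec_0:
  assumes "0 < q" "q < 1"
  shows "jtp_coeff q (Suc N) 0 =
    (1 + q ^ (4 * N + 2)) * jtp_coeff q N 0 + 2 * (q ^ (2 * N + 1) * jtp_coeff q N (Suc 0))"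
proof -
  note s = jtp_coeff_same[OF assms, of 0 N, unfolded power_Suc] jtp_coeff_next[OF assms, of 0 N, unfolded power_Suc]
  have N: "0 \<le> N" "N + 0 = N" "N - 0 = N" by auto
  show ?thesis
    unfolding s(1)[OF N(1)] s(2)[OF N(1)] s(3)[OF N(1)] s(4)[OF N(1)] N(2,3) jtp_identity
    by (simp add: algebra_simps)
qed

lemma jtp_coeff_rec_Suc:
  assumes q: "0 < q" "q < 1"
  shows "jtp_coeff q (Suc N) (Suc k) = (1 + q ^ (4 * N + 2)) * jtp_coeff q N (Suc k) +
    q ^ (2 * N + 1) * jtp_coeff q N k + q ^ (2 * N + 1) * jtp_coeff q N (Suc (Suc k))"
proof -
  consider "k < N" | "k = N" | "N < k" by linarith
  then show ?thesis
  proof cases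
    case 1
    show ?thesis
      unfolding jtp_coeff_next[OF q Suc_leI[OF 1]] jtp_coeff_prev[OF q 1]
        jtp_coeff_same[OF q Suc_leI[OF 1]] power_Suc jtp_identity
      by (simp only:)
  next
    \<comment> \<open>The new top frequency receives a contribution from its lower neighbour
      only.\<close>
    case 2
    have Q: "0 < q\<^sup>2" "q\<^sup>2 < 1" using q by (auto simp: power_less_one_iff)
    have "qfac (q\<^sup>2) n \<noteq> 0" for n using qfac_pos[OF Q, of n] by simp
    moreover have "q ^ ((Suc N)\<^sup>2) = q ^ (2 * N + 1) * q ^ (N\<^sup>2)"
      unfolding power_add[symmetric] by (rule arg_cong[where f = "\<lambda>n. q ^ n"]) (simp add: power2_eq_square)
    ultimately show ?thesis using 2 by (simp add: jtp_coeff_def mult_2[symmetric] del: power_Suc)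
  qed (simp add: jtp_coeff_above)
qed

lemma jtp_coeff_nonneg: "0 < q \<Longrightarrow> q < 1 \<Longrightarrow> 0 \<le> jtp_coeff q N k"
  unfolding jtp_coeff_def
  using qfac_pos[of "q\<^sup>2"] by (auto simp: power_less_one_iff less_imp_le)

text \<open>The bound \<open>M\<close> is free so that the induction step can sum over the same
  range for \<open>N\<close> and \<open>Suc N\<close>; the surplus coefficients vanish.\<close>

lemma jtp_finite:
  assumes q: "0 < q" "q < 1"
  shows "N \<le> M \<Longrightarrow> (\<Prod>n<N. 1 + 2 * q ^ (2 * n + 1) * cos \<theta> + q ^ (4 * n + 2)) =
    jtp_coeff q N 0 + 2 * (\<Sum>k<M. jtp_coeff q N (Suc k) * cos (real (Suc k) * \<theta>))"
proof (induction N arbitrary: M)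
  case 0
  have "(\<Sum>k<M. jtp_coeff q 0 (Suc k) * cos (real (Suc k) * \<theta>)) = 0"
    by (intro sum.neutral) (simp add: jtp_coeff_def)
  then show ?case by (simp add: jtp_coeff_def)
next
  case (Suc N)
  let ?a = "jtp_coeff q N" and ?p = "q ^ (2 * N + 1)" and ?r = "1 + q ^ (4 * N + 2)"
  let ?c = "\<lambda>k. cos (real k * \<theta>)"
  define S where "S = (\<Sum>k<M. ?a (Suc k) * ?c (Suc k))"
  obtain M' where M: "M = Suc M'" using Suc.prems by (cases M) auto
  have z: "?a M = 0" "?a (Suc M) = 0" using Suc.prems by (auto intro: jtp_coeff_above)
  have cc: "2 * cos \<theta> * ?c (Suc k) = ?c k + ?c (Suc (Suc k))" for k
  proof -
    have "2 * cos \<theta> * ?c (Suc k) = cos (real (Suc k) * \<theta> - \<theta>) + cos (real (Suc k) * \<theta> + \<theta>)"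
      by (simp add: cos_add cos_diff)
    then show ?thesis by (simp add: algebra_simps)
  qed
  have s1: "(\<Sum>k<M. ?a (Suc k) * ?c k) = ?a (Suc 0) + (\<Sum>k<M. ?a (Suc (Suc k)) * ?c (Suc k))"
    using z sum.lessThan_Suc_shift[of "\<lambda>k. ?a (Suc k) * ?c k" M'] by (simp add: M)
  have s2: "(\<Sum>k<M. ?a (Suc k) * ?c (Suc (Suc k))) + ?a 0 * cos \<theta> = (\<Sum>k<M. ?a k * ?c (Suc k))"
    using z sum.lessThan_Suc_shift[of "\<lambda>k. ?a k * ?c (Suc k)" M'] by (simp add: M)
  have "2 * cos \<theta> * S = (\<Sum>k<M. ?a (Suc k) * (2 * cos \<theta> * ?c (Suc k)))"
    by (simp add: S_def sum_distrib_left algebra_simps)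
  also have "\<dots> = (\<Sum>k<M. ?a (Suc k) * ?c k) + (\<Sum>k<M. ?a (Suc k) * ?c (Suc (Suc k)))"
    by (simp only: cc distrib_left sum.distrib)
  finally have "2 * cos \<theta> * S + ?a 0 * cos \<theta> = ?a (Suc 0) + (\<Sum>k<M. ?a (Suc (Suc k)) * ?c (Suc k)) + (\<Sum>k<M. ?a k * ?c (Suc k))"
    using s1 s2 by simp
  then have e: "?p * (2 * cos \<theta> * S) = ?p * ?a (Suc 0) + ?p * (\<Sum>k<M. ?a (Suc (Suc k)) * ?c (Suc k)) + ?p * (\<Sum>k<M. ?a k * ?c (Suc k)) - ?p * ?a 0 * cos \<theta>"
    unfolding eq_diff_eq distrib_left[symmetric] mult.assoc by (simp only: mult.assoc)
  have f: "(\<Sum>k<M. jtp_coeff q (Suc N) (Suc k) * ?c (Suc k)) =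
     ?r * S + ?p * (\<Sum>k<M. ?a k * ?c (Suc k)) + ?p * (\<Sum>k<M. ?a (Suc (Suc k)) * ?c (Suc k))"
    unfolding jtp_coeff_rec_Suc[OF q] S_def
    by (simp only: distrib_right sum.distrib sum_distrib_left mult.assoc)
  have "(\<Prod>n<Suc N. 1 + 2 * q ^ (2 * n + 1) * cos \<theta> + q ^ (4 * n + 2)) =
     (?r + 2 * ?p * cos \<theta>) * (?a 0 + 2 * S)"
    using Suc.IH[of M] Suc.prems by (simp add: S_def algebra_simps)
  also have "\<dots> = ?r * ?a 0 + 2 * (?r * S) + 2 * ?p * ?a 0 * cos \<theta> + 2 * (?p * (2 * cos \<theta> * S))"
    by (simp add: algebra_simps)
  also have "\<dots> = jtp_coeff q (Suc N) 0 + 2 * (\<Sum>k<M. jtp_coeff q (Suc N) (Suc k) * ?c (Suc k))"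
    unfolding e f jtp_coeff_rec_0[OF q] by (simp add: algebra_simps)
  finally show ?case .
qed

text \<open>The factor \<open>qfac (q\<^sup>2) (2 * N)\<close> cancels in the quotient, and the
  remaining q-factorials all have the same positive limit.\<close>

lemma jtp_coeff_ratio_tendsto:
  assumes q: "0 < q" "q < 1"
  shows "(\<lambda>N. jtp_coeff q N k / jtp_coeff q N 0) \<longlonglongrightarrow> q ^ (k\<^sup>2)"
proof -
  let ?P = "qfac (q\<^sup>2)"
  have Q: "0 < q\<^sup>2" "q\<^sup>2 < 1" using q by (auto simp: power_less_one_iff)
  obtain p where p: "0 < p" "?P \<longlonglongrightarrow> p" using qfac_limit[OF Q] by metis
  have pos: "0 < ?P n" for n by (rule qfac_pos[OF Q])
  have "(\<lambda>N. q ^ (k\<^sup>2) * (?P N)\<^sup>2 / (?P (N + k) * ?P (N - k))) \<longlonglongrightarrow> q ^ (k\<^sup>2) * p\<^sup>2 / (p * p)"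
    using p by (intro tendsto_intros LIMSEQ_ignore_initial_segment)
      (auto simp: filterlim_minus_const_nat_at_top intro: filterlim_compose[OF p(2)])
  then have "(\<lambda>N. q ^ (k\<^sup>2) * (?P N)\<^sup>2 / (?P (N + k) * ?P (N - k))) \<longlonglongrightarrow> q ^ (k\<^sup>2)"
    using p(1) by (simp add: power2_eq_square)
  moreover have "eventually (\<lambda>N. q ^ (k\<^sup>2) * (?P N)\<^sup>2 / (?P (N + k) * ?P (N - k)) = jtp_coeff q N k / jtp_coeff q N 0) sequentially"
    using eventually_ge_at_top[of k]
  proof eventually_elim
    case (elim N)
    have ne: "?P n \<noteq> 0" for n using pos[of n] by simp
    show ?case using elim ne by (simp add: jtp_coeff_def power2_eq_square[of "?P N"])
  qed
  ultimately show ?thesis by (rule Lim_transform_eventually)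
qed

text \<open>The series is half the difference of two values of the theta function, hence the limit
  of differences of finite products divided by \<open>jtp_coeff q N 0\<close>. All factors increase
  with the cosine, so these differences are positive; strictness survives the limit because of a
  lower bound that does not depend on \<open>N\<close>.\<close>

lemma theta_kernel_pos:
  assumes q: "0 < q" "q < 1" and ab: "cos \<beta> < cos \<alpha>"
  shows "0 < (\<Sum>k. q ^ ((Suc k)\<^sup>2) * (cos (real (Suc k) * \<alpha>) - cos (real (Suc k) * \<beta>)))"
proof -
  let ?P = "qfac (q\<^sup>2)" and ?a = "jtp_coeff q"
  define d where "d k = cos (real (Suc k) * \<alpha>) - cos (real (Suc k) * \<beta>)" for k
  have d2: "\<bar>d k\<bar> \<le> 2" for k
    unfolding d_def using cos_le_one[of "real (Suc k) * \<alpha>"] cos_ge_minus_one[of "real (Suc k) * \<alpha>"]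
      cos_le_one[of "real (Suc k) * \<beta>"] cos_ge_minus_one[of "real (Suc k) * \<beta>"] by linarith
  have Q: "0 < q\<^sup>2" "q\<^sup>2 < 1" using q by (auto simp: power_less_one_iff)
  obtain p where p: "0 < p" "\<And>n. p \<le> ?P n" using qfac_limit[OF Q] by metis
  obtain r where r: "0 < r" "\<And>n. r \<le> qfac q n" using qfac_limit[OF q] by metis
  have pos: "0 < ?P n" for n by (rule qfac_pos[OF Q])
  have P1: "?P n \<le> 1" for n using decseqD[OF qfac_decseq[OF Q], of 0 n] by simp
  have a0: "0 < ?a N 0" "?a N 0 \<le> 1 / (p * p)" for N
  proof -
    show "0 < ?a N 0" using pos by (simp add: jtp_coeff_def)
    have "?P (2 * N) / (?P N * ?P N) \<le> 1 / (p * p)"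
      using p pos P1 less_imp_le[OF pos] by (intro frac_le mult_mono mult_pos_pos) auto
    then show "?a N 0 \<le> 1 / (p * p)" by (simp add: jtp_coeff_def)
  qed
  \<comment> \<open>A majorant independent of \<open>N\<close>, as dominated convergence of the
    series requires; the exponent \<open>k\<^sup>2\<close> is weakened to \<open>k\<close>.\<close>
  have ratio: "?a N k / ?a N 0 \<le> q ^ k * (1 / (p * p))" "0 \<le> ?a N k / ?a N 0" for N k
  proof -
    show "0 \<le> ?a N k / ?a N 0" using jtp_coeff_nonneg[OF q] by simp
    show "?a N k / ?a N 0 \<le> q ^ k * (1 / (p * p))"
    proof (cases "k \<le> N")
      case True
      have ne: "?P n \<noteq> 0" for n using pos[of n] by simp
      have "?a N k / ?a N 0 = q ^ (k\<^sup>2) * (?P N * ?P N / (?P (N + k) * ?P (N - k)))"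
        using True ne by (simp add: jtp_coeff_def)
      also have "\<dots> \<le> q ^ k * (1 / (p * p))"
      proof (intro mult_mono)
        show "q ^ (k\<^sup>2) \<le> q ^ k" using q by (intro power_decreasing) (auto simp: power2_eq_square)
        show "?P N * ?P N / (?P (N + k) * ?P (N - k)) \<le> 1 / (p * p)"
          using p pos P1 less_imp_le[OF pos] by (intro frac_le mult_mono mult_pos_pos mult_le_one) auto
      qed (use q pos in \<open>auto intro!: divide_nonneg_pos mult_pos_pos\<close>)
      finally show ?thesis .
    qed (use q p in \<open>simp add: jtp_coeff_above\<close>)
  qed
  define A where "A k N = ?a N (Suc k) / ?a N 0 * d k" for k N
  have T: "((\<lambda>N. suminf (\<lambda>k. A k N)) \<longlonglongrightarrow> (\<Sum>k. q ^ ((Suc k)\<^sup>2) * d k))"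
  proof (rule conjunct2[OF conjunct2[OF tannerys_theorem]])
    show "((\<lambda>N. A k N) \<longlonglongrightarrow> q ^ ((Suc k)\<^sup>2) * d k)" for k
      unfolding A_def by (intro tendsto_intros jtp_coeff_ratio_tendsto q)
    have "norm (A k N) \<le> q ^ Suc k * (1 / (p * p)) * 2" for k N
      unfolding A_def real_norm_def abs_mult[of _ "d k"] abs_of_nonneg[OF ratio(2)]
      using ratio[of N "Suc k"] d2[of k] q p by (intro mult_mono) auto
    then show "\<forall>\<^sub>F (k, N) in sequentially \<times>\<^sub>F sequentially. norm (A k N) \<le> q ^ Suc k * (1 / (p * p)) * 2"
      by (auto intro: always_eventually)
    show "summable (\<lambda>k. q ^ Suc k * (1 / (p * p)) * 2)"
      using q by (intro summable_mult2) (simp add: summable_geometric_iff summable_mult)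
  qed auto
  \<comment> \<open>The factor with index 0 provides the cosine gap, the others at least
    \<open>r\<^sup>2\<close>, and the division by the coefficient at 0 at least
    \<open>p\<^sup>2\<close>. The shift to \<open>Suc N\<close> guarantees that the factor with
    index 0 is present.\<close>
  have low: "q * (cos \<alpha> - cos \<beta>) * r\<^sup>2 * p\<^sup>2 \<le> suminf (\<lambda>k. A k (Suc N))" for N
  proof -
    let ?N = "Suc N"
    let ?f = "\<lambda>\<theta> n. 1 + 2 * q ^ (2 * n + 1) * cos \<theta> + q ^ (4 * n + 2)"
    have "suminf (\<lambda>k. A k ?N) = (\<Sum>k<?N. A k ?N)"
      by (rule suminf_finite) (auto simp: A_def intro: jtp_coeff_above)
    also have "\<dots> = (\<Sum>k<?N. ?a ?N (Suc k) * d k) / ?a ?N 0"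
      by (simp add: A_def sum_divide_distrib del: sum.lessThan_Suc)
    also have "\<dots> = ((\<Prod>n<?N. ?f \<alpha> n) - (\<Prod>n<?N. ?f \<beta> n)) / 2 / ?a ?N 0"
    proof -
      have *: "(x - y) / c = ((w + 2 * x) - (w + 2 * y)) / 2 / c" for w x y c :: real
      proof -
        have "(w + 2 * x) - (w + 2 * y) = (x - y) * 2" by (simp add: algebra_simps)
        then show ?thesis by (metis nonzero_mult_div_cancel_right zero_neq_numeral)
      qed
      show ?thesis
        unfolding jtp_finite[OF q order_refl] d_def right_diff_distrib sum_subtractf by (rule *)
    qed
    finally have e: "suminf (\<lambda>k. A k ?N) = ((\<Prod>n<?N. ?f \<alpha> n) - (\<Prod>n<?N. ?f \<beta> n)) / 2 / ?a ?N 0" .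
    \<comment> \<open>The worst case is cosine -1, where the factor is a perfect square.\<close>
    have fpos: "(1 - q ^ (2 * n + 1))\<^sup>2 \<le> ?f \<beta> n" for n
    proof -
      define x where "x = q ^ (2 * n + 1)"
      have x: "0 \<le> x" using q(1) by (simp add: x_def)
      have "(2 * n + 1) * 2 = 4 * n + 2" by simp
      then have y: "q ^ (4 * n + 2) = x\<^sup>2"
        unfolding x_def power_mult[symmetric] by (rule arg_cong[OF sym])
      have "2 * x * (-1) \<le> 2 * x * cos \<beta>"
        using x by (intro mult_left_mono cos_ge_minus_one) simp
      moreover have "(1 - x)\<^sup>2 = 1 - 2 * x + x\<^sup>2"
        by (simp only: power2_diff) simp
      ultimately show ?thesis unfolding x_def[symmetric] y by simp
    qed
    have f_le: "?f \<beta> n \<le> ?f \<alpha> n" for n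
      using q(1) ab by (intro add_mono mult_left_mono) simp_all
    have f0: "0 \<le> ?f \<beta> n" for n by (rule order_trans[OF zero_le_power2 fpos])
    have "r\<^sup>2 \<le> (qfac q N)\<^sup>2" using r less_imp_le[OF r(1)] by (intro power_mono) auto
    also have "\<dots> = (\<Prod>n<N. (1 - q ^ Suc n)\<^sup>2)" by (simp add: qfac_def prod_power_distrib)
    also have "\<dots> \<le> (\<Prod>n<N. ?f \<beta> (Suc n))"
    proof (intro prod_mono conjI)
      fix n
      have "(1 - q ^ Suc n)\<^sup>2 \<le> (1 - q ^ (2 * Suc n + 1))\<^sup>2"
      proof (rule power_mono)
        show "1 - q ^ Suc n \<le> 1 - q ^ (2 * Suc n + 1)"
          using q power_decreasing[of "Suc n" "2 * Suc n + 1" q] by auto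
        show "0 \<le> 1 - q ^ Suc n" using power_Suc_less_one[OF q, of n] by simp
      qed
      then show "(1 - q ^ Suc n)\<^sup>2 \<le> ?f \<beta> (Suc n)" using fpos[of "Suc n"] by linarith
    qed auto
    finally have R: "r\<^sup>2 \<le> (\<Prod>n<N. ?f \<beta> (Suc n))" .
    have mono: "(\<Prod>n<N. ?f \<beta> (Suc n)) \<le> (\<Prod>n<N. ?f \<alpha> (Suc n))"
      by (intro prod_mono conjI f0 f_le)
    have f0_diff: "?f \<alpha> 0 - ?f \<beta> 0 = 2 * q * (cos \<alpha> - cos \<beta>)"
      by (simp add: right_diff_distrib)
    have "2 * (q * (cos \<alpha> - cos \<beta>) * r\<^sup>2) = 2 * q * (cos \<alpha> - cos \<beta>) * r\<^sup>2" by simp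
    also have "\<dots> \<le> (?f \<alpha> 0 - ?f \<beta> 0) * (\<Prod>n<N. ?f \<beta> (Suc n))"
      unfolding f0_diff using R q ab by (intro mult_left_mono) auto
    also have "\<dots> = ?f \<alpha> 0 * (\<Prod>n<N. ?f \<beta> (Suc n)) - ?f \<beta> 0 * (\<Prod>n<N. ?f \<beta> (Suc n))"
      by (rule left_diff_distrib)
    also have "\<dots> \<le> ?f \<alpha> 0 * (\<Prod>n<N. ?f \<alpha> (Suc n)) - ?f \<beta> 0 * (\<Prod>n<N. ?f \<beta> (Suc n))"
      by (rule diff_right_mono, rule mult_left_mono[OF mono order_trans[OF f0 f_le]])
    also have "\<dots> = (\<Prod>n<?N. ?f \<alpha> n) - (\<Prod>n<?N. ?f \<beta> n)"
      by (simp only: prod.lessThan_Suc_shift)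
    finally have g: "q * (cos \<alpha> - cos \<beta>) * r\<^sup>2 \<le> ((\<Prod>n<?N. ?f \<alpha> n) - (\<Prod>n<?N. ?f \<beta> n)) / 2" by simp
    have "p\<^sup>2 \<le> 1 / ?a ?N 0" 
      using a0[of ?N] p(1) by (simp add: field_simps power2_eq_square)
    then have "q * (cos \<alpha> - cos \<beta>) * r\<^sup>2 * p\<^sup>2 \<le> ((\<Prod>n<?N. ?f \<alpha> n) - (\<Prod>n<?N. ?f \<beta> n)) / 2 * (1 / ?a ?N 0)"
    proof (rule mult_mono[OF g])
      have "0 \<le> q * (cos \<alpha> - cos \<beta>) * r\<^sup>2" using q ab by simp
      then show "0 \<le> ((\<Prod>n<?N. ?f \<alpha> n) - (\<Prod>n<?N. ?f \<beta> n)) / 2" using g by (rule order_trans)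
    qed simp
    then show ?thesis unfolding e by simp
  qed
  have "q * (cos \<alpha> - cos \<beta>) * r\<^sup>2 * p\<^sup>2 \<le> (\<Sum>k. q ^ ((Suc k)\<^sup>2) * d k)"
    using LIMSEQ_Suc[OF T] by (rule LIMSEQ_le_const) (use low in auto)
  moreover have "0 < q * (cos \<alpha> - cos \<beta>) * r\<^sup>2 * p\<^sup>2" using q ab r p by simp
  ultimately show ?thesis unfolding d_def by simp
qed

section \<open>Absolutely continuous functions\<close>

lemma sum_lengths_le_measure:
  fixes D :: "(real set) set"
  assumes "finite D" "\<And>K. K \<in> D \<Longrightarrow> \<exists>a b. K = {a..b} \<and> a \<le> b" 
    "\<And>K L. K \<in> D \<Longrightarrow> L \<in> D \<Longrightarrow> K \<noteq> L \<Longrightarrow> interior K \<inter> interior L = {}"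
    "\<And>K. K \<in> D \<Longrightarrow> K \<subseteq> U" "open U"
  shows "ennreal (\<Sum>K\<in>D. measure lborel K) \<le> emeasure lborel U"
proof -
  have m: "measure lborel K = measure lborel (interior K)" "emeasure lborel (interior K) = ennreal (measure lborel (interior K))" if "K \<in> D" for K
    using assms(2)[OF that] by (auto simp: )
  have "ennreal (\<Sum>K\<in>D. measure lborel K) = (\<Sum>K\<in>D. emeasure lborel (interior K))"
    using m by (subst sum_ennreal[symmetric]) (auto intro!: sum.cong)
  also have "\<dots> = emeasure lborel (\<Union>K\<in>D. interior K)"
    using assms(1,3) by (intro sum_emeasure) (auto simp: disjoint_family_on_def)
  also have "\<dots> \<le> emeasure lborel U"
    using assms(4,5) interior_subset by (intro emeasure_mono) (blast, auto)
  finally show ?thesis .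
qed

text \<open>Tagged divisions produce finite sets of nonoverlapping intervals rather than indexed
  families; enumerating such a set brings it into the form of the definition.\<close>

lemma abs_continuous_onD:
  assumes "abs_continuous_on a b f" "0 < e"
  shows "\<exists>d>0. \<forall>D. finite D \<longrightarrow> (\<forall>K\<in>D. K \<subseteq> {a..b} \<and> (\<exists>l r. K = {l..r} \<and> l \<le> r)) \<longrightarrow>
    (\<forall>K\<in>D. \<forall>L\<in>D. K \<noteq> L \<longrightarrow> interior K \<inter> interior L = {}) \<longrightarrow>
    (\<Sum>K\<in>D. measure lborel K) < d \<longrightarrow> (\<Sum>K\<in>D. norm (f (Sup K) - f (Inf K))) < e"
proof -
  obtain d where d: "0 < d" "\<And>n l r. (\<forall>i<n. a \<le> l i \<and> l i \<le> r i \<and> r i \<le> b) \<Longrightarrow>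
     disjoint_family_on (\<lambda>i. {l i<..<r i}) {..<n} \<Longrightarrow> (\<Sum>i<n. r i - l i) < d \<Longrightarrow>
     (\<Sum>i<(n::nat). norm (f (r i) - f (l i))) < e"
    using assms unfolding abs_continuous_on_def by meson
  show ?thesis
  proof (intro exI[of _ d] conjI d(1) allI impI)
    fix D assume "finite D" "\<forall>K\<in>D. K \<subseteq> {a..b} \<and> (\<exists>l r. K = {l..r} \<and> l \<le> r)"
      "\<forall>K\<in>D. \<forall>L\<in>D. K \<noteq> L \<longrightarrow> interior K \<inter> interior L = {}"
      "(\<Sum>K\<in>D. measure lborel K) < d"
    then have D: "finite D" "\<And>K. K \<in> D \<Longrightarrow> K \<subseteq> {a..b} \<and> (\<exists>l r. K = {l..r} \<and> l \<le> r)"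
      "\<And>K L. K \<in> D \<Longrightarrow> L \<in> D \<Longrightarrow> K \<noteq> L \<Longrightarrow> interior K \<inter> interior L = {}"
      "(\<Sum>K\<in>D. measure lborel K) < d" by blast+
    obtain h where h: "bij_betw h {..<card D} D"
      using ex_bij_betw_nat_finite[OF D(1)] by (auto simp: atLeast0LessThan)
    have mem: "h i \<in> D" if "i < card D" for i using h that by (auto simp: bij_betw_def)
    have K: "K = {Inf K..Sup K}" "Inf K \<le> Sup K" "a \<le> Inf K" "Sup K \<le> b" "measure lborel K = Sup K - Inf K" if "K \<in> D" for K
      using D(2)[OF that] by (auto)
    have "(\<Sum>i<card D. norm (f (Sup (h i)) - f (Inf (h i)))) < e"
    proof (rule d(2))
      show "\<forall>i<card D. a \<le> Inf (h i) \<and> Inf (h i) \<le> Sup (h i) \<and> Sup (h i) \<le> b"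
        using K(2-4) mem by auto
      show "disjoint_family_on (\<lambda>i. {Inf (h i)<..<Sup (h i)}) {..<card D}"
      proof (unfold disjoint_family_on_def, intro ballI impI)
        fix i j assume ij: "i \<in> {..<card D}" "j \<in> {..<card D}" "i \<noteq> j"
        then have "h i \<noteq> h j" using h by (auto simp: bij_betw_def inj_on_def)
        with ij have "interior (h i) \<inter> interior (h j) = {}" using D(3) mem by auto
        moreover have "interior (h i) = {Inf (h i)<..<Sup (h i)}" if "i < card D" for i
          using K(1)[OF mem[OF that]] interior_atLeastAtMost_real by metis
        ultimately show "{Inf (h i)<..<Sup (h i)} \<inter> {Inf (h j)<..<Sup (h j)} = {}"
          using ij by auto
      qed
      have "(\<Sum>i<card D. Sup (h i) - Inf (h i)) = (\<Sum>K\<in>D. Sup K - Inf K)"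
        using h by (rule sum.reindex_bij_betw)
      also have "\<dots> = (\<Sum>K\<in>D. measure lborel K)" using K(5) by (intro sum.cong) auto
      finally show "(\<Sum>i<card D. Sup (h i) - Inf (h i)) < d" using D(4) by simp
    qed
    also have "(\<Sum>i<card D. norm (f (Sup (h i)) - f (Inf (h i)))) = (\<Sum>K\<in>D. norm (f (Sup K) - f (Inf K)))"
      using h by (rule sum.reindex_bij_betw)
    finally show "(\<Sum>K\<in>D. norm (f (Sup K) - f (Inf K))) < e" .
  qed
qed

text \<open>Cousin's lemma: on the exceptional null set the gauge stays inside an open set of small
  measure, where absolute continuity controls the increments.\<close>

lemma abs_continuous_on_increment_ge:
  fixes f :: "real \<Rightarrow> real"
  assumes ac: "abs_continuous_on a b f" and ab: "a \<le> b"
    and deriv: "AE t in lborel. a < t \<and> t < b \<longrightarrow> (\<exists>D. (f has_real_derivative D) (at t) \<and> C \<le> D)"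
  shows "C * (b - a) \<le> f b - f a"
proof (rule field_le_epsilon)
  fix e :: real assume e: "0 < e"
  \<comment> \<open>The error \<open>e\<close> is split: half of it for the linear error
    \<open>e1 * (b - a)\<close> at regular tags, and \<open>e2\<close> each for the increments over
    the exceptional intervals and for \<open>C\<close> times their length.\<close>
  define e1 where "e1 = e / (2 * (1 + (b - a)))"
  have e1: "0 < e1" using e ab by (simp add: e1_def)
  define e2 where "e2 = e / 4"
  have e2: "0 < e2" using e by (simp add: e2_def)
  obtain d where d: "0 < d" "\<forall>D. finite D \<longrightarrow> (\<forall>K\<in>D. K \<subseteq> {a..b} \<and> (\<exists>l r. K = {l..r} \<and> l \<le> r)) \<longrightarrow>
    (\<forall>K\<in>D. \<forall>L\<in>D. K \<noteq> L \<longrightarrow> interior K \<inter> interior L = {}) \<longrightarrow>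
    (\<Sum>K\<in>D. measure lborel K) < d \<longrightarrow> (\<Sum>K\<in>D. norm (f (Sup K) - f (Inf K))) < e2"
    using abs_continuous_onD[OF ac e2] by blast
  \<comment> \<open>The second bound makes \<open>C\<close> times the total exceptional length at
    most \<open>e2\<close>.\<close>
  define d' where "d' = min d (e2 / (1 + \<bar>C\<bar>))"
  have d': "0 < d'" using d e2 by (simp add: d'_def)
  from deriv have AEN: "AE t in lborel. a \<le> t \<and> t \<le> b \<longrightarrow> a < t \<and> t < b \<and> (\<exists>D. (f has_real_derivative D) (at t) \<and> C \<le> D)"
    using AE_lborel_singleton[of a] AE_lborel_singleton[of b] by eventually_elim auto
  obtain N where N: "N \<in> null_sets lborel"
    "\<And>t. a \<le> t \<Longrightarrow> t \<le> b \<Longrightarrow> t \<notin> N \<Longrightarrow> a < t \<and> t < b \<and> (\<exists>D. (f has_real_derivative D) (at t) \<and> C \<le> D)"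
    by (rule AE_E3[OF AEN]) simp
  have "N \<in> sets borel" using N(1) by auto
  then obtain U where U: "open U" "N \<subseteq> U" "emeasure lborel (U - N) < ennreal d'"
    using outer_regular_lborel[of N d'] d' by metis
  have mU: "emeasure lborel U < ennreal d'"
  proof -
    have "emeasure lborel U = emeasure lborel (U - N)"
      using emeasure_Diff_null_set[OF N(1), of U] U(1) by simp
    then show ?thesis using U(3) by simp
  qed
  \<comment> \<open>At a regular tag the increment is controlled on both sides of the tag
    separately, so that the two parts of an interval around the tag can be added.\<close>
  define good where "good t g \<longleftrightarrow> (t \<in> N \<longrightarrow> ball t g \<subseteq> U) \<and> (t \<notin> N \<longrightarrow> t \<in> {a..b} \<longrightarrow> (\<forall>s. \<bar>s - t\<bar> < g \<longrightarrow> 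
      (t \<le> s \<longrightarrow> (C - e1) * (s - t) \<le> f s - f t) \<and> (s \<le> t \<longrightarrow> (C - e1) * (t - s) \<le> f t - f s)))" for t g
  have "\<exists>g>0. good t g" for t
  proof (cases "t \<in> N")
    case True
    then show ?thesis using U unfolding good_def by (meson open_contains_ball subsetD)
  next
    case False
    show ?thesis
    proof (cases "t \<in> {a..b}")
      case True
      with N(2) False obtain D where D: "(f has_real_derivative D) (at t)" "C \<le> D" by auto
      then have "(f has_derivative (*) D) (at t)" by (simp add: has_field_derivative_def)
      then obtain g where g: "0 < g" "\<And>s. norm (s - t) < g \<Longrightarrow> norm (f s - f t - D * (s - t)) \<le> e1 * norm (s - t)"
        using e1 unfolding has_derivative_at_alt by blast
      have "(C - e1) * (s - t) \<le> f s - f t" if "\<bar>s - t\<bar> < g" "t \<le> s" for s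
      proof -
        have "C * (s - t) \<le> D * (s - t)" using D that by (intro mult_right_mono) auto
        then show ?thesis using g(2)[of s] that by (simp add: left_diff_distrib abs_le_iff)
      qed
      moreover have "(C - e1) * (t - s) \<le> f t - f s" if "\<bar>s - t\<bar> < g" "s \<le> t" for s
      proof -
        have "C * (t - s) \<le> D * (t - s)" using D that by (intro mult_right_mono) auto
        then show ?thesis using g(2)[of s] that by (simp add: algebra_simps abs_le_iff)
      qed
      ultimately show ?thesis unfolding good_def using g(1) False by (intro exI[of _ g]) simp
    qed (use False in \<open>auto simp: good_def intro: exI[of _ 1]\<close>)
  qed
  then obtain g where g: "\<And>t. 0 < g t" "\<And>t. good t (g t)" by metis
  have "gauge (\<lambda>t. ball t (g t))" using g by (auto simp: gauge_def)
  then obtain p where p: "p tagged_division_of {a..b}" "(\<lambda>t. ball t (g t)) fine p"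
    using fine_division_exists_real by metis
  have K: "K = {Inf K..Sup K}" "Inf K \<le> Sup K" "Inf K \<le> t" "t \<le> Sup K" "a \<le> Inf K" "Sup K \<le> b"
    "measure lborel K = Sup K - Inf K" "K \<subseteq> ball t (g t)" "\<bar>Inf K - t\<bar> < g t" "\<bar>Sup K - t\<bar> < g t" "t \<in> {a..b}" if tKp: "(t, K) \<in> p" for t K
  proof -
    obtain l r where lr: "K = {l..r}" using tagged_division_ofD(4)[OF p(1) tKp] by auto
    have tK: "t \<in> K" "K \<subseteq> {a..b}" using tagged_division_ofD(2,3)[OF p(1) tKp] by auto
    show KB: "K \<subseteq> ball t (g t)" using p(2) tKp by (auto simp: fine_def)
    show "K = {Inf K..Sup K}" "Inf K \<le> Sup K" "Inf K \<le> t" "t \<le> Sup K" "a \<le> Inf K" "Sup K \<le> b"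
      "measure lborel K = Sup K - Inf K" "t \<in> {a..b}" using lr tK by auto
    have "Inf K \<in> K" "Sup K \<in> K" using lr tK by auto
    then show "\<bar>Inf K - t\<bar> < g t" "\<bar>Sup K - t\<bar> < g t" using KB by (auto simp: dist_real_def)
  qed
  have fin: "finite p" using p(1) by auto
  define p1 where "p1 = {x\<in>p. fst x \<in> N}"
  define p2 where "p2 = {x\<in>p. fst x \<notin> N}"
  have p12: "p = p1 \<union> p2" "p1 \<inter> p2 = {}" "finite p1" "finite p2" using fin by (auto simp: p1_def p2_def)
  define F where "F K = f (Sup K) - f (Inf K)" for K :: "real set"
  have tot: "(\<Sum>(t,K)\<in>p. F K) = f b - f a"
    unfolding F_def using additive_tagged_division_1[OF ab p(1), of f] .
  have len: "(\<Sum>(t,K)\<in>p. measure lborel K) = b - a"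
    using additive_content_tagged_division[of p a b] p(1) ab by (simp add: box_real)
  have low2: "(\<Sum>(t,K)\<in>p2. (C - e1) * measure lborel K) \<le> (\<Sum>(t,K)\<in>p2. F K)"
  proof (rule sum_mono, clarify)
    fix t K assume "(t, K) \<in> p2"
    then have tK: "(t, K) \<in> p" "t \<notin> N" by (auto simp: p2_def)
    note k = K[OF tK(1)]
    have "(C - e1) * (Sup K - t) \<le> f (Sup K) - f t" "(C - e1) * (t - Inf K) \<le> f t - f (Inf K)"
      using g(2)[of t] tK k(3,4,9-11) by (auto simp: good_def)
    then show "(C - e1) * measure lborel K \<le> F K" by (simp add: F_def k(7) algebra_simps)
  qed
  \<comment> \<open>Disjointness of interiors says nothing about degenerate intervals. These
    contribute nothing and are dropped; each remaining interval then determines its tag, and sums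
    over pairs become sums over intervals.\<close>
  define D where "D = {K \<in> snd ` p1. measure lborel K \<noteq> 0}"
  have inj: "t = t'" if "(t, K) \<in> p" "(t', K) \<in> p" "measure lborel K \<noteq> 0" for t t' K
  proof (rule ccontr)
    assume "t \<noteq> t'"
    then have "interior K \<inter> interior K = {}" using tagged_division_ofD(5)[OF p(1) that(1,2)] by auto
    then have "{Inf K<..<Sup K} = {}" using K(1)[OF that(1)] interior_atLeastAtMost_real by (metis inf.idem)
    then show False using K(2,7)[OF that(1)] that(3) by auto
  qed
  have sumD: "(\<Sum>(t,K)\<in>p1. G K) = (\<Sum>K\<in>D. G K)" if G: "\<And>t K. (t, K) \<in> p \<Longrightarrow> measure lborel K = 0 \<Longrightarrow> G K = (0::real)" for G
  proof -
    have "(\<Sum>(t,K)\<in>p1. G K) = (\<Sum>(t,K)\<in>{x\<in>p1. measure lborel (snd x) \<noteq> 0}. G K)"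
      using p12(3) G by (intro sum.mono_neutral_right) (auto simp: p1_def)
    also have "\<dots> = (\<Sum>K\<in>D. G K)"
      by (rule sum.reindex_cong[of snd, symmetric]) (auto simp: D_def inj_on_def p1_def intro: inj)
    finally show ?thesis .
  qed
  have Dp: "\<exists>t. (t, K) \<in> p \<and> t \<in> N" if "K \<in> D" for K using that by (auto simp: D_def p1_def)
  have D1: "finite D" using p12 by (simp add: D_def)
  have D2: "K \<subseteq> {a..b} \<and> (\<exists>l r. K = {l..r} \<and> l \<le> r)" if KD: "K \<in> D" for K
  proof -
    obtain t where "(t, K) \<in> p" using Dp[OF KD] by auto
    note k = K(1,2,5,6)[OF this]
    have "{Inf K..Sup K} \<subseteq> {a..b}" using k(3,4) by auto
    then show ?thesis using k(1,2) by metis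
  qed
  have D3: "interior K \<inter> interior L = {}" if KL: "K \<in> D" "L \<in> D" "K \<noteq> L" for K L
    using Dp[OF KL(1)] Dp[OF KL(2)] tagged_division_ofD(5)[OF p(1)] KL(3) by blast
  have D4: "K \<subseteq> U" if KD: "K \<in> D" for K
  proof -
    obtain t where "(t, K) \<in> p" "t \<in> N" using Dp[OF KD] by auto
    then show ?thesis using K(8) g(2)[of t] by (auto simp: good_def)
  qed
  have "ennreal (\<Sum>K\<in>D. measure lborel K) \<le> emeasure lborel U"
  proof (rule sum_lengths_le_measure)
    show "\<exists>a b. K = {a..b} \<and> a \<le> b" if "K \<in> D" for K using D2[OF that] by blast
  qed (use D1 D3 D4 U(1) in auto)
  also note mU
  finally have mD: "(\<Sum>K\<in>D. measure lborel K) < d'"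
    using d' by (subst (asm) ennreal_less_iff) (auto intro: sum_nonneg)
  have small: "(\<Sum>K\<in>D. norm (F K)) < e2"
    unfolding F_def using d(2)[rule_format, OF D1 D2 D3] mD by (simp add: d'_def)
  have F0: "F K = 0" if "(t, K) \<in> p" "measure lborel K = 0" for t K
    using K(7)[OF that(1)] that(2) by (simp add: F_def)
  have s1: "(\<Sum>(t,K)\<in>p1. F K) \<ge> - e2"
  proof -
    have "(\<Sum>(t,K)\<in>p1. F K) = (\<Sum>K\<in>D. F K)" by (rule sumD) (rule F0)
    moreover have "\<bar>\<Sum>K\<in>D. F K\<bar> \<le> (\<Sum>K\<in>D. norm (F K))" unfolding real_norm_def by (rule sum_abs)
    ultimately show ?thesis using small by linarith
  qed
  have m1: "(\<Sum>(t,K)\<in>p1. measure lborel K) < d'" "0 \<le> (\<Sum>(t,K)\<in>p1. measure lborel K)"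
    using mD sumD[of "measure lborel"] by (auto intro: sum_nonneg)
  have sp: "(\<Sum>x\<in>p. h x) = (\<Sum>x\<in>p1. h x) + (\<Sum>x\<in>p2. h x)" for h :: "real \<times> real set \<Rightarrow> real"
    unfolding p12(1) by (rule sum.union_disjoint) (use p12 in auto)
  have "(\<Sum>(t,K)\<in>p2. (C - e1) * measure lborel K) = (C - e1) * (\<Sum>(t,K)\<in>p2. measure lborel K)"
    by (simp add: sum_distrib_left case_prod_unfold)
  also have "(\<Sum>(t,K)\<in>p2. measure lborel K) = (b - a) - (\<Sum>(t,K)\<in>p1. measure lborel K)"
    using len sp[of "\<lambda>(t,K). measure lborel K"] by simp
  finally have "(C - e1) * ((b - a) - (\<Sum>(t,K)\<in>p1. measure lborel K)) - e2 \<le> f b - f a"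
    using low2 s1 tot sp[of "\<lambda>(t,K). F K"] by simp
  moreover define m where "m = (\<Sum>(t,K)\<in>p1. measure lborel K)"
  ultimately have *: "(C - e1) * ((b - a) - m) - e2 \<le> f b - f a" by simp
  have "C * m \<le> \<bar>C\<bar> * m" using m1 by (intro mult_right_mono) (auto simp: m_def)
  also have "\<dots> \<le> (1 + \<bar>C\<bar>) * (e2 / (1 + \<bar>C\<bar>))"
    using m1 by (intro mult_mono) (auto simp: m_def d'_def)
  also have "\<dots> = e2" by simp
  finally have cm: "C * m \<le> e2" .
  have e1b: "e1 * (b - a) \<le> e / 2"
    using e ab by (simp add: e1_def field_simps)
  have "0 \<le> e1 * m" using e1 m1 by (simp add: m_def)
  then have "C * (b - a) \<le> f b - f a + e2 + e2 + e / 2"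
    using * cm e1b by (simp add: algebra_simps)
  then show "C * (b - a) \<le> f b - f a + e" unfolding e2_def by simp
qed

section \<open>Primitives on the unit interval\<close>

lemma measurable_id_I01 [measurable, simp]: "(\<lambda>x. x) \<in> borel_measurable I01"
  by (rule measurable_I01) simp

text \<open>The integral from 0 to \<open>x\<close>. Integrating over \<open>I01\<close> makes it
  constant to the left of 0 and to the right of 1, hence defined and continuous on the whole
  line.\<close>

definition primitive :: "(real \<Rightarrow> real) \<Rightarrow> real \<Rightarrow> real" where
  "primitive h x = (\<integral>y. (if y \<le> x then h y else 0) \<partial>I01)"

lemma primitive_integrable:
  fixes h :: "real \<Rightarrow> real"
  assumes "integrable I01 h" shows "integrable I01 (\<lambda>y. if y \<le> x then h y else 0)"
proof (rule Bochner_Integration.integrable_bound[OF assms])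
  have [measurable]: "h \<in> borel_measurable I01" using assms by auto
  show "(\<lambda>y. if y \<le> x then h y else 0) \<in> borel_measurable I01" by measurable
qed auto

lemma primitive_measurable:
  assumes [measurable]: "h \<in> borel_measurable I01" shows "primitive h \<in> borel_measurable I01"
proof -
  interpret sigma_finite_measure I01 ..
  show ?thesis unfolding primitive_def[abs_def] by measurable
qed

lemma primitive_bound:
  assumes "integrable I01 h" shows "\<bar>primitive h x\<bar> \<le> (\<integral>y. \<bar>h y\<bar> \<partial>I01)"
proof -
  have "\<bar>primitive h x\<bar> \<le> (\<integral>y. \<bar>if y \<le> x then h y else 0\<bar> \<partial>I01)"
    unfolding primitive_def by (rule integral_abs_bound)
  also have "\<dots> \<le> (\<integral>y. \<bar>h y\<bar> \<partial>I01)"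
    using primitive_integrable[OF assms, of x] assms by (intro integral_mono) auto
  finally show ?thesis .
qed

lemma primitive_square_integrable:
  assumes "integrable I01 h" shows "square_integrable (primitive h)"
  using primitive_measurable[of h] primitive_bound[OF assms] assms by (intro square_integrable_bounded) auto

lemma primitive_at_0: "x \<le> 0 \<Longrightarrow> primitive h x = 0"
proof -
  assume "x \<le> 0"
  then have "primitive h x = (\<integral>y. 0 \<partial>I01)"
    unfolding primitive_def by (intro Bochner_Integration.integral_cong) (auto simp: space_I01)
  then show ?thesis by simp
qed

lemma primitive_at_1: "1 \<le> x \<Longrightarrow> primitive h x = (\<integral>y. h y \<partial>I01)"
  unfolding primitive_def by (intro Bochner_Integration.integral_cong) (auto simp: space_I01)

text \<open>The bridge to the gauge integral, whose theorems on indefinite integrals are used below;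
  \<open>H\<close> extends \<open>h\<close> by zero.\<close>

lemma primitive_diff_HK:
  assumes "integrable I01 h" 
  defines "H \<equiv> \<lambda>y. indicator {0<..<1} y * h y"
  shows "integrable lborel H" "H integrable_on {a..c}"
    and "a \<le> c \<Longrightarrow> primitive h c - primitive h a = integral {a..c} H"
proof -
  show H: "integrable lborel H"
    using assms by (simp add: integrable_restrict_space)
  have si: "set_integrable lborel S H" if "S \<in> sets borel" for S
    unfolding set_integrable_def using integrable_mult_indicator[OF _ H] that by simp
  show "H integrable_on {a..c}" by (rule set_borel_integral_eq_integral(1)) (simp add: si)
  assume "a \<le> c"
  have "primitive h c - primitive h a = (\<integral>y. (if y \<le> c then h y else 0) - (if y \<le> a then h y else 0) \<partial>I01)"
    unfolding primitive_def using primitive_integrable[OF assms(1)] by simp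
  also have "\<dots> = (\<integral>y. indicator {0<..<1} y *\<^sub>R ((if y \<le> c then h y else 0) - (if y \<le> a then h y else 0)) \<partial>lborel)"
    by (subst integral_restrict_space) auto
  also have "\<dots> = (\<integral>y. indicator {a<..c} y *\<^sub>R H y \<partial>lborel)"
    using \<open>a \<le> c\<close> by (intro Bochner_Integration.integral_cong) (auto simp: H_def indicator_def)
  also have "\<dots> = (\<integral>y. indicator {a..c} y *\<^sub>R H y \<partial>lborel)"
  proof (rule integral_cong_AE)
    show "(\<lambda>y. indicator {a<..c} y *\<^sub>R H y) \<in> borel_measurable lborel" 
      "(\<lambda>y. indicator {a..c} y *\<^sub>R H y) \<in> borel_measurable lborel"
      using H by (auto intro!: borel_measurable_scaleR)
    show "AE y in lborel. indicator {a<..c} y *\<^sub>R H y = indicator {a..c} y *\<^sub>R H y"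
      using AE_lborel_singleton[of a] by (rule AE_mp) (auto intro!: AE_I2 simp: indicator_def)
  qed
  also have "\<dots> = integral {a..c} H"
    using set_borel_integral_eq_integral(2)[OF si[of "{a..c}"]] by (simp add: set_lebesgue_integral_def)
  finally show "primitive h c - primitive h a = integral {a..c} H" .
qed

lemma primitive_continuous:
  assumes "integrable I01 h" shows "continuous_on S (primitive h)"
proof -
  let ?H = "\<lambda>y. indicator {0<..<1} y * h y"
  have "continuous_on {-1..2} (\<lambda>x. integral {-1..x} ?H)"
    by (rule indefinite_integral_continuous_1) (rule primitive_diff_HK(2)[OF assms])
  then have c: "continuous_on {-1..2} (primitive h)"
    by (rule continuous_on_eq) (use primitive_diff_HK(3)[OF assms, of "-1"] primitive_at_0[of "-1" h] in auto)
  have "isCont (primitive h) x" for x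
  proof -
    consider "x < 0" | "1 < x" | "x \<in> {-1<..<2}" by fastforce
    then show ?thesis
    proof cases
      case 1
      then have "eventually (\<lambda>y. 0 = primitive h y) (nhds x)"
        by (auto simp: primitive_at_0 eventually_nhds intro!: exI[of _ "{..<0}"])
      then show ?thesis by (rule isCont_cong[THEN iffD1]) simp
    next
      case 2
      then have "eventually (\<lambda>y. (\<integral>y. h y \<partial>I01) = primitive h y) (nhds x)"
        by (auto simp: primitive_at_1 eventually_nhds intro!: exI[of _ "{1<..}"])
      then show ?thesis by (rule isCont_cong[THEN iffD1]) simp
    next
      case 3
      then show ?thesis using continuous_on_subset[OF c, of "{-1<..<2}"]
        by (simp add: continuous_on_eq_continuous_at greaterThanLessThan_subseteq_atLeastAtMost_iff)
    qed
  qed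
  then show ?thesis by (simp add: continuous_at_imp_continuous_on)
qed

lemma primitive_has_derivative:
  assumes "integrable I01 h" "continuous_on UNIV h" "0 < x" "x < 1"
  shows "(primitive h has_real_derivative h x) (at x)"
proof -
  let ?H = "\<lambda>y. indicator {0<..<1} y * h y"
  define a b where "a = x / 2" and "b = (x + 1) / 2"
  have ab: "0 < a" "a < x" "x < b" "b < 1" using assms(3,4) by (auto simp: a_def b_def)
  have "continuous_on {a..b} ?H"
    by (rule continuous_on_eq[OF continuous_on_subset[OF assms(2)]]) (use ab in auto)
  then have "((\<lambda>u. integral {a..u} ?H) has_real_derivative ?H x) (at x within {a..b})"
    by (rule integral_has_real_derivative) (use ab in auto)
  then have "((\<lambda>u. primitive h a + integral {a..u} ?H) has_real_derivative ?H x) (at x within {a..b})"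
    by (auto intro!: derivative_eq_intros)
  then have "(primitive h has_real_derivative ?H x) (at x within {a..b})"
  proof (rule has_field_derivative_transform_within[OF _ zero_less_one])
    fix u assume "u \<in> {a..b}"
    then show "primitive h a + integral {a..u} ?H = primitive h u" using primitive_diff_HK(3)[OF assms(1), of a u] by simp
  qed (use ab in auto)
  then show ?thesis
    using ab by (simp add: at_within_Icc_at)
qed

text \<open>Lebesgue differentiation from the right. One-sided quotients are enough, since later the
  zeros of a function are approached from the right.\<close>

lemma primitive_right_derivative_AE:
  assumes "integrable I01 h"
  shows "AE x in I01. \<forall>e>0. \<exists>d>0. \<forall>s. 0 < s \<and> s < d \<longrightarrow> \<bar>(primitive h (x + s) - primitive h x) / s - h x\<bar> < e"
proof -
  let ?H = "\<lambda>y. indicator {0<..<1} y * h y"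
  obtain N where N: "negligible N" "\<And>x e. x \<notin> N \<Longrightarrow> 0 < e \<Longrightarrow>
     \<exists>d>0. \<forall>s. 0 < s \<and> s < d \<longrightarrow> norm (integral (cbox x (x + s *\<^sub>R One)) ?H /\<^sub>R s ^ DIM(real) - ?H x) < e"
  proof (rule integrable_ccontinuous_explicit[of ?H])
    show "?H integrable_on cbox a b" for a b unfolding box_real by (rule primitive_diff_HK(2)[OF assms])
  qed (rule that)
  have "AE x in lborel. x \<notin> N"
    using AE_not_in[of N lebesgue] N(1) AE_completion_iff[of "\<lambda>x. x \<notin> N" lborel]
    by (simp add: negligible_iff_null_sets)
  then have "AE x in I01. x \<notin> N"
    by (subst AE_restrict_space_iff) auto
  then show ?thesis
  proof (rule AE_mp, intro AE_I2 impI allI)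
    fix x e :: real assume x: "x \<in> space I01" "x \<notin> N" "0 < e"
    obtain d where d: "0 < d" "\<And>s. 0 < s \<Longrightarrow> s < d \<Longrightarrow> norm (integral (cbox x (x + s *\<^sub>R One)) ?H /\<^sub>R s ^ DIM(real) - ?H x) < e"
      using N(2)[OF x(2,3)] by blast
    have "\<bar>(primitive h (x + s) - primitive h x) / s - h x\<bar> < e" if "0 < s" "s < d" for s
      using d(2)[OF that] primitive_diff_HK(3)[OF assms, of x "x + s"] x(1) that
      by (simp add: space_I01 divide_inverse mult.commute)
    then show "\<exists>d>0. \<forall>s. 0 < s \<and> s < d \<longrightarrow> \<bar>(primitive h (x + s) - primitive h x) / s - h x\<bar> < e"
      using d(1) by blast
  qed
qed

lemma primitive_zero_imp_AE_zero:
  assumes "integrable I01 h" "\<And>x. 0 < x \<Longrightarrow> x < 1 \<Longrightarrow> primitive h x = 0"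
  shows "AE x in I01. h x = 0"
  using primitive_right_derivative_AE[OF assms(1)]
proof (rule AE_mp, intro AE_I2 impI)
  fix x assume x: "x \<in> space I01" and *: "\<forall>e>0. \<exists>d>0. \<forall>s. 0 < s \<and> s < d \<longrightarrow> \<bar>(primitive h (x + s) - primitive h x) / s - h x\<bar> < e"
  have "\<bar>h x\<bar> < e" if "0 < e" for e
  proof -
    obtain d where d: "0 < d" "\<And>s. 0 < s \<Longrightarrow> s < d \<Longrightarrow> \<bar>(primitive h (x + s) - primitive h x) / s - h x\<bar> < e"
      using * \<open>0 < e\<close> by blast
    define s where "s = min d (1 - x) / 2"
    have "0 < s" "s < d" "x + s < 1" using d(1) x by (auto simp: s_def space_I01 min_def field_simps)
    then show ?thesis using d(2)[of s] assms(2)[of x] assms(2)[of "x + s"] x by (simp add: space_I01)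
  qed
  from this[of "\<bar>h x\<bar>"] show "h x = 0" by fastforce
qed

lemma continuous_bounded_unit:
  fixes f :: "real \<Rightarrow> real"
  assumes "continuous_on UNIV f"
  obtains M where "\<And>x. 0 \<le> x \<Longrightarrow> x \<le> 1 \<Longrightarrow> \<bar>f x\<bar> \<le> M"
proof -
  have "bounded (f ` {0..1})"
    by (intro compact_imp_bounded compact_continuous_image continuous_on_subset[OF assms]) auto
  then obtain M where "\<forall>y\<in>f ` {0..1}. norm y \<le> M" unfolding bounded_iff by blast
  then show thesis by (intro that[of M]) auto
qed

lemma continuous_square_integrable:
  assumes "continuous_on UNIV f" shows "square_integrable f"
proof -
  obtain M where "\<And>x. 0 \<le> x \<Longrightarrow> x \<le> 1 \<Longrightarrow> \<bar>f x\<bar> \<le> M"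
    using continuous_bounded_unit[OF assms] by blast
  then show ?thesis
    by (intro square_integrable_bounded[where C = M] measurable_I01 borel_measurable_continuous_onI assms) auto
qed

text \<open>As \<open>h\<close> is merely integrable, the product rule is replaced by Fubini's
  theorem on the triangle \<open>y \<le> x\<close>.\<close>

lemma primitive_by_parts:
  fixes \<psi> \<psi>' :: "real \<Rightarrow> real"
  assumes h: "integrable I01 h" and \<psi>: "\<And>x. (\<psi> has_real_derivative \<psi>' x) (at x)" "continuous_on UNIV \<psi>'"
  shows "(\<integral>x. primitive h x * \<psi>' x \<partial>I01) = \<psi> 1 * (\<integral>x. h x \<partial>I01) - (\<integral>x. h x * \<psi> x \<partial>I01)"
proof -
  interpret sigma_finite_measure I01 ..
  interpret P: pair_sigma_finite I01 I01 ..
  have [measurable]: "h \<in> borel_measurable I01" using h by auto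
  have [measurable]: "\<psi>' \<in> borel_measurable I01"
    by (intro measurable_I01 borel_measurable_continuous_onI \<psi>(2))
  have c\<psi>: "continuous_on UNIV \<psi>" using \<psi>(1) by (meson DERIV_isCont continuous_at_imp_continuous_on)
  then have [measurable]: "\<psi> \<in> borel_measurable I01"
    by (intro measurable_I01 borel_measurable_continuous_onI)
  obtain M where M: "\<And>x. 0 \<le> x \<Longrightarrow> x \<le> 1 \<Longrightarrow> \<bar>\<psi>' x\<bar> \<le> M"
    using continuous_bounded_unit[OF \<psi>(2)] by blast
  obtain M' where M': "\<And>x. 0 \<le> x \<Longrightarrow> x \<le> 1 \<Longrightarrow> \<bar>\<psi> x\<bar> \<le> M'"
    using continuous_bounded_unit[OF c\<psi>] by blast
  have M0: "0 \<le> M" using M[of 0] by auto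
  let ?f = "\<lambda>x y. (if y \<le> x then h y else 0) * \<psi>' x"
  have int: "integrable (I01 \<Otimes>\<^sub>M I01) (\<lambda>(x, y). ?f x y)"
  proof (rule Bochner_Integration.integrable_bound)
    show "integrable (I01 \<Otimes>\<^sub>M I01) (\<lambda>(x, y). M * \<bar>h y\<bar>)"
      by (rule P.Fubini_integrable) (use h in \<open>auto\<close>)
    show "(\<lambda>(x, y). ?f x y) \<in> borel_measurable (I01 \<Otimes>\<^sub>M I01)" by measurable
    show "AE x in I01 \<Otimes>\<^sub>M I01. norm (case x of (x, y) \<Rightarrow> ?f x y) \<le> norm (case x of (x, y) \<Rightarrow> M * \<bar>h y\<bar>)"
      using M M0 by (intro AE_I2) (auto simp: space_pair_measure space_I01 abs_mult mult.commute intro!: mult_mono)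
  qed
  have "(\<integral>x. primitive h x * \<psi>' x \<partial>I01) = (\<integral>x. (\<integral>y. ?f x y \<partial>I01) \<partial>I01)"
    by (simp add: primitive_def)
  also have "\<dots> = (\<integral>y. (\<integral>x. ?f x y \<partial>I01) \<partial>I01)"
    using P.Fubini_integral[OF int] by simp
  also have "\<dots> = (\<integral>y. \<psi> 1 * h y - h y * \<psi> y \<partial>I01)"
  proof (rule Bochner_Integration.integral_cong)
    fix y assume y: "y \<in> space I01"
    \<comment> \<open>For fixed \<open>y\<close> the inner variable runs from \<open>y\<close> to
      1.\<close>
    have "(\<integral>x. ?f x y \<partial>I01) = (\<integral>x. h y * (\<psi>' x * indicator {y..1} x) \<partial>I01)"
      by (intro Bochner_Integration.integral_cong) (auto simp: space_I01)
    also have "\<dots> = h y * (\<psi> 1 - \<psi> y)"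
      using I01_integral_FTC[of y 1 \<psi> \<psi>'] \<psi> y by (simp add: space_I01)
    finally show "(\<integral>x. ?f x y \<partial>I01) = \<psi> 1 * h y - h y * \<psi> y" by (simp add: algebra_simps)
  qed simp
  also have "\<dots> = \<psi> 1 * (\<integral>x. h x \<partial>I01) - (\<integral>x. h x * \<psi> x \<partial>I01)"
  proof -
    have "integrable I01 (\<lambda>x. h x * \<psi> x)"
      by (rule Bochner_Integration.integrable_bound[of _ "\<lambda>x. M' * h x"])
        (use h M' in \<open>auto intro!: AE_I2 mult_mono simp: space_I01 abs_mult mult.commute order.trans[OF M' abs_ge_self]\<close>)
    then show ?thesis using h by simp
  qed
  finally show ?thesis .
qed

section \<open>Completeness\<close>

text \<open>The modes are indexed from 0: index \<open>k\<close> belongs to the frequency \<open>k + 1\<close>.\<close>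

definition lam :: "nat \<Rightarrow> real" where "lam k = (real (Suc k) * pi)\<^sup>2"

definition esin :: "nat \<Rightarrow> real \<Rightarrow> real" where "esin k x = sqrt 2 * sin (real (Suc k) * pi * x)"

definition ek :: "nat \<Rightarrow> l2" where "ek k = abs_l2 (esin k)"

lemma esin_continuous: "continuous_on S (esin k)"
  unfolding esin_def by (intro continuous_intros)

lemma esin_square_integrable [simp]: "square_integrable (esin k)"
  by (rule continuous_square_integrable[OF esin_continuous])

lemma esin_bound: "\<bar>esin k x\<bar> \<le> sqrt 2"
  using abs_sin_le_one by (simp add: esin_def abs_mult)

lemma inner_ek: "inner v (ek k) = (\<integral>x. rep_l2 v x * esin k x \<partial>I01)"
  unfolding ek_def by (rule inner_abs) simp

text \<open>Multiplying by a cosine only moves the frequency of the sine up and down by one, so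
  vanishing sine moments annihilate all powers of the cosine as well. The frequency starts at 0
  here, where the sine is zero, to give the downward shift room.\<close>

lemma sin_moments_zero:
  assumes f: "square_integrable f" and z: "\<And>k. (\<integral>x. f x * sin (real (Suc k) * pi * x) \<partial>I01) = 0"
  shows "(\<integral>x. f x * (cos (pi * x) ^ n * sin (real k * pi * x)) \<partial>I01) = 0"
proof (induction n arbitrary: k)
  case 0
  show ?case using z[of "k - 1"] by (cases k) auto
next
  case (Suc n)
  have int: "integrable I01 (\<lambda>x. f x * (cos (pi * x) ^ n * sin (real k * pi * x)))" for k
    by (intro square_integrable_mult f continuous_square_integrable continuous_intros)
  have "(\<integral>x. f x * (cos (pi * x) ^ Suc n * sin (real k * pi * x)) \<partial>I01) = 0" if k: "0 < k"
  proof -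
    have e: "f x * (cos (pi * x) ^ Suc n * sin (real k * pi * x)) =
      f x * (cos (pi * x) ^ n * sin (real (Suc k) * pi * x)) / 2 + f x * (cos (pi * x) ^ n * sin (real (k - 1) * pi * x)) / 2" for x
    proof -
      have "sin (real (Suc k) * pi * x) + sin (real (k - 1) * pi * x) = 
        sin (real k * pi * x + pi * x) + sin (real k * pi * x - pi * x)"
        using k by (simp add: algebra_simps of_nat_diff)
      also have "\<dots> = 2 * cos (pi * x) * sin (real k * pi * x)"
        by (simp add: sin_add sin_diff)
      finally show ?thesis by (simp add: algebra_simps flip: add_divide_distrib)
         (simp flip: distrib_left)
    qed
    show ?thesis unfolding e using int[of "Suc k"] int[of "k - 1"] Suc.IH[of "Suc k"] Suc.IH[of "k - 1"]
      by (simp del: of_nat_Suc)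
  qed
  then show ?case by (cases k) auto
qed

lemma sin_poly_zero:
  assumes f: "square_integrable f" and z: "\<And>k. (\<integral>x. f x * sin (real (Suc k) * pi * x) \<partial>I01) = 0"
    and P: "real_polynomial_function P"
  shows "(\<integral>x. f x * sin (pi * x) * P (cos (pi * x)) \<partial>I01) = 0"
proof -
  obtain a n where P: "P = (\<lambda>x. \<Sum>i\<le>n. a i * x ^ i)"
    using real_polynomial_function_imp_sum[OF P] by blast
  have int: "integrable I01 (\<lambda>x. f x * (cos (pi * x) ^ i * sin (real 1 * pi * x)))" for i
    by (intro square_integrable_mult f continuous_square_integrable continuous_intros)
  have "(\<integral>x. f x * sin (pi * x) * P (cos (pi * x)) \<partial>I01) = 
     (\<integral>x. (\<Sum>i\<le>n. a i * (f x * (cos (pi * x) ^ i * sin (real 1 * pi * x)))) \<partial>I01)"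
    unfolding P by (intro Bochner_Integration.integral_cong) (auto simp: sum_distrib_left algebra_simps)
  also have "\<dots> = (\<Sum>i\<le>n. a i * (\<integral>x. f x * (cos (pi * x) ^ i * sin (real 1 * pi * x)) \<partial>I01))"
    using int by (subst Bochner_Integration.integral_sum) auto
  also have "\<dots> = 0" unfolding sin_moments_zero[OF f z] by simp
  finally show ?thesis .
qed

text \<open>\<open>cos (pi * x)\<close> takes its values in \<open>{-1..1}\<close>, where
  \<open>Q\<close> is a uniform limit of polynomials; uniform errors are harmless against the
  integrable weight \<open>f x * sin (pi * x)\<close>.\<close>

lemma sin_continuous_zero:
  assumes f: "square_integrable f" and z: "\<And>k. (\<integral>x. f x * sin (real (Suc k) * pi * x) \<partial>I01) = 0"
    and Q: "continuous_on UNIV Q"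
  shows "(\<integral>x. f x * sin (pi * x) * Q (cos (pi * x)) \<partial>I01) = 0"
proof -
  have fi: "integrable I01 (\<lambda>x. f x * sin (pi * x))"
    by (intro square_integrable_mult f continuous_square_integrable continuous_intros)
  define M where "M = (\<integral>x. \<bar>f x * sin (pi * x)\<bar> \<partial>I01)"
  have M0: "0 \<le> M" by (simp add: M_def)
  have "\<bar>\<integral>x. f x * sin (pi * x) * Q (cos (pi * x)) \<partial>I01\<bar> \<le> e * M" if e: "0 < e" for e
  proof -
    have Qc: "continuous_on {-1..1} Q" using Q continuous_on_subset by blast
    obtain P where P: "real_polynomial_function P" "\<And>x. x \<in> {-1..1} \<Longrightarrow> \<bar>Q x - P x\<bar> < e"
      using Stone_Weierstrass_real_polynomial_function[OF compact_Icc Qc e] by blast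
    have Pc: "continuous_on UNIV P" using P(1) 
      by (simp add: continuous_on_polymonial_function real_polynomial_function_eq)
    have iQ: "integrable I01 (\<lambda>x. f x * (sin (pi * x) * Q (cos (pi * x))))"
      by (intro square_integrable_mult f continuous_square_integrable continuous_intros continuous_on_compose2[OF Q]) auto
    have iP: "integrable I01 (\<lambda>x. f x * (sin (pi * x) * P (cos (pi * x))))"
      by (intro square_integrable_mult f continuous_square_integrable continuous_intros continuous_on_compose2[OF Pc]) auto
    have "(\<integral>x. f x * sin (pi * x) * Q (cos (pi * x)) \<partial>I01) = 
      (\<integral>x. f x * (sin (pi * x) * Q (cos (pi * x))) \<partial>I01) - (\<integral>x. f x * (sin (pi * x) * P (cos (pi * x))) \<partial>I01)"
      using sin_poly_zero[OF f z P(1)] by (simp add: mult.assoc)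
    also have "\<dots> = (\<integral>x. (f x * sin (pi * x)) * (Q (cos (pi * x)) - P (cos (pi * x))) \<partial>I01)"
      using iQ iP by (subst Bochner_Integration.integral_diff[symmetric]) (auto simp: algebra_simps)
    also have "\<bar>\<dots>\<bar> \<le> (\<integral>x. \<bar>(f x * sin (pi * x)) * (Q (cos (pi * x)) - P (cos (pi * x)))\<bar> \<partial>I01)"
      by (rule integral_abs_bound)
    also have "\<dots> \<le> (\<integral>x. e * \<bar>f x * sin (pi * x)\<bar> \<partial>I01)"
    proof (rule integral_mono)
      have "integrable I01 (\<lambda>x. f x * (sin (pi * x) * Q (cos (pi * x))) - f x * (sin (pi * x) * P (cos (pi * x))))"
        using iQ iP by simp
      then show "integrable I01 (\<lambda>x. \<bar>(f x * sin (pi * x)) * (Q (cos (pi * x)) - P (cos (pi * x)))\<bar>)"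
        by (intro integrable_abs) (simp add: algebra_simps)
      show "integrable I01 (\<lambda>x. e * \<bar>f x * sin (pi * x)\<bar>)" using fi by simp
      show "\<bar>(f x * sin (pi * x)) * (Q (cos (pi * x)) - P (cos (pi * x)))\<bar> \<le> e * \<bar>f x * sin (pi * x)\<bar>" for x
        using P(2)[of "cos (pi * x)"] unfolding abs_mult[of "f x * sin (pi * x)"]
        by (subst mult.commute) (intro mult_right_mono, auto)
    qed
    also have "\<dots> = e * M" by (simp add: M_def)
    finally show ?thesis .
  qed
  note b = this
  have "\<bar>\<integral>x. f x * sin (pi * x) * Q (cos (pi * x)) \<partial>I01\<bar> \<le> 0"
  proof (rule field_le_epsilon)
    fix e :: real assume "0 < e"
    then have "0 < e / (M + 1)" using M0 by simp
    from b[OF this] have "\<bar>\<integral>x. f x * sin (pi * x) * Q (cos (pi * x)) \<partial>I01\<bar> \<le> e / (M + 1) * M" .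
    also have "\<dots> \<le> e" using M0 \<open>0 < e\<close> by (simp add: field_simps)
    finally show "\<bar>\<integral>x. f x * sin (pi * x) * Q (cos (pi * x)) \<partial>I01\<bar> \<le> 0 + e" by simp
  qed
  then show ?thesis by simp
qed

text \<open>The cosine decreases strictly on the unit interval, so the indicator of
  \<open>x \<le> a\<close> is a limit of continuous functions of \<open>cos (pi * x)\<close>. Hence
  the primitive of \<open>f x * sin (pi * x)\<close> vanishes, then the function itself, and the
  sine has no zero inside.\<close>

lemma sin_complete:
  assumes f: "square_integrable f" and z: "\<And>k. (\<integral>x. f x * sin (real (Suc k) * pi * x) \<partial>I01) = 0"
  shows "AE x in I01. f x = 0"
proof -
  let ?g = "\<lambda>x. f x * sin (pi * x)"
  have fi: "integrable I01 ?g"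
    by (intro square_integrable_mult f continuous_square_integrable continuous_intros)
  have "primitive ?g a = 0" if a: "0 < a" "a < 1" for a
  proof -
    \<comment> \<open>Ramps of slope \<open>n\<close>, clipped to \<open>[0, 1]\<close>, that start
      at \<open>cos (pi * a)\<close>.\<close>
    define Q where "Q n y = max 0 (min 1 (real n * (y - cos (pi * a))))" for n y
    have Qc: "continuous_on UNIV (Q n)" for n unfolding Q_def by (intro continuous_intros)
    have ca: "x < a \<longleftrightarrow> cos (pi * a) < cos (pi * x)" "x \<le> a \<longleftrightarrow> cos (pi * a) \<le> cos (pi * x)" if "0 < x" "x < 1" for x
      using that a by (auto simp: cos_mono_less_eq cos_mono_le_eq mult_le_cancel_left_pos)
    have lim: "(\<lambda>n. \<integral>x. ?g x * Q n (cos (pi * x)) \<partial>I01) \<longlonglongrightarrow> (\<integral>x. (if x \<le> a then ?g x else 0) \<partial>I01)"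
    proof (rule integral_dominated_convergence[where w = "\<lambda>x. \<bar>?g x\<bar>"])
      have [measurable]: "f \<in> borel_measurable I01" using f by (simp add: square_integrable_def)
      have [measurable]: "(\<lambda>x. sin (pi * x)) \<in> borel_measurable I01" "(\<lambda>x. Q n (cos (pi * x))) \<in> borel_measurable I01" for n
        by (auto intro!: measurable_I01 borel_measurable_continuous_onI continuous_intros continuous_on_compose2[OF Qc])
      show "(\<lambda>x. if x \<le> a then ?g x else 0) \<in> borel_measurable I01" by measurable
      show "(\<lambda>x. ?g x * Q n (cos (pi * x))) \<in> borel_measurable I01" for n by measurable
      show "integrable I01 (\<lambda>x. \<bar>?g x\<bar>)" using fi by simp
      show "AE x in I01. norm (?g x * Q n (cos (pi * x))) \<le> \<bar>?g x\<bar>" for n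
        by (intro AE_I2) (auto simp: abs_mult Q_def intro!: mult_left_le)
      have "AE x in lborel. x \<noteq> a" by (rule AE_lborel_singleton)
      then have "AE x in I01. x \<noteq> a" by (subst AE_restrict_space_iff) auto
      then show "AE x in I01. (\<lambda>n. ?g x * Q n (cos (pi * x))) \<longlonglongrightarrow> (if x \<le> a then ?g x else 0)"
      proof (rule AE_mp, intro AE_I2 impI)
        fix x assume x: "x \<in> space I01" "x \<noteq> a"
        show "(\<lambda>n. ?g x * Q n (cos (pi * x))) \<longlonglongrightarrow> (if x \<le> a then ?g x else 0)"
        proof (cases "x < a")
          case True
          then have d: "0 < cos (pi * x) - cos (pi * a)" using ca(1)[of x] x by (simp add: space_I01)
          obtain n0 where n0: "1 < real n0 * (cos (pi * x) - cos (pi * a))"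
            using reals_Archimedean3[OF d] by blast
          have "eventually (\<lambda>n. ?g x = ?g x * Q n (cos (pi * x))) sequentially"
            using eventually_ge_at_top[of n0]
          proof eventually_elim
            case (elim n)
            then have "real n0 * (cos (pi * x) - cos (pi * a)) \<le> real n * (cos (pi * x) - cos (pi * a))"
              using d by (intro mult_right_mono) auto
            then show ?case using n0 by (simp add: Q_def)
          qed
          then show ?thesis using True by (simp add: tendsto_eventually eventually_mono)
        next
          case False
          then have "cos (pi * x) - cos (pi * a) \<le> 0" using ca[of x] x by (auto simp: space_I01)
          then have "real n * (cos (pi * x) - cos (pi * a)) \<le> 0" for n
            by (simp add: mult_nonneg_nonpos)
          then have "Q n (cos (pi * x)) = 0" for n
            unfolding Q_def by (metis max.absorb1 min.coboundedI2)
          then show ?thesis using False x by simp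
        qed
      qed
    qed
    moreover have "(\<integral>x. ?g x * Q n (cos (pi * x)) \<partial>I01) = 0" for n
      by (rule sin_continuous_zero[OF f z Qc])
    ultimately show ?thesis by (simp add: primitive_def LIMSEQ_const_iff)
  qed
  then have "AE x in I01. ?g x = 0" by (rule primitive_zero_imp_AE_zero[OF fi])
  then show ?thesis
  proof (rule AE_mp, intro AE_I2 impI)
    fix x assume "x \<in> space I01" "?g x = 0"
    moreover then have "0 < sin (pi * x)" by (intro sin_gt_zero) (auto simp: space_I01)
    ultimately show "f x = 0" by simp
  qed
qed

lemma ek_total:
  assumes "\<And>k. inner v (ek k) = 0" shows "v = 0"
proof -
  have "(\<integral>x. rep_l2 v x * sin (real (Suc k) * pi * x) \<partial>I01) = 0" for k
  proof -
    have "(\<integral>x. sqrt 2 * (rep_l2 v x * sin (real (Suc k) * pi * x)) \<partial>I01) = 0"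
      using assms[of k] unfolding inner_ek esin_def by (simp add: algebra_simps)
    then show ?thesis by (subst (asm) integral_mult_right_zero) simp
  qed
  then have "AE x in I01. rep_l2 v x = 0" by (intro sin_complete) auto
  then show ?thesis unfolding l2_eq_iff using rep_0 by (auto elim: AE_mp)
qed

lemma ek_eqI: "(\<And>k. inner v (ek k) = inner w (ek k)) \<Longrightarrow> v = w"
  using ek_total[of "v - w"] by (simp add: inner_diff_left)

section \<open>Completeness of the space in its norm\<close>

lemma measure_I01 [simp]: "measure I01 {0<..<1} = 1"
  using measure_I01_space unfolding space_I01 .

lemma integral_abs_rep_le: "(\<integral>x. \<bar>rep_l2 v x\<bar> \<partial>I01) \<le> norm v"
proof -
  have s: "square_integrable (\<lambda>x. \<bar>rep_l2 v x\<bar>)" by (rule square_integrable_abs) simp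
  have o: "square_integrable (\<lambda>x. 1)" by (rule continuous_square_integrable) simp
  have "(\<integral>x. \<bar>rep_l2 v x\<bar> \<partial>I01) = inner (abs_l2 (\<lambda>x. \<bar>rep_l2 v x\<bar>)) (abs_l2 (\<lambda>x. 1))"
    using inner_abs_abs[OF s o] by simp
  also have "\<dots> \<le> norm (abs_l2 (\<lambda>x. \<bar>rep_l2 v x\<bar>)) * norm (abs_l2 (\<lambda>x. 1))"
    by (rule norm_cauchy_schwarz)
  also have "norm (abs_l2 (\<lambda>x. \<bar>rep_l2 v x\<bar>)) = norm v"
  proof -
    have "(norm (abs_l2 (\<lambda>x. \<bar>rep_l2 v x\<bar>)))\<^sup>2 = (norm v)\<^sup>2"
      using norm_abs_l2[OF s] norm_rep_l2[of v] by simp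
    then show ?thesis by (simp add: power2_eq_iff_nonneg)
  qed
  also have "norm (abs_l2 (\<lambda>x. 1)) = 1"
  proof -
    have "(norm (abs_l2 (\<lambda>x. 1)))\<^sup>2 = 1\<^sup>2" using norm_abs_l2[OF o] by (simp add: space_I01)
    then show ?thesis by (subst (asm) power2_eq_iff_nonneg) auto
  qed
  finally show ?thesis by simp
qed

lemma integral_abs_diff_rep_le: "(\<integral>x. \<bar>rep_l2 v x - rep_l2 w x\<bar> \<partial>I01) \<le> norm (v - w)"
proof -
  have "(\<integral>x. \<bar>rep_l2 v x - rep_l2 w x\<bar> \<partial>I01) = (\<integral>x. \<bar>rep_l2 (v - w) x\<bar> \<partial>I01)"
    using rep_diff[of v w] by (intro integral_cong_AE) (auto intro!: borel_measurable_abs borel_measurable_diff)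
  then show ?thesis using integral_abs_rep_le[of "v - w"] by simp
qed

text \<open>Riesz--Fischer: an \<open>L\<^sup>1\<close>-Cauchy sequence has an a.e. convergent subsequence, and Fatou's lemma
  upgrades the convergence to \<open>L\<^sup>2\<close>.\<close>

instance l2 :: banach
proof
  fix X :: "nat \<Rightarrow> l2"
  assume C: "Cauchy X"
  have "\<exists>N. \<forall>i\<ge>N. \<forall>j\<ge>N. (\<integral>x. norm (rep_l2 (X i) x - rep_l2 (X j) x) \<partial>I01) < e" if "0 < e" for e
  proof -
    obtain N where "\<And>i j. i \<ge> N \<Longrightarrow> j \<ge> N \<Longrightarrow> norm (X i - X j) < e"
      using C \<open>0 < e\<close> by (metis CauchyD)
    then have "(\<integral>x. norm (rep_l2 (X i) x - rep_l2 (X j) x) \<partial>I01) < e" if "i \<ge> N" "j \<ge> N" for i j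
      unfolding real_norm_def using that integral_abs_diff_rep_le[of "X i" "X j"] by (meson le_less_trans)
    then show ?thesis by blast
  qed
  then obtain r where r: "strict_mono r" "AE x in I01. Cauchy (\<lambda>i. rep_l2 (X (r i)) x)"
    using cauchy_L1_AE_cauchy_subseq[of I01 "\<lambda>i. rep_l2 (X i)", OF integrable_rep] by blast
  define F where "F x = lim (\<lambda>i. rep_l2 (X (r i)) x)" for x
  have F_meas [measurable]: "F \<in> borel_measurable I01"
    unfolding F_def by measurable
  have Flim: "AE x in I01. (\<lambda>i. rep_l2 (X (r i)) x) \<longlonglongrightarrow> F x"
    using r(2) by (rule AE_mp) (auto simp: F_def Cauchy_convergent_iff convergent_LIMSEQ_iff)
  \<comment> \<open>Fatou's lemma bounds the distance from \<open>F\<close> to the terms of the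
    subsequence and shows at the same time that this difference is square integrable.\<close>
  have bd: "square_integrable (\<lambda>x. F x - rep_l2 (X (r n)) x) \<and> (\<integral>x. (F x - rep_l2 (X (r n)) x)\<^sup>2 \<partial>I01) \<le> e\<^sup>2"
    if e: "0 < e" and N: "\<And>m. m \<ge> N \<Longrightarrow> norm (X (r m) - X (r n)) < e" for e n N
  proof -
    have "(\<integral>\<^sup>+x. ennreal ((F x - rep_l2 (X (r n)) x)\<^sup>2) \<partial>I01) =
      (\<integral>\<^sup>+x. liminf (\<lambda>m. ennreal ((rep_l2 (X (r m)) x - rep_l2 (X (r n)) x)\<^sup>2)) \<partial>I01)"
    proof (rule nn_integral_cong_AE, use Flim in \<open>rule AE_mp\<close>, intro AE_I2 impI)
      fix x assume "(\<lambda>i. rep_l2 (X (r i)) x) \<longlonglongrightarrow> F x"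
      then have "(\<lambda>m. ennreal ((rep_l2 (X (r m)) x - rep_l2 (X (r n)) x)\<^sup>2)) \<longlonglongrightarrow> ennreal ((F x - rep_l2 (X (r n)) x)\<^sup>2)"
        by (intro tendsto_ennrealI tendsto_intros)
      then show "ennreal ((F x - rep_l2 (X (r n)) x)\<^sup>2) = liminf (\<lambda>m. ennreal ((rep_l2 (X (r m)) x - rep_l2 (X (r n)) x)\<^sup>2))"
        using lim_imp_Liminf[OF sequentially_bot] by metis
    qed
    also have "\<dots> \<le> liminf (\<lambda>m. \<integral>\<^sup>+x. ennreal ((rep_l2 (X (r m)) x - rep_l2 (X (r n)) x)\<^sup>2) \<partial>I01)"
      by (rule nn_integral_liminf) measurable
    also have "\<dots> = liminf (\<lambda>m. ennreal ((norm (X (r m) - X (r n)))\<^sup>2))"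
    proof (intro arg_cong[where f = liminf] ext)
      fix m
      have "(\<integral>\<^sup>+x. ennreal ((rep_l2 (X (r m)) x - rep_l2 (X (r n)) x)\<^sup>2) \<partial>I01) =
         (\<integral>\<^sup>+x. ennreal ((rep_l2 (X (r m) - X (r n)) x)\<^sup>2) \<partial>I01)"
        using rep_diff[of "X (r m)" "X (r n)"] by (intro nn_integral_cong_AE) auto
      also have "\<dots> = ennreal (\<integral>x. (rep_l2 (X (r m) - X (r n)) x)\<^sup>2 \<partial>I01)"
        using square_integrable_rep[of "X (r m) - X (r n)"]
        by (intro nn_integral_eq_integral) (auto simp: square_integrable_def)
      finally show "(\<integral>\<^sup>+x. ennreal ((rep_l2 (X (r m)) x - rep_l2 (X (r n)) x)\<^sup>2) \<partial>I01) = ennreal ((norm (X (r m) - X (r n)))\<^sup>2)"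
        by (simp add: norm_rep_l2)
    qed
    also have "\<dots> \<le> liminf (\<lambda>m. ennreal (e\<^sup>2))"
      by (intro Liminf_mono eventually_sequentiallyI[of N] ennreal_leI power_mono) (auto intro: less_imp_le[OF N])
    also have "\<dots> = ennreal (e\<^sup>2)" by (simp add: Liminf_const)
    finally have le: "(\<integral>\<^sup>+x. ennreal ((F x - rep_l2 (X (r n)) x)\<^sup>2) \<partial>I01) \<le> ennreal (e\<^sup>2)" .
    then have int: "integrable I01 (\<lambda>x. (F x - rep_l2 (X (r n)) x)\<^sup>2)"
      by (intro integrableI_nonneg) (auto intro: le_less_trans)
    moreover have "(\<integral>x. (F x - rep_l2 (X (r n)) x)\<^sup>2 \<partial>I01) \<le> e\<^sup>2"
      using le by (subst (asm) nn_integral_eq_integral[OF int]) auto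
    ultimately show ?thesis by (simp add: square_integrable_def)
  qed
  have near: "\<exists>N. \<forall>m\<ge>N. \<forall>n\<ge>N. norm (X (r m) - X (r n)) < e" if "0 < e" for e
  proof -
    obtain N where "\<And>i j. i \<ge> N \<Longrightarrow> j \<ge> N \<Longrightarrow> norm (X i - X j) < e"
      using C \<open>0 < e\<close> by (metis CauchyD)
    then have "norm (X (r m) - X (r n)) < e" if "m \<ge> N" "n \<ge> N" for m n
      using that seq_suble[OF r(1), of m] seq_suble[OF r(1), of n] by simp
    then show ?thesis by blast
  qed
  \<comment> \<open>A single term at distance at most 1 already shows that \<open>F\<close> is
    square integrable.\<close>
  obtain N1 where "\<forall>m\<ge>N1. \<forall>n\<ge>N1. norm (X (r m) - X (r n)) < 1" using near[of 1] by auto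
  then have "square_integrable (\<lambda>x. F x - rep_l2 (X (r N1)) x)" using bd[of 1 N1 N1] by auto
  from square_integrable_add[OF this square_integrable_rep[of "X (r N1)"]]
  have F: "square_integrable F" by simp
  have "(\<lambda>n. X (r n)) \<longlonglongrightarrow> abs_l2 F"
  proof (rule LIMSEQ_I)
    fix e :: real assume "0 < e"
    then have e2: "0 < e / 2" by simp
    obtain N where N: "\<forall>m\<ge>N. \<forall>n\<ge>N. norm (X (r m) - X (r n)) < e / 2" using near[OF e2] by auto
    have "norm (X (r n) - abs_l2 F) < e" if "n \<ge> N" for n
    proof -
      have *: "square_integrable (\<lambda>x. F x - rep_l2 (X (r n)) x)" "(\<integral>x. (F x - rep_l2 (X (r n)) x)\<^sup>2 \<partial>I01) \<le> (e/2)\<^sup>2"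
        using bd[OF e2, of N n] N that by auto
      have "abs_l2 (\<lambda>x. F x - rep_l2 (X (r n)) x) = abs_l2 F - X (r n)"
        using abs_l2_diff[OF F, of "rep_l2 (X (r n))"] by simp
      then have "(norm (abs_l2 F - X (r n)))\<^sup>2 \<le> (e/2)\<^sup>2" using norm_abs_l2[OF *(1)] *(2) by simp
      then have "norm (abs_l2 F - X (r n)) \<le> e / 2" using e2 by (simp add: abs_le_square_iff[symmetric])
      then show ?thesis using \<open>0 < e\<close> by (simp add: norm_minus_commute)
    qed
    then show "\<exists>N. \<forall>n\<ge>N. norm (X (r n) - abs_l2 F) < e" by blast
  qed
  then have "X \<longlonglongrightarrow> abs_l2 F"
    using Cauchy_converges_subseq[OF C r(1)] by (simp add: o_def)
  then show "convergent X" by (rule convergentI)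
qed

section \<open>Expansion in the orthonormal basis of eigenfunctions\<close>

lemma inner_ek_ek: "inner (ek j) (ek k) = (if j = k then 1 else 0)"
proof -
  let ?m = "real (Suc j) * pi" and ?n = "real (Suc k) * pi"
  have "inner (ek j) (ek k) = (\<integral>x. esin j x * esin k x \<partial>I01)"
    unfolding ek_def by (rule inner_abs_abs) auto
  also have "\<dots> = (\<integral>x. cos ((?m - ?n) * x) - cos ((?m + ?n) * x) \<partial>I01)"
  proof -
    have *: "sqrt 2 * sin A * (sqrt 2 * sin B) = cos (A - B) - cos (A + B)" for A B :: real
      by (simp add: cos_add cos_diff)
    show ?thesis unfolding esin_def left_diff_distrib distrib_right * ..
  qed
  also have "\<dots> = (if j = k then 1 else 0)"
  proof (cases "j = k")
    case True
    have "((\<lambda>x. x - sin ((?m + ?n) * x) / (?m + ?n)) has_real_derivative cos ((?m - ?n) * x) - cos ((?m + ?n) * x)) (at x)" for x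
    proof -
      have "?m + ?n > 0" by (intro add_pos_pos) auto
      then have "?m + ?n \<noteq> 0" by linarith
      then show ?thesis using True by (auto intro!: derivative_eq_intros simp del: of_nat_Suc)
    qed
    from I01_integral_FTC_full[OF this] show ?thesis
      using True sin_integer_2pi[of "real (Suc k)"] by (simp add: continuous_intros mult_2[symmetric] algebra_simps del: of_nat_Suc)
  next
    case False
    have ne: "?m + ?n \<noteq> 0" "?m - ?n \<noteq> 0"
    proof -
      have "?m + ?n > 0" by (intro add_pos_pos) auto
      then show "?m + ?n \<noteq> 0" by linarith
      show "?m - ?n \<noteq> 0" using False by simp
    qed
    have "((\<lambda>x. sin ((?m - ?n) * x) / (?m - ?n) - sin ((?m + ?n) * x) / (?m + ?n)) has_real_derivative cos ((?m - ?n) * x) - cos ((?m + ?n) * x)) (at x)" for x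
      using ne by (auto intro!: derivative_eq_intros simp del: of_nat_Suc)
    moreover have "sin (?m - ?n) = 0" "sin (?m + ?n) = 0"
      by (simp_all add: sin_add sin_diff sin_npi del: of_nat_Suc)
    ultimately show ?thesis
      using False I01_integral_FTC_full[of "\<lambda>x. sin ((?m - ?n) * x) / (?m - ?n) - sin ((?m + ?n) * x) / (?m + ?n)"]
      by (simp add: continuous_intros del: of_nat_Suc)
  qed
  finally show ?thesis .
qed

lemma norm_sum_ek:
  assumes "finite A" shows "(norm (\<Sum>k\<in>A. a k *\<^sub>R ek k))\<^sup>2 = (\<Sum>k\<in>A. (a k)\<^sup>2)"
proof -
  have "(norm (\<Sum>k\<in>A. a k *\<^sub>R ek k))\<^sup>2 = (\<Sum>j\<in>A. \<Sum>k\<in>A. a j * (a k * inner (ek j) (ek k)))"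
    unfolding power2_norm_eq_inner inner_sum_left by (simp add: inner_sum_right mult.left_commute)
  also have "\<dots> = (\<Sum>k\<in>A. (a k)\<^sup>2)"
    using assms by (simp add: inner_ek_ek if_distrib power2_eq_square cong: if_cong)
  finally show ?thesis .
qed

lemma ek_series_summable:
  assumes "summable (\<lambda>k. (a k)\<^sup>2)" shows "summable (\<lambda>k. a k *\<^sub>R ek k)"
  unfolding summable_Cauchy
proof (intro allI impI)
  fix e :: real assume "0 < e"
  then obtain N where N: "\<And>m n. m \<ge> N \<Longrightarrow> norm (\<Sum>k=m..<n. (a k)\<^sup>2) < e\<^sup>2"
    using assms unfolding summable_Cauchy by (meson zero_less_power)
  have "norm (\<Sum>k=m..<n. a k *\<^sub>R ek k) < e" if "m \<ge> N" for m n
  proof (rule power_less_imp_less_base)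
    show "(norm (\<Sum>k=m..<n. a k *\<^sub>R ek k))\<^sup>2 < e\<^sup>2"
      using N[OF that, of n] by (simp add: norm_sum_ek sum_nonneg)
  qed (use \<open>0 < e\<close> in simp)
  then show "\<exists>N. \<forall>m\<ge>N. \<forall>n. norm (\<Sum>k=m..<n. a k *\<^sub>R ek k) < e" by blast
qed

lemma ek_series_coeff:
  assumes "(\<lambda>k. a k *\<^sub>R ek k) sums v" shows "inner v (ek j) = a j"
proof -
  have "(\<lambda>k. inner (a k *\<^sub>R ek k) (ek j)) sums inner v (ek j)"
    using bounded_linear.sums[OF bounded_linear_inner_left assms] .
  moreover have "(\<lambda>k. inner (a k *\<^sub>R ek k) (ek j)) sums (\<Sum>k\<in>{j}. inner (a k *\<^sub>R ek k) (ek j))"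
    by (rule sums_finite) (auto simp: inner_ek_ek)
  ultimately show ?thesis by (auto simp: inner_ek_ek dest: sums_unique2)
qed

lemma bessel: "summable (\<lambda>k. (inner v (ek k))\<^sup>2)"
proof (rule summableI_nonneg_bounded)
  fix n
  let ?P = "\<Sum>k<n. inner v (ek k) *\<^sub>R ek k"
  have "inner v ?P = (\<Sum>k<n. (inner v (ek k))\<^sup>2)"
    by (simp add: inner_sum_right power2_eq_square)
  moreover have "inner ?P ?P = (\<Sum>k<n. (inner v (ek k))\<^sup>2)"
    using norm_sum_ek[of "{..<n}"] by (simp add: power2_norm_eq_inner)
  moreover have "0 \<le> inner (v - ?P) (v - ?P)" by simp
  ultimately show "(\<Sum>k<n. (inner v (ek k))\<^sup>2) \<le> (norm v)\<^sup>2"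
    by (simp add: inner_diff_left inner_diff_right power2_norm_eq_inner inner_commute)
qed simp

lemma ek_expansion: "(\<lambda>k. inner v (ek k) *\<^sub>R ek k) sums v"
proof -
  let ?w = "\<Sum>k. inner v (ek k) *\<^sub>R ek k"
  have s: "(\<lambda>k. inner v (ek k) *\<^sub>R ek k) sums ?w"
    by (intro summable_sums ek_series_summable bessel)
  then have "?w = v" by (intro ek_eqI) (rule ek_series_coeff)
  with s show ?thesis by simp
qed

lemma parseval: "(\<lambda>k. inner v (ek k) * inner w (ek k)) sums inner v w"
  using bounded_linear.sums[OF bounded_linear_inner_left ek_expansion, of v w]
  by (simp add: inner_commute[of "ek _"])

lemma parseval_norm: "(\<lambda>k. (inner v (ek k))\<^sup>2) sums (norm v)\<^sup>2"
  using parseval[of v v] unfolding power2_norm_eq_inner by (simp add: power2_eq_square)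

lemma parseval_abs_summable: "summable (\<lambda>k. \<bar>inner v (ek k) * inner w (ek k)\<bar>)"
proof (rule summable_comparison_test')
  show "summable (\<lambda>k. (inner v (ek k))\<^sup>2 + (inner w (ek k))\<^sup>2)" by (intro summable_add bessel)
  fix k
  have "2 * (\<bar>inner v (ek k)\<bar> * \<bar>inner w (ek k)\<bar>) \<le> (inner v (ek k))\<^sup>2 + (inner w (ek k))\<^sup>2"
    using sum_squares_bound[of "\<bar>inner v (ek k)\<bar>" "\<bar>inner w (ek k)\<bar>"] by (simp add: mult.assoc)
  moreover have "0 \<le> \<bar>inner v (ek k)\<bar> * \<bar>inner w (ek k)\<bar>" by simp
  ultimately show "norm \<bar>inner v (ek k) * inner w (ek k)\<bar> \<le> (inner v (ek k))\<^sup>2 + (inner w (ek k))\<^sup>2"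
    unfolding abs_mult real_norm_def by linarith
qed

section \<open>Test functions\<close>

text \<open>Smoothness is counted by the number of derivatives, so that closure properties follow by
  induction on \<open>n\<close> with one differentiation per step.\<close>

definition smooth_upto :: "nat \<Rightarrow> (real \<Rightarrow> real) \<Rightarrow> bool" where
  "smooth_upto n f \<longleftrightarrow> (\<forall>k<n. (deriv ^^ k) f differentiable_on UNIV)"

lemma smooth_upto_0 [simp]: "smooth_upto 0 f" by (simp add: smooth_upto_def)

lemma smooth_upto_Suc:
  "smooth_upto (Suc n) f \<longleftrightarrow> f differentiable_on UNIV \<and> smooth_upto n (deriv f)"
  unfolding smooth_upto_def by (auto simp: less_Suc_eq_0_disj funpow_Suc_right simp del: funpow.simps)

lemma smooth_upto_SucI:
  assumes "\<And>x. (f has_real_derivative f' x) (at x)" "smooth_upto n f'"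
  shows "smooth_upto (Suc n) f"
proof -
  have "deriv f = f'" by (rule ext) (rule DERIV_imp_deriv[OF assms(1)])
  moreover have "f differentiable_on UNIV"
    unfolding differentiable_on_def using assms(1) real_differentiable_def by blast
  ultimately show ?thesis using assms(2) by (simp add: smooth_upto_Suc)
qed

lemma smooth_upto_SucD:
  assumes "smooth_upto (Suc n) f"
  shows "(f has_real_derivative deriv f x) (at x)" "smooth_upto n (deriv f)"
proof -
  have "f differentiable (at x)" using assms by (simp add: smooth_upto_Suc differentiable_on_def)
  then show "(f has_real_derivative deriv f x) (at x)" by (simp add: DERIV_deriv_iff_real_differentiable)
  show "smooth_upto n (deriv f)" using assms by (simp add: smooth_upto_Suc)
qed

lemma smooth_upto_mono: "smooth_upto (Suc n) f \<Longrightarrow> smooth_upto n f"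
  by (auto simp: smooth_upto_def)

lemma smooth_upto_add: "smooth_upto n f \<Longrightarrow> smooth_upto n g \<Longrightarrow> smooth_upto n (\<lambda>x. f x + g x)"
proof (induction n arbitrary: f g)
  case (Suc n)
  note f = smooth_upto_SucD[OF Suc.prems(1)] and g = smooth_upto_SucD[OF Suc.prems(2)]
  show ?case
    by (rule smooth_upto_SucI[OF DERIV_add[OF f(1) g(1)] Suc.IH[OF f(2) g(2)]])
qed simp

lemma smooth_upto_mult: "smooth_upto n f \<Longrightarrow> smooth_upto n g \<Longrightarrow> smooth_upto n (\<lambda>x. f x * g x)"
proof (induction n arbitrary: f g)
  case (Suc n)
  note f = smooth_upto_SucD[OF Suc.prems(1)] and g = smooth_upto_SucD[OF Suc.prems(2)]
  note f' = smooth_upto_mono[OF Suc.prems(1)] and g' = smooth_upto_mono[OF Suc.prems(2)]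
  show ?case
    by (rule smooth_upto_SucI[OF DERIV_mult[OF f(1) g(1)]])
       (intro smooth_upto_add Suc.IH f(2) g(2) f' g')
qed simp

lemma smooth_upto_const: "smooth_upto n (\<lambda>x. c)"
proof (induction n arbitrary: c)
  case (Suc n)
  show ?case by (rule smooth_upto_SucI[OF DERIV_const Suc.IH])
qed simp

lemma smooth_upto_affine: "smooth_upto n f \<Longrightarrow> smooth_upto n (\<lambda>x. f (a * x + c))"
proof (induction n arbitrary: f)
  case (Suc n)
  note f = smooth_upto_SucD[OF Suc.prems]
  have "((\<lambda>x. f (a * x + c)) has_real_derivative deriv f (a * x + c) * a) (at x)" for x
    by (rule DERIV_chain2[OF f(1)]) (auto intro!: derivative_eq_intros)
  then show ?case
    by (rule smooth_upto_SucI[OF _ smooth_upto_mult[OF Suc.IH[OF f(2)] smooth_upto_const]])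
qed simp

lemma smooth_upto_sin: "smooth_upto n (\<lambda>x. sin (x + c))"
proof (induction n arbitrary: c)
  case (Suc n)
  have "((\<lambda>x. sin (x + c)) has_real_derivative sin (x + (c + pi / 2))) (at x)" for x
    by (auto intro!: derivative_eq_intros simp: sin_add cos_add add.assoc[symmetric])
  then show ?case by (rule smooth_upto_SucI) (rule Suc.IH)
qed simp

lemma smooth_upto_esin: "smooth_upto n (esin k)"
proof -
  have "smooth_upto n (\<lambda>x. sqrt 2 * sin ((real (Suc k) * pi) * x + 0 + 0))"
    by (rule smooth_upto_mult[OF smooth_upto_const smooth_upto_affine[OF smooth_upto_sin]])
  then show ?thesis by (simp add: esin_def[abs_def])
qed

lemma smooth_upto_polynomial: "real_polynomial_function p \<Longrightarrow> smooth_upto n p"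
proof (induction n arbitrary: p)
  case (Suc n)
  obtain p' where "real_polynomial_function p'" "\<And>x. (p has_real_derivative p' x) (at x)"
    using has_real_derivative_polynomial_function[OF Suc.prems] by blast
  then show ?case using Suc.IH smooth_upto_SucI by blast
qed simp

text \<open>\<open>bump 0\<close> is the classical flat function exp(-1/x); the powers of 1/x make
  the family closed under differentiation up to linear combinations.\<close>

definition bump :: "nat \<Rightarrow> real \<Rightarrow> real" where
  "bump k x = (if 0 < x then (1 / x) ^ k * exp (- (1 / x)) else 0)"

lemma bump_nonneg: "0 \<le> bump k x" by (simp add: bump_def)

lemma bump_tendsto_0: "((\<lambda>x. bump k x) \<longlongrightarrow> 0) (at_right 0)"
proof -
  have "((\<lambda>y::real. y ^ k / exp y) \<longlongrightarrow> 0) at_top" by (rule tendsto_power_div_exp_0)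
  then have "((\<lambda>x::real. (inverse x) ^ k / exp (inverse x)) \<longlongrightarrow> 0) (at_right 0)"
    by (rule filterlim_compose) (rule filterlim_inverse_at_top_right)
  moreover have "eventually (\<lambda>x. (inverse x) ^ k / exp (inverse x) = bump k x) (at_right (0::real))"
    using eventually_at_right_less[of "0::real"] 
    by eventually_elim (simp add: bump_def divide_inverse exp_minus)
  ultimately show ?thesis by (rule Lim_transform_eventually)
qed

lemma bump_deriv: "(bump k has_real_derivative bump (Suc (Suc k)) x + (- real k) * bump (Suc k) x) (at x)"
proof -
  consider "0 < x" | "x < 0" | "x = 0" by linarith
  then show ?thesis
  proof cases
    case 1
    have "((\<lambda>x. (1 / x) ^ k * exp (- (1 / x))) has_real_derivative
       bump (Suc (Suc k)) x + (- real k) * bump (Suc k) x) (at x)"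
    proof -
      have d: "((\<lambda>x. 1 / x) has_real_derivative - ((1 / x)\<^sup>2)) (at x)"
        using 1 by (auto intro!: derivative_eq_intros simp: power2_eq_square)
      have "((\<lambda>x. exp (- (1 / x))) has_real_derivative exp (- (1 / x)) * - (- ((1 / x)\<^sup>2))) (at x)"
        by (rule DERIV_chain2[OF DERIV_exp DERIV_minus[OF d]])
      note D = DERIV_mult[OF DERIV_power[OF d, of k] this]
      define y where "y = 1 / x"
      have b: "bump j x = y ^ j * exp (- y)" for j using 1 by (simp add: bump_def y_def)
      show ?thesis
        by (rule DERIV_cong[OF D], unfold b y_def[symmetric], cases k)
           (simp_all add: power2_eq_square algebra_simps)
    qed
    then show ?thesis
      by (rule DERIV_cong_ev[THEN iffD1, OF refl _ refl, rotated])
         (use 1 in \<open>auto simp: eventually_nhds bump_def intro!: exI[of _ "{0<..}"]\<close>)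
  next
    case 2
    have "((\<lambda>x. 0) has_real_derivative bump (Suc (Suc k)) x + (- real k) * bump (Suc k) x) (at x)"
      using 2 by (simp add: bump_def)
    then show ?thesis
      by (rule DERIV_cong_ev[THEN iffD1, OF refl _ refl, rotated])
         (use 2 in \<open>auto simp: eventually_nhds bump_def intro!: exI[of _ "{..<0}"]\<close>)
  next
    case 3
    \<comment> \<open>At 0 the right difference quotient of \<open>bump k\<close> is
      \<open>bump (Suc k)\<close>, which tends to 0.\<close>
    have "((\<lambda>h. (bump k (0 + h) - bump k 0) / h) \<longlongrightarrow> 0) (at 0)"
    proof (rule filterlim_split_at)
      show "((\<lambda>h. (bump k (0 + h) - bump k 0) / h) \<longlongrightarrow> 0) (at_right 0)"
        using bump_tendsto_0[of "Suc k"]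
      proof (rule Lim_transform_eventually)
        show "eventually (\<lambda>h. bump (Suc k) h = (bump k (0 + h) - bump k 0) / h) (at_right (0::real))"
          using eventually_at_right_less[of "0::real"] by eventually_elim (simp add: bump_def)
      qed
      show "((\<lambda>h. (bump k (0 + h) - bump k 0) / h) \<longlongrightarrow> 0) (at_left 0)"
        by (rule tendsto_eventually) (auto simp: eventually_at_filter bump_def)
    qed
    then show ?thesis using 3 by (simp add: DERIV_def bump_def)
  qed
qed

lemma smooth_upto_bump: "smooth_upto n (bump k)"
proof (induction n arbitrary: k)
  case (Suc n)
  show ?case
    by (rule smooth_upto_SucI[OF bump_deriv])
       (rule smooth_upto_add[OF Suc.IH smooth_upto_mult[OF smooth_upto_const Suc.IH]])
qed simp

lemma bump_0_le_1: "bump 0 x \<le> 1"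
  by (simp add: bump_def)

text \<open>\<open>bump 2\<close> is the derivative of \<open>bump 0\<close>. For the argument
  \<open>n * x - 1\<close> the weight is \<open>n * x\<close>, that is, the factor from the chain
  rule times the distance to the end point. The constant 3 makes the quadratic Taylor polynomial of
  the exponential dominate \<open>s + s\<^sup>2\<close>.\<close>

lemma bump_2_bound: "(x + 1) * bump 2 x \<le> 3"
proof (cases "0 < x")
  case True
  define s where "s = 1 / x"
  have s: "0 < s" using True by (simp add: s_def)
  have e: "(x + 1) * bump 2 x = (s + s\<^sup>2) * exp (- s)"
    using True by (simp add: bump_def s_def power2_eq_square field_simps)
  have "s + s\<^sup>2 \<le> 3 * exp s"
    using exp_lower_Taylor_quadratic[of s] s exp_gt_zero[of s] by linarith
  then have "(s + s\<^sup>2) * exp (- s) \<le> 3 * exp s * exp (- s)" by (intro mult_right_mono) auto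
  also have "\<dots> = 3" by (simp add: exp_minus)
  finally show ?thesis using e by simp
qed (simp add: bump_def)

lemma bump_tendsto_at_top: "(bump 0 \<longlongrightarrow> 1) at_top" "((\<lambda>x. (x + 1) * bump 2 x) \<longlongrightarrow> 0) at_top"
proof -
  have i: "((\<lambda>x::real. 1 / x) \<longlongrightarrow> 0) at_top"
    by (intro tendsto_divide_0[OF tendsto_const] filterlim_at_top_imp_at_infinity filterlim_ident)
  have "((\<lambda>x::real. exp (- (1 / x))) \<longlongrightarrow> exp (- 0)) at_top"
    by (intro tendsto_intros i)
  then have "((\<lambda>x::real. exp (- (1 / x))) \<longlongrightarrow> 1) at_top" by simp
  moreover have "eventually (\<lambda>x::real. exp (- (1 / x)) = bump 0 x) at_top"
    using eventually_gt_at_top[of "0::real"] by eventually_elim (simp add: bump_def)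
  ultimately show "(bump 0 \<longlongrightarrow> 1) at_top" by (rule Lim_transform_eventually)
  have "((\<lambda>x::real. ((1 / x) + (1 / x) ^ 2) * exp (- (1 / x))) \<longlongrightarrow> (0 + 0 ^ 2) * exp (- 0)) at_top"
    by (intro tendsto_intros i)
  then have "((\<lambda>x::real. ((1 / x) + (1 / x) ^ 2) * exp (- (1 / x))) \<longlongrightarrow> 0) at_top" by simp
  moreover have "eventually (\<lambda>x::real. ((1 / x) + (1 / x) ^ 2) * exp (- (1 / x)) = (x + 1) * bump 2 x) at_top"
    using eventually_gt_at_top[of "0::real"]
    by eventually_elim (simp add: bump_def power2_eq_square field_simps)
  ultimately show "((\<lambda>x. (x + 1) * bump 2 x) \<longlongrightarrow> 0) at_top" by (rule Lim_transform_eventually)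
qed

text \<open>These cutoffs have no plateau; all that is needed is pointwise convergence to 1 on \<open>(0,1)\<close> and
  the uniform bound of \<open>x (1 - x) cutoff' n x\<close>.\<close>

definition cutoff :: "nat \<Rightarrow> real \<Rightarrow> real" where
  "cutoff n x = bump 0 (real n * x - 1) * bump 0 (real n * (1 - x) - 1)"

definition cutoff' :: "nat \<Rightarrow> real \<Rightarrow> real" where
  "cutoff' n x = real n * bump 2 (real n * x - 1) * bump 0 (real n * (1 - x) - 1)
     - real n * bump 0 (real n * x - 1) * bump 2 (real n * (1 - x) - 1)"

lemma cutoff_deriv: "(cutoff n has_real_derivative cutoff' n x) (at x)"
proof -
  have b: "(bump 0 has_real_derivative bump 2 y) (at y)" for y
    using bump_deriv[of 0 y] by (simp add: numeral_2_eq_2)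
  have "((\<lambda>x. bump 0 (real n * x - 1)) has_real_derivative bump 2 (real n * x - 1) * real n) (at x)"
    by (rule DERIV_chain2[OF b]) (auto intro!: derivative_eq_intros)
  moreover have "((\<lambda>x. bump 0 (real n * (1 - x) - 1)) has_real_derivative bump 2 (real n * (1 - x) - 1) * (- real n)) (at x)"
    by (rule DERIV_chain2[OF b]) (auto intro!: derivative_eq_intros)
  ultimately show ?thesis
    unfolding cutoff_def[abs_def] cutoff'_def
    by (rule DERIV_cong[OF DERIV_mult]) (simp add: algebra_simps)
qed

lemma smooth_upto_cutoff: "smooth_upto m (cutoff n)"
proof -
  have "smooth_upto m (\<lambda>x. bump 0 (real n * x + (- 1)) * bump 0 ((- real n) * x + (real n - 1)))"
    by (rule smooth_upto_mult[OF smooth_upto_affine[OF smooth_upto_bump] smooth_upto_affine[OF smooth_upto_bump]])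
  then show ?thesis by (simp add: cutoff_def[abs_def] algebra_simps)
qed

lemma cutoff_bounds: "0 \<le> cutoff n x" "cutoff n x \<le> 1"
  unfolding cutoff_def using bump_nonneg bump_0_le_1 by (auto intro: mult_le_one)

lemma cutoff_support:
  assumes "cutoff n x \<noteq> 0" shows "0 < n" "1 / real n < x" "x < 1 - 1 / real n"
proof -
  have a: "1 < real n * x" "1 < real n * (1 - x)"
    using assms by (auto simp: cutoff_def bump_def split: if_splits)
  show n: "0 < n" using a by (cases n) auto
  show "1 / real n < x" "x < 1 - 1 / real n" using a n by (auto simp: field_simps)
qed

lemma real_mult_minus_at_top:
  assumes "0 < c" shows "filterlim (\<lambda>n. real n * c - 1) at_top sequentially"
proof -
  have "filterlim (\<lambda>n. - 1 + c * real n) at_top sequentially"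
    by (rule filterlim_tendsto_add_at_top[OF tendsto_const
          filterlim_tendsto_pos_mult_at_top[OF tendsto_const assms filterlim_real_sequentially]])
  then show ?thesis by (simp add: algebra_simps)
qed

lemma cutoff_tendsto: "0 < x \<Longrightarrow> x < 1 \<Longrightarrow> (\<lambda>n. cutoff n x) \<longlonglongrightarrow> 1"
  unfolding cutoff_def
  using tendsto_mult[OF filterlim_compose[OF bump_tendsto_at_top(1) real_mult_minus_at_top[of x]]
     filterlim_compose[OF bump_tendsto_at_top(1) real_mult_minus_at_top[of "1 - x"]]] by simp

text \<open>The factor \<open>n\<close> from the chain rule is absorbed by the distance to the end
  point near which the respective bump drops to zero.\<close>

lemma cutoff'_bound:
  assumes "0 \<le> x" "x \<le> 1"
  shows "\<bar>x * (1 - x) * cutoff' n x\<bar> \<le> (real n * x) * bump 2 (real n * x - 1) + (real n * (1 - x)) * bump 2 (real n * (1 - x) - 1)"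
proof -
  let ?a = "(real n * x) * bump 2 (real n * x - 1)" and ?b = "(real n * (1 - x)) * bump 2 (real n * (1 - x) - 1)"
  let ?c = "(1 - x) * bump 0 (real n * (1 - x) - 1)" and ?d = "x * bump 0 (real n * x - 1)"
  have e: "x * (1 - x) * cutoff' n x = ?a * ?c - ?b * ?d" by (simp add: cutoff'_def algebra_simps)
  have c: "0 \<le> ?c" "?c \<le> 1" "0 \<le> ?d" "?d \<le> 1"
    using assms bump_nonneg bump_0_le_1 by (auto intro!: mult_le_one)
  have "0 \<le> ?a" "0 \<le> ?b" using assms bump_nonneg by auto
  then have "0 \<le> ?a * ?c" "?a * ?c \<le> ?a" "0 \<le> ?b * ?d" "?b * ?d \<le> ?b"
    using c by (auto simp: mult_left_le)
  then show ?thesis unfolding e by linarith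
qed

lemma cutoff'_bound_const:
  assumes "0 \<le> x" "x \<le> 1" shows "\<bar>x * (1 - x) * cutoff' n x\<bar> \<le> 6"
  using cutoff'_bound[OF assms, of n] bump_2_bound[of "real n * x - 1"] bump_2_bound[of "real n * (1 - x) - 1"]
  by simp

lemma cutoff'_tendsto:
  assumes "0 < x" "x < 1" shows "(\<lambda>n. x * (1 - x) * cutoff' n x) \<longlonglongrightarrow> 0"
proof (rule Lim_null_comparison)
  have "(\<lambda>n. (real n * x - 1 + 1) * bump 2 (real n * x - 1) + (real n * (1 - x) - 1 + 1) * bump 2 (real n * (1 - x) - 1)) \<longlonglongrightarrow> 0 + 0"
    using assms by (intro tendsto_add filterlim_compose[OF bump_tendsto_at_top(2)] real_mult_minus_at_top) auto
  then show "(\<lambda>n. (real n * x) * bump 2 (real n * x - 1) + (real n * (1 - x)) * bump 2 (real n * (1 - x) - 1)) \<longlonglongrightarrow> 0"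
    by simp
  show "\<forall>\<^sub>F n in sequentially. norm (x * (1 - x) * cutoff' n x) \<le> (real n * x) * bump 2 (real n * x - 1) + (real n * (1 - x)) * bump 2 (real n * (1 - x) - 1)"
    unfolding real_norm_def using assms by (intro always_eventually allI cutoff'_bound) auto
qed

lemma test_functionsI:
  assumes "\<And>n. smooth_upto n f" "0 < a" "c < 1" "\<And>x. f x \<noteq> 0 \<Longrightarrow> a \<le> x \<and> x \<le> c"
  shows "f \<in> test_functions"
proof -
  have sub: "closure {x. f x \<noteq> 0} \<subseteq> {a..c}"
    by (rule closure_minimal) (use assms(4) in auto)
  moreover have "compact (closure {x. f x \<noteq> 0})"
    using bounded_subset[OF bounded_closed_interval sub] by (simp add: compact_eq_bounded_closed)
  moreover have "(deriv ^^ k) f differentiable_on UNIV" for k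
    using assms(1)[of "Suc k"] by (auto simp: smooth_upto_def)
  ultimately show ?thesis using assms(2,3) by (auto simp: test_functions_def)
qed

lemma cutoff_mult_test:
  assumes "\<And>n. smooth_upto n f" shows "(\<lambda>x. cutoff m x * f x) \<in> test_functions"
proof (cases "m = 0")
  case True
  \<comment> \<open>\<open>cutoff 0\<close> vanishes identically, because both bumps are evaluated
    at -1.\<close>
  then have "(\<lambda>x. cutoff m x * f x) = (\<lambda>x. 0)" by (auto simp: cutoff_def bump_def)
  then show ?thesis by (auto intro!: test_functionsI[of _ "1/2" "1/2"] smooth_upto_const)
next
  case False
  show ?thesis
  proof (rule test_functionsI)
    show "smooth_upto n (\<lambda>x. cutoff m x * f x)" for n by (intro smooth_upto_mult smooth_upto_cutoff assms)
    show "0 < 1 / real m" "1 - 1 / real m < 1" using False by auto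
    show "1 / real m \<le> x \<and> x \<le> 1 - 1 / real m" if "cutoff m x * f x \<noteq> 0" for x
      using cutoff_support[of m x] that by auto
  qed
qed

lemma test_functionD:
  assumes "\<phi> \<in> test_functions"
  shows "smooth_upto n \<phi>" "(\<phi> has_real_derivative deriv \<phi> x) (at x)" "continuous_on UNIV \<phi>" "continuous_on UNIV (deriv \<phi>)"
    "x \<le> 0 \<or> 1 \<le> x \<Longrightarrow> \<phi> x = 0"
proof -
  show s: "smooth_upto n \<phi>" for n using assms unfolding test_functions_def smooth_upto_def by blast
  show d: "(\<phi> has_real_derivative deriv \<phi> x) (at x)" for x by (rule smooth_upto_SucD(1)[OF s[of "Suc 0"]])
  show "continuous_on UNIV \<phi>" by (rule continuous_at_imp_continuous_on) (use DERIV_isCont[OF d] in blast)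
  have "(deriv \<phi> has_real_derivative deriv (deriv \<phi>) x) (at x)" for x
    using smooth_upto_SucD(2)[OF s[of "Suc (Suc 0)"]] by (rule smooth_upto_SucD(1))
  then show "continuous_on UNIV (deriv \<phi>)"
    by (intro continuous_at_imp_continuous_on ballI) (rule DERIV_isCont)
  assume "x \<le> 0 \<or> 1 \<le> x"
  moreover have "{x. \<phi> x \<noteq> 0} \<subseteq> {0<..<1}"
    using assms closure_subset[of "{x. \<phi> x \<noteq> 0}"] unfolding test_functions_def by blast
  ultimately show "\<phi> x = 0" by force
qed

section \<open>The Dirichlet Laplacian\<close>

lemma test_square_integrable:
  assumes "\<phi> \<in> test_functions"
  shows "square_integrable \<phi>" "square_integrable (deriv \<phi>)"
  using test_functionD(3,4)[OF assms] by (auto intro: continuous_square_integrable)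

lemma esin_deriv: "(esin k has_real_derivative sqrt 2 * (real (Suc k) * pi) * cos (real (Suc k) * pi * x)) (at x)"
  unfolding esin_def[abs_def] by (auto intro!: derivative_eq_intros simp del: of_nat_Suc)

definition ecos :: "nat \<Rightarrow> real \<Rightarrow> real" where
  "ecos k x = sqrt 2 * (real (Suc k) * pi) * cos (real (Suc k) * pi * x)"

lemma esin_deriv': "(esin k has_real_derivative ecos k x) (at x)"
  unfolding ecos_def by (rule esin_deriv)

lemma ecos_deriv: "(ecos k has_real_derivative - (lam k * esin k x)) (at x)"
  unfolding ecos_def[abs_def] esin_def lam_def
  by (auto intro!: derivative_eq_intros simp: power2_eq_square simp del: of_nat_Suc)

lemma ecos_continuous: "continuous_on S (ecos k)"
  unfolding ecos_def by (intro continuous_intros)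

lemma ecos_square_integrable [simp]: "square_integrable (ecos k)"
  by (rule continuous_square_integrable[OF ecos_continuous])

lemma esin_boundary: "esin k 0 = 0" "esin k 1 = 0"
  by (simp_all add: esin_def sin_npi del: of_nat_Suc)

lemma abs_sin_mult_le: "\<bar>sin (real n * y)\<bar> \<le> real n * \<bar>sin y\<bar>"
proof (induction n)
  case (Suc n)
  have "\<bar>sin (real (Suc n) * y)\<bar> = \<bar>sin (real n * y) * cos y + cos (real n * y) * sin y\<bar>"
    by (simp add: sin_add algebra_simps)
  also have "\<dots> \<le> \<bar>sin (real n * y)\<bar> * \<bar>cos y\<bar> + \<bar>cos (real n * y)\<bar> * \<bar>sin y\<bar>"
    by (metis abs_mult abs_triangle_ineq)
  also have "\<dots> \<le> \<bar>sin (real n * y)\<bar> * 1 + 1 * \<bar>sin y\<bar>"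
    by (intro add_mono mult_left_mono mult_right_mono) auto
  also have "\<dots> \<le> real n * \<bar>sin y\<bar> + \<bar>sin y\<bar>" using Suc by simp
  finally show ?case by (simp add: algebra_simps)
qed simp

text \<open>The sine vanishes linearly at both ends; of \<open>x\<close> and \<open>1 - x\<close>
  one is at least 1/2, whence the factor 2. This weight is what compensates the growth of
  \<open>cutoff'\<close>.\<close>

lemma sin_pi_le: "0 \<le> x \<Longrightarrow> x \<le> 1 \<Longrightarrow> \<bar>sin (pi * x)\<bar> \<le> 2 * pi * (x * (1 - x))"
proof -
  assume x: "0 \<le> x" "x \<le> 1"
  have a: "\<bar>sin (pi * x)\<bar> \<le> pi * x" using abs_sin_x_le_abs_x[of "pi * x"] x by simp
  have "sin (pi * (1 - x)) = sin (pi * x)" by (simp add: right_diff_distrib sin_diff)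
  then have b: "\<bar>sin (pi * x)\<bar> \<le> pi * (1 - x)" using abs_sin_x_le_abs_x[of "pi * (1 - x)"] x by simp
  show ?thesis
  proof (cases "x \<le> 1 / 2")
    case True
    have "x * 1 \<le> x * (2 * (1 - x))" using True x by (intro mult_left_mono) auto
    then have "pi * x \<le> pi * (x * (2 * (1 - x)))" by (intro mult_left_mono) auto
    also have "pi * (x * (2 * (1 - x))) = 2 * pi * (x * (1 - x))" by (simp only: mult_ac)
    finally show ?thesis using a by linarith
  next
    case False
    have "(1 - x) * 1 \<le> (1 - x) * (2 * x)" using False x by (intro mult_left_mono) auto
    then have "pi * (1 - x) \<le> pi * ((1 - x) * (2 * x))" by (intro mult_left_mono) auto
    also have "pi * ((1 - x) * (2 * x)) = 2 * pi * (x * (1 - x))" by (simp only: mult_ac)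
    finally show ?thesis using b by linarith
  qed
qed

lemma esin_le: "0 \<le> x \<Longrightarrow> x \<le> 1 \<Longrightarrow> \<bar>esin k x\<bar> \<le> (sqrt 2 * real (Suc k) * 2 * pi) * (x * (1 - x))"
proof -
  assume x: "0 \<le> x" "x \<le> 1"
  have "\<bar>esin k x\<bar> \<le> sqrt 2 * (real (Suc k) * \<bar>sin (pi * x)\<bar>)"
    using abs_sin_mult_le[of "Suc k" "pi * x"] by (simp add: esin_def abs_mult mult.assoc del: of_nat_Suc)
  also have "\<dots> \<le> sqrt 2 * (real (Suc k) * (2 * pi * (x * (1 - x))))"
    using sin_pi_le[OF x] by (intro mult_left_mono) auto
  finally show ?thesis by (simp only: mult.assoc)
qed

lemma cutoff_measurable [measurable]: "cutoff n \<in> borel_measurable I01" "cutoff' n \<in> borel_measurable I01"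
proof -
  show "cutoff n \<in> borel_measurable I01"
    by (intro measurable_I01 borel_measurable_continuous_onI continuous_at_imp_continuous_on ballI DERIV_isCont[OF cutoff_deriv])
  have "cutoff' n = deriv (cutoff n)" using DERIV_imp_deriv[OF cutoff_deriv] by (metis ext)
  moreover have "(deriv (cutoff n) has_real_derivative deriv (deriv (cutoff n)) x) (at x)" for x
    using smooth_upto_SucD(2)[OF smooth_upto_cutoff[of "Suc (Suc 0)"]] by (rule smooth_upto_SucD(1))
  ultimately have "continuous_on UNIV (cutoff' n)" 
    by (metis DERIV_isCont continuous_at_imp_continuous_on)
  then show "cutoff' n \<in> borel_measurable I01"
    by (intro measurable_I01 borel_measurable_continuous_onI)
qed

lemma integral_cutoff_tendsto:
  assumes f: "integrable I01 f"
  shows "(\<lambda>n. \<integral>x. f x * cutoff n x \<partial>I01) \<longlonglongrightarrow> (\<integral>x. f x \<partial>I01)"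
proof (rule integral_dominated_convergence[where w = "\<lambda>x. \<bar>f x\<bar>"])
  have [measurable]: "f \<in> borel_measurable I01" using f by auto
  show "f \<in> borel_measurable I01" "(\<lambda>x. f x * cutoff n x) \<in> borel_measurable I01" for n by measurable
  show "integrable I01 (\<lambda>x. \<bar>f x\<bar>)" using f by simp
  show "AE x in I01. norm (f x * cutoff n x) \<le> \<bar>f x\<bar>" for n
    using cutoff_bounds by (intro AE_I2) (auto simp: abs_mult intro!: mult_left_le)
  show "AE x in I01. (\<lambda>n. f x * cutoff n x) \<longlonglongrightarrow> f x"
  proof (intro AE_I2)
    fix x assume "x \<in> space I01"
    then have "(\<lambda>n. f x * cutoff n x) \<longlonglongrightarrow> f x * 1"
      by (intro tendsto_mult tendsto_const cutoff_tendsto) (auto simp: space_I01)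
    then show "(\<lambda>n. f x * cutoff n x) \<longlonglongrightarrow> f x" by simp
  qed
qed

text \<open>Cutting off an eigenfunction costs nothing in the limit: it vanishes linearly at the
  ends, so the dangerous product with \<open>cutoff'\<close> stays bounded and tends to 0
  pointwise.\<close>

lemma integral_cutoff'_tendsto:
  assumes f: "integrable I01 f"
  shows "(\<lambda>n. \<integral>x. f x * (cutoff' n x * esin k x) \<partial>I01) \<longlonglongrightarrow> 0"
proof -
  let ?C = "sqrt 2 * real (Suc k) * 2 * pi"
  have C: "0 \<le> ?C" by simp
  have b: "\<bar>cutoff' n x * esin k x\<bar> \<le> ?C * \<bar>x * (1 - x) * cutoff' n x\<bar>" if "0 < x" "x < 1" for n x
  proof -
    have "\<bar>cutoff' n x * esin k x\<bar> \<le> \<bar>cutoff' n x\<bar> * (?C * (x * (1 - x)))"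
      unfolding abs_mult using esin_le[of x k] that by (intro mult_left_mono) auto
    also have "x * (1 - x) = \<bar>x * (1 - x)\<bar>" using that by simp
    also have "\<bar>cutoff' n x\<bar> * (?C * \<bar>x * (1 - x)\<bar>) = ?C * \<bar>x * (1 - x) * cutoff' n x\<bar>"
      by (simp only: abs_mult mult_ac)
    finally show ?thesis .
  qed
  have "(\<lambda>n. \<integral>x. f x * (cutoff' n x * esin k x) \<partial>I01) \<longlonglongrightarrow> (\<integral>x. 0 \<partial>I01)"
  proof (rule integral_dominated_convergence[where w = "\<lambda>x. \<bar>f x\<bar> * (?C * 6)"])
    have [measurable]: "f \<in> borel_measurable I01" using f by auto
    have [measurable]: "esin k \<in> borel_measurable I01"
      by (intro measurable_I01 borel_measurable_continuous_onI esin_continuous)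
    show "(\<lambda>x. f x * (cutoff' n x * esin k x)) \<in> borel_measurable I01" for n by measurable
    show "integrable I01 (\<lambda>x. \<bar>f x\<bar> * (?C * 6))" using f by simp
    show "AE x in I01. norm (f x * (cutoff' n x * esin k x)) \<le> \<bar>f x\<bar> * (?C * 6)" for n
    proof (intro AE_I2)
      fix x assume x: "x \<in> space I01"
      have "\<bar>cutoff' n x * esin k x\<bar> \<le> ?C * \<bar>x * (1 - x) * cutoff' n x\<bar>" using b x by (simp add: space_I01)
      also have "\<dots> \<le> ?C * 6" using x C by (intro mult_left_mono cutoff'_bound_const) (auto simp: space_I01)
      finally show "norm (f x * (cutoff' n x * esin k x)) \<le> \<bar>f x\<bar> * (?C * 6)"
        unfolding real_norm_def abs_mult[of "f x"] by (intro mult_left_mono) auto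
    qed
    show "AE x in I01. (\<lambda>n. f x * (cutoff' n x * esin k x)) \<longlonglongrightarrow> 0"
    proof (intro AE_I2 tendsto_mult_right_zero)
      fix x assume x: "x \<in> space I01"
      have "(\<lambda>n. ?C * \<bar>x * (1 - x) * cutoff' n x\<bar>) \<longlonglongrightarrow> ?C * \<bar>0\<bar>"
        using x by (intro tendsto_mult tendsto_const tendsto_rabs cutoff'_tendsto) (auto simp: space_I01)
      then have "(\<lambda>n. ?C * \<bar>x * (1 - x) * cutoff' n x\<bar>) \<longlonglongrightarrow> 0" by simp
      then show "(\<lambda>n. cutoff' n x * esin k x) \<longlonglongrightarrow> 0"
        by (rule Lim_null_comparison[rotated])
           (use b x in \<open>auto simp: space_I01 intro!: always_eventually\<close>)
    qed
  qed simp
  then show ?thesis by simp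
qed

text \<open>Eigenfunctions multiplied by a cutoff are test functions and tend to the eigenfunctions,
  which are total.\<close>

lemma test_total:
  assumes "\<And>\<phi>. \<phi> \<in> test_functions \<Longrightarrow> (\<integral>x. rep_l2 v x * \<phi> x \<partial>I01) = 0"
  shows "v = 0"
proof (rule ek_total)
  fix k
  have "(\<lambda>n. \<integral>x. rep_l2 v x * esin k x * cutoff n x \<partial>I01) \<longlonglongrightarrow> (\<integral>x. rep_l2 v x * esin k x \<partial>I01)"
    by (intro integral_cutoff_tendsto integrable_rep_mult) simp
  moreover have "(\<integral>x. rep_l2 v x * esin k x * cutoff n x \<partial>I01) = 0" for n
    using assms[OF cutoff_mult_test[OF smooth_upto_esin[of _ k], of n]] by (simp add: mult_ac)
  ultimately show "inner v (ek k) = 0" by (simp add: inner_ek LIMSEQ_const_iff)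
qed

section \<open>Weak derivatives and the action of the operator on the modes\<close>

lemma has_weak_deriv_unique:
  assumes "has_weak_deriv v g" "has_weak_deriv v h" shows "g = h"
proof -
  have "g - h = 0"
  proof (rule test_total)
    fix \<phi> assume \<phi>: "\<phi> \<in> test_functions"
    have "(\<integral>x. rep_l2 (g - h) x * \<phi> x \<partial>I01) = inner (g - h) (abs_l2 \<phi>)"
      by (rule inner_abs[symmetric]) (rule test_square_integrable[OF \<phi>])
    also have "\<dots> = (\<integral>x. rep_l2 g x * \<phi> x \<partial>I01) - (\<integral>x. rep_l2 h x * \<phi> x \<partial>I01)"
      by (simp add: inner_diff_left inner_abs test_square_integrable[OF \<phi>])
    also have "\<dots> = 0" using assms \<phi> by (simp add: has_weak_deriv_def)
    finally show "(\<integral>x. rep_l2 (g - h) x * \<phi> x \<partial>I01) = 0" .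
  qed
  then show ?thesis by simp
qed

lemma weak_deriv_eq: "has_weak_deriv v g \<Longrightarrow> weak_deriv v = g"
  unfolding weak_deriv_def by (rule some_equality) (auto intro: has_weak_deriv_unique)

lemma has_weak_deriv_inner:
  "has_weak_deriv v g \<longleftrightarrow> (\<forall>\<phi>\<in>test_functions. inner v (abs_l2 (deriv \<phi>)) = - inner g (abs_l2 \<phi>))"
  unfolding has_weak_deriv_def by (auto simp: inner_abs test_square_integrable)

lemma has_weak_deriv_diff:
  "has_weak_deriv v g \<Longrightarrow> has_weak_deriv w h \<Longrightarrow> has_weak_deriv (v - w) (g - h)"
  by (simp add: has_weak_deriv_inner inner_diff_left)

lemma has_weak_deriv_test:
  assumes \<phi>: "\<phi> \<in> test_functions" shows "has_weak_deriv (abs_l2 \<phi>) (abs_l2 (deriv \<phi>))"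
  unfolding has_weak_deriv_inner
proof
  fix \<psi> assume \<psi>: "\<psi> \<in> test_functions"
  note p = test_functionD[OF \<phi>] and s = test_functionD[OF \<psi>]
  have "((\<lambda>x. \<phi> x * \<psi> x) has_real_derivative deriv \<phi> x * \<psi> x + deriv \<psi> x * \<phi> x) (at x)" for x
    by (rule DERIV_mult[OF p(2) s(2)])
  moreover have "continuous_on UNIV (\<lambda>x. deriv \<phi> x * \<psi> x + deriv \<psi> x * \<phi> x)"
    by (intro continuous_intros p(3,4) s(3,4))
  ultimately have "(\<integral>x. deriv \<phi> x * \<psi> x + deriv \<psi> x * \<phi> x \<partial>I01) = \<phi> 1 * \<psi> 1 - \<phi> 0 * \<psi> 0"
    by (rule I01_integral_FTC_full)
  then have "(\<integral>x. deriv \<phi> x * \<psi> x + deriv \<psi> x * \<phi> x \<partial>I01) = 0"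
    using p(5)[of 0] p(5)[of 1] by simp
  moreover have "integrable I01 (\<lambda>x. deriv \<phi> x * \<psi> x)" "integrable I01 (\<lambda>x. deriv \<psi> x * \<phi> x)"
    by (intro square_integrable_mult test_square_integrable \<phi> \<psi>)+
  ultimately show "inner (abs_l2 \<phi>) (abs_l2 (deriv \<psi>)) = - inner (abs_l2 (deriv \<phi>)) (abs_l2 \<psi>)"
    by (simp add: inner_abs_abs test_square_integrable \<phi> \<psi> mult.commute)
qed

text \<open>Two integrations by parts whose boundary terms vanish for different reasons: in the
  first the eigenfunction is zero at the ends, in the second \<open>v\<close> lies in the closure of
  the test functions.\<close>

lemma dom_A_coeff:
  assumes v: "v \<in> dom_A" shows "inner (op_A v) (ek k) = lam k * inner v (ek k)"
proof -
  define p where "p = weak_deriv v"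
  define q where "q = weak_deriv p"
  have p: "has_weak_deriv v p" and q: "has_weak_deriv p q"
    using v someI_ex[of "has_weak_deriv v"] someI_ex[of "has_weak_deriv p"]
    unfolding dom_A_def H2_def H1_def p_def q_def weak_deriv_def by auto
  let ?e = "abs_l2 (ecos k)"
  \<comment> \<open>The weak derivative \<open>p\<close> satisfies no boundary condition, so the
    eigenfunction is cut off to become a test function and the cutoff is then removed.\<close>
  have 1: "inner q (ek k) = - inner p ?e"
  proof -
    have d: "deriv (\<lambda>x. cutoff n x * esin k x) x = cutoff' n x * esin k x + ecos k x * cutoff n x" for n x
      by (rule DERIV_imp_deriv[OF DERIV_mult[OF cutoff_deriv esin_deriv']])
    have e: "(\<integral>x. rep_l2 p x * (cutoff' n x * esin k x) \<partial>I01) + (\<integral>x. rep_l2 p x * ecos k x * cutoff n x \<partial>I01) =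
        - (\<integral>x. rep_l2 q x * esin k x * cutoff n x \<partial>I01)" for n
    proof -
      have t: "(\<lambda>x. cutoff n x * esin k x) \<in> test_functions" by (rule cutoff_mult_test[OF smooth_upto_esin])
      have i2: "integrable I01 (\<lambda>x. rep_l2 p x * ecos k x * cutoff n x)"
      proof (rule Bochner_Integration.integrable_bound[OF integrable_rep_mult[OF ecos_square_integrable, of p k]])
        have [measurable]: "ecos k \<in> borel_measurable I01"
          using ecos_square_integrable[of k] by (simp add: square_integrable_def del: ecos_square_integrable)
        show "(\<lambda>x. rep_l2 p x * ecos k x * cutoff n x) \<in> borel_measurable I01" by measurable
        show "AE x in I01. norm (rep_l2 p x * ecos k x * cutoff n x) \<le> norm (rep_l2 p x * ecos k x)"
          using cutoff_bounds[of n] by (intro AE_I2) (auto simp: abs_mult intro!: mult_left_le)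
      qed
      have "integrable I01 (\<lambda>x. rep_l2 p x * deriv (\<lambda>x. cutoff n x * esin k x) x)"
        by (rule integrable_rep_mult[OF test_square_integrable(2)[OF t]])
      then have "integrable I01 (\<lambda>x. rep_l2 p x * deriv (\<lambda>x. cutoff n x * esin k x) x - rep_l2 p x * ecos k x * cutoff n x)"
        using i2 by (rule Bochner_Integration.integrable_diff)
      then have i1: "integrable I01 (\<lambda>x. rep_l2 p x * (cutoff' n x * esin k x))"
        unfolding d by (simp add: algebra_simps)
      have "(\<integral>x. rep_l2 p x * deriv (\<lambda>x. cutoff n x * esin k x) x \<partial>I01) = - (\<integral>x. rep_l2 q x * (cutoff n x * esin k x) \<partial>I01)"
        using q t unfolding has_weak_deriv_def by blast
      moreover have "(\<integral>x. rep_l2 p x * deriv (\<lambda>x. cutoff n x * esin k x) x \<partial>I01) =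
          (\<integral>x. rep_l2 p x * (cutoff' n x * esin k x) + rep_l2 p x * ecos k x * cutoff n x \<partial>I01)"
        unfolding d by (simp add: algebra_simps)
      ultimately show ?thesis using i1 i2 by (simp add: mult_ac)
    qed
    have "(\<lambda>n. (\<integral>x. rep_l2 p x * (cutoff' n x * esin k x) \<partial>I01) + (\<integral>x. rep_l2 p x * ecos k x * cutoff n x \<partial>I01))
       \<longlonglongrightarrow> 0 + (\<integral>x. rep_l2 p x * ecos k x \<partial>I01)"
      by (intro tendsto_add integral_cutoff'_tendsto integral_cutoff_tendsto integrable_rep_mult integrable_rep ecos_square_integrable)
    moreover have "(\<lambda>n. - (\<integral>x. rep_l2 q x * esin k x * cutoff n x \<partial>I01)) \<longlonglongrightarrow> - (\<integral>x. rep_l2 q x * esin k x \<partial>I01)"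
      by (intro tendsto_minus integral_cutoff_tendsto integrable_rep_mult esin_square_integrable)
    ultimately have "(\<integral>x. rep_l2 p x * ecos k x \<partial>I01) = - (\<integral>x. rep_l2 q x * esin k x \<partial>I01)"
      unfolding e using LIMSEQ_unique by fastforce
    then show ?thesis by (simp add: inner_ek inner_abs)
  qed
  \<comment> \<open>The identity is exact for test functions, and both sides are continuous in the
    norm of \<open>H1\<close>; a discrepancy \<open>d\<close> would contradict the approximation of
    \<open>v\<close>. \<open>K\<close> is the continuity constant.\<close>
  have 2: "inner p ?e = lam k * inner v (ek k)"
  proof (rule ccontr)
    assume ne: "inner p ?e \<noteq> lam k * inner v (ek k)"
    define K where "K = norm ?e + lam k * norm (ek k)"
    define d where "d = \<bar>inner p ?e - lam k * inner v (ek k)\<bar>"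
    have lam0: "0 \<le> lam k" by (simp add: lam_def)
    have K0: "0 \<le> K" by (simp add: K_def lam0)
    have "0 < d / (K + 1)" using ne K0 by (simp add: d_def)
    moreover have "v \<in> H1_0" using v by (simp add: dom_A_def)
    ultimately obtain \<phi> where \<phi>: "\<phi> \<in> test_functions" "H1_norm (v - abs_l2 \<phi>) < d / (K + 1)"
      unfolding H1_0_def by blast
    have wd: "weak_deriv (v - abs_l2 \<phi>) = p - abs_l2 (deriv \<phi>)"
      by (intro weak_deriv_eq has_weak_deriv_diff p has_weak_deriv_test \<phi>)
    let ?h = "H1_norm (v - abs_l2 \<phi>)"
    have n: "norm (v - abs_l2 \<phi>) \<le> ?h" "norm (p - abs_l2 (deriv \<phi>)) \<le> ?h"
      unfolding H1_norm_def wd by (auto intro: real_le_rsqrt)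
    note pp = test_functionD[OF \<phi>(1)]
    have "((\<lambda>x. \<phi> x * ecos k x) has_real_derivative deriv \<phi> x * ecos k x + (- (lam k * esin k x)) * \<phi> x) (at x)" for x
      by (rule DERIV_mult[OF pp(2) ecos_deriv])
    moreover have "continuous_on UNIV (\<lambda>x. deriv \<phi> x * ecos k x + (- (lam k * esin k x)) * \<phi> x)"
      by (intro continuous_intros pp(3,4) esin_continuous ecos_continuous)
    ultimately have "(\<integral>x. deriv \<phi> x * ecos k x + (- (lam k * esin k x)) * \<phi> x \<partial>I01) = \<phi> 1 * ecos k 1 - \<phi> 0 * ecos k 0"
      by (rule I01_integral_FTC_full)
    then have "(\<integral>x. deriv \<phi> x * ecos k x + (- (lam k * esin k x)) * \<phi> x \<partial>I01) = 0"
      using pp(5)[of 0] pp(5)[of 1] by simp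
    moreover have "integrable I01 (\<lambda>x. deriv \<phi> x * ecos k x)" "integrable I01 (\<lambda>x. \<phi> x * esin k x)"
      by (intro square_integrable_mult test_square_integrable \<phi> ecos_square_integrable esin_square_integrable)+
    ultimately have "inner (abs_l2 (deriv \<phi>)) ?e = lam k * inner (abs_l2 \<phi>) (ek k)"
      unfolding ek_def by (simp add: inner_abs_abs test_square_integrable \<phi> mult_ac)
    then have "inner p ?e - lam k * inner v (ek k) = inner (p - abs_l2 (deriv \<phi>)) ?e - lam k * inner (v - abs_l2 \<phi>) (ek k)"
      by (simp add: inner_diff_left right_diff_distrib)
    then have "d \<le> \<bar>inner (p - abs_l2 (deriv \<phi>)) ?e\<bar> + lam k * \<bar>inner (v - abs_l2 \<phi>) (ek k)\<bar>"
      unfolding d_def using lam0 by (metis abs_mult abs_of_nonneg abs_triangle_ineq4)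
    also have "\<dots> \<le> ?h * norm ?e + lam k * (?h * norm (ek k))"
      using n lam0 by (intro add_mono mult_left_mono order_trans[OF Cauchy_Schwarz_ineq2] mult_right_mono) auto
    also have "\<dots> = ?h * K" by (simp add: K_def algebra_simps)
    also have "\<dots> \<le> d / (K + 1) * K" using \<phi>(2) K0 by (intro mult_right_mono) auto
    finally show False using ne K0 by (simp add: d_def field_simps)
  qed
  show ?thesis using 1 2 by (simp add: op_A_def p_def q_def)
qed

lemma lam_pos: "0 < lam k"
  by (simp add: lam_def)

lemma lam_ge: "pi\<^sup>2 \<le> lam k"
proof -
  have "1 * pi\<^sup>2 \<le> (real (Suc k))\<^sup>2 * pi\<^sup>2" by (intro mult_right_mono one_le_power) auto
  then show ?thesis by (simp add: lam_def power_mult_distrib del: of_nat_Suc)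
qed

section \<open>Approximation by test functions and the Green operator\<close>

lemma ex_antiderivative:
  fixes f :: "real \<Rightarrow> real"
  assumes "continuous_on UNIV f"
  shows "\<exists>F. \<forall>x. (F has_real_derivative f x) (at x)"
proof -
  have "\<exists>F. \<forall>x. - \<infinity> < ereal x \<longrightarrow> ereal x < \<infinity> \<longrightarrow> (F has_vector_derivative f x) (at x)"
    using assms by (intro einterval_antiderivative) (auto simp: continuous_on_eq_continuous_at)
  then show ?thesis by (auto simp: has_real_derivative_iff_has_vector_derivative)
qed

text \<open>A negative value would persist on a nonempty open set, which is not negligible.\<close>

lemma continuous_AE_nonneg:
  assumes "continuous_on UNIV f" "AE x in I01. 0 \<le> f x" "0 < x" "x < 1"
  shows "0 \<le> (f x :: real)"
proof (rule ccontr)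
  assume neg: "\<not> 0 \<le> f x"
  let ?S = "{x. f x < 0} \<inter> {0<..<1}"
  have o: "open ?S"
    using assms(1) by (intro open_Int open_Collect_less) (auto intro: continuous_intros)
  have "AE x in lborel. x \<in> {0<..<1} \<longrightarrow> 0 \<le> f x"
    using assms(2) by (subst (asm) AE_restrict_space_iff) auto
  then have "AE x in lborel. x \<notin> ?S" by (rule AE_mp) auto
  then have "?S \<in> null_sets lborel"
    using AE_iff_null_sets[of ?S lborel] o by simp
  then have "negligible ?S" unfolding negligible_iff_null_sets by (rule null_sets_completionI)
  moreover have "x \<in> ?S" using neg assms(3,4) by simp
  ultimately show False using open_not_negligible[OF o] by blast
qed

lemma integral_abs_le_norm:
  assumes "square_integrable f" shows "(\<integral>x. \<bar>f x\<bar> \<partial>I01) \<le> norm (abs_l2 f)"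
proof -
  have "(\<integral>x. \<bar>f x\<bar> \<partial>I01) = (\<integral>x. \<bar>rep_l2 (abs_l2 f) x\<bar> \<partial>I01)"
    using assms rep_abs_l2[OF assms] unfolding square_integrable_def
    by (intro integral_cong_AE) (auto intro!: borel_measurable_abs)
  then show ?thesis using integral_abs_rep_le by simp
qed

lemma norm_abs_l2_le:
  assumes "square_integrable f" "\<And>x. 0 < x \<Longrightarrow> x < 1 \<Longrightarrow> \<bar>f x\<bar> \<le> C" "0 \<le> C"
  shows "norm (abs_l2 f) \<le> C"
proof -
  have "(norm (abs_l2 f))\<^sup>2 = (\<integral>x. (f x)\<^sup>2 \<partial>I01)" by (rule norm_abs_l2[OF assms(1)])
  also have "\<dots> \<le> (\<integral>x. C\<^sup>2 \<partial>I01)"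
  proof (rule integral_mono)
    show "integrable I01 (\<lambda>x. (f x)\<^sup>2)" using assms(1) by (simp add: square_integrable_def)
    show "(f x)\<^sup>2 \<le> C\<^sup>2" if "x \<in> space I01" for x
      using assms(2)[of x] assms(3) that by (simp add: space_I01 abs_le_square_iff[symmetric])
  qed simp
  also have "\<dots> = C\<^sup>2" by (simp add: space_I01)
  finally show ?thesis using assms(3) by (simp add: abs_le_square_iff[symmetric])
qed

lemma primitive_diff_fun:
  assumes "integrable I01 f" "integrable I01 g"
  shows "primitive f x - primitive g x = primitive (\<lambda>y. f y - g y) x"
proof -
  have "primitive f x - primitive g x = (\<integral>y. (if y \<le> x then f y else 0) - (if y \<le> x then g y else 0) \<partial>I01)"
    unfolding primitive_def using primitive_integrable[OF assms(1)] primitive_integrable[OF assms(2)] by simp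
  also have "\<dots> = primitive (\<lambda>y. f y - g y) x"
    unfolding primitive_def by (intro Bochner_Integration.integral_cong) auto
  finally show ?thesis .
qed

lemma primitive_eq_primitive:
  assumes "\<And>x. (F has_real_derivative f x) (at x)" "continuous_on UNIV f" "0 \<le> x" "x \<le> 1"
  shows "primitive f x = F x - F 0"
proof -
  have "primitive f x = (\<integral>y. f y * indicator {0..x} y \<partial>I01)"
    unfolding primitive_def by (intro Bochner_Integration.integral_cong) (auto simp: space_I01 indicator_def)
  then show ?thesis using I01_integral_FTC[of 0 x F f] assms by simp
qed

text \<open>Weierstrass approximation of \<open>p\<close>, cut off near the boundary and corrected by a fixed bump to
  have mean zero, so that its primitive is again compactly supported.\<close>

lemma test_approx:
  assumes p: "continuous_on UNIV p" "(\<integral>x. p x \<partial>I01) = 0" and e: "0 < e"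
  shows "\<exists>\<phi>\<in>test_functions. norm (abs_l2 (primitive p) - abs_l2 \<phi>) \<le> e \<and> norm (abs_l2 p - abs_l2 (deriv \<phi>)) \<le> e"
proof -
  have ps: "square_integrable p" by (rule continuous_square_integrable[OF p(1)])
  have cc: "continuous_on UNIV (cutoff n)" for n
    by (intro continuous_at_imp_continuous_on ballI DERIV_isCont[OF cutoff_deriv])
  \<comment> \<open>The fixed bump that corrects the mean; it is positive at 1/2, so its integral
    \<open>B\<close> is positive.\<close>
  define b where "b = cutoff 4"
  have bs: "square_integrable b" unfolding b_def by (rule continuous_square_integrable[OF cc])
  have b01: "0 \<le> b x" "b x \<le> 1" for x by (auto simp: b_def cutoff_bounds)
  define B where "B = (\<integral>x. b x \<partial>I01)"
  have B: "0 < B"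
  proof (rule ccontr)
    assume "\<not> 0 < B"
    moreover have "0 \<le> B" unfolding B_def using b01 by (intro integral_nonneg_AE) auto
    ultimately have "(\<integral>x. b x \<partial>I01) = 0" by (simp add: B_def)
    then have "AE x in I01. b x = 0"
      using integral_nonneg_eq_0_iff_AE[OF square_integrable_integrable[OF bs]] b01 by auto
    then have "AE x in I01. 0 \<le> - b x" by (rule AE_mp) auto
    then have "0 \<le> - b (1/2)"
      by (rule continuous_AE_nonneg[rotated]) (auto simp: b_def intro!: continuous_intros cc)
    then show False by (simp add: b_def cutoff_def bump_def flip: exp_add)
  qed
  \<comment> \<open>The cut-off polynomial is within \<open>2 * e1\<close> of \<open>p\<close> and
    the correction of the mean costs at most another \<open>2 * e1 / B\<close>; together this is
    \<open>e\<close>.\<close>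
  define e1 where "e1 = e / (2 * (1 + 1 / B))"
  have e1: "0 < e1" using e B by (simp add: e1_def add_pos_pos)
  obtain P where P: "real_polynomial_function P" "\<And>x. x \<in> {0..1} \<Longrightarrow> \<bar>p x - P x\<bar> < e1"
    using Stone_Weierstrass_real_polynomial_function[OF compact_Icc continuous_on_subset[OF p(1)] e1, of 0 1] by blast
  have Pc: "continuous_on UNIV P" using P(1)
    by (simp add: continuous_on_polymonial_function real_polynomial_function_eq)
  define f where "f n x = p x - cutoff n x * P x" for n x
  have fs: "square_integrable (f n)" for n
    unfolding f_def by (intro continuous_square_integrable continuous_intros p(1) Pc cc)
  have "continuous_on UNIV (\<lambda>x. \<bar>p x\<bar> + \<bar>P x\<bar>)" by (intro continuous_intros p(1) Pc)
  then obtain M where M: "\<And>x. 0 \<le> x \<Longrightarrow> x \<le> 1 \<Longrightarrow> \<bar>\<bar>p x\<bar> + \<bar>P x\<bar>\<bar> \<le> M"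
    by (rule continuous_bounded_unit) blast
  have "(\<lambda>n. \<integral>x. (f n x)\<^sup>2 \<partial>I01) \<longlonglongrightarrow> (\<integral>x. (p x - P x)\<^sup>2 \<partial>I01)"
  proof (rule integral_dominated_convergence[where w = "\<lambda>x. M\<^sup>2"])
    show "(\<lambda>x. (p x - P x)\<^sup>2) \<in> borel_measurable I01"
      by (intro measurable_I01 borel_measurable_continuous_onI continuous_intros p(1) Pc)
    show "(\<lambda>x. (f n x)\<^sup>2) \<in> borel_measurable I01" for n
      using fs[of n] by (auto simp: square_integrable_def)
    show "AE x in I01. norm ((f n x)\<^sup>2) \<le> M\<^sup>2" for n
    proof (intro AE_I2)
      fix x assume x: "x \<in> space I01"
      have "\<bar>cutoff n x * P x\<bar> \<le> \<bar>P x\<bar>" using cutoff_bounds[of n x] by (auto simp: abs_mult intro!: mult_left_le_one_le)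
      then have "\<bar>f n x\<bar> \<le> M" using M[of x] x unfolding f_def by (simp add: space_I01)
      then show "norm ((f n x)\<^sup>2) \<le> M\<^sup>2" using power_mono[of "\<bar>f n x\<bar>" M 2] by simp
    qed
    show "AE x in I01. (\<lambda>n. (f n x)\<^sup>2) \<longlonglongrightarrow> (p x - P x)\<^sup>2"
    proof (intro AE_I2)
      fix x assume "x \<in> space I01"
      then have "(\<lambda>n. (p x - cutoff n x * P x)\<^sup>2) \<longlonglongrightarrow> (p x - 1 * P x)\<^sup>2"
        by (intro tendsto_intros cutoff_tendsto) (auto simp: space_I01)
      then show "(\<lambda>n. (f n x)\<^sup>2) \<longlonglongrightarrow> (p x - P x)\<^sup>2" by (simp add: f_def)
    qed
  qed simp
  moreover have "(\<integral>x. (p x - P x)\<^sup>2 \<partial>I01) < (2 * e1)\<^sup>2"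
  proof -
    have s: "square_integrable (\<lambda>x. p x - P x)"
      by (intro continuous_square_integrable continuous_intros p(1) Pc)
    have "norm (abs_l2 (\<lambda>x. p x - P x)) \<le> e1"
      by (rule norm_abs_l2_le[OF s]) (use P(2) e1 in \<open>auto intro: less_imp_le\<close>)
    then have "norm (abs_l2 (\<lambda>x. p x - P x)) < 2 * e1" using e1 by simp
    then have "(norm (abs_l2 (\<lambda>x. p x - P x)))\<^sup>2 < (2 * e1)\<^sup>2" by (intro power_strict_mono) auto
    then show ?thesis using norm_abs_l2[OF s] by simp
  qed
  ultimately have "eventually (\<lambda>n. (\<integral>x. (f n x)\<^sup>2 \<partial>I01) < (2 * e1)\<^sup>2) sequentially"
    by (rule order_tendstoD(2))
  then obtain n where "(\<integral>x. (f n x)\<^sup>2 \<partial>I01) < (2 * e1)\<^sup>2"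
    using eventually_happens sequentially_bot by blast
  then have "(norm (abs_l2 (f n)))\<^sup>2 < (2 * e1)\<^sup>2" using norm_abs_l2[OF fs] by simp
  then have fn: "norm (abs_l2 (f n)) < 2 * e1"
    by (rule power_less_imp_less_base) (use e1 in simp)
  \<comment> \<open>Since \<open>p\<close> has mean zero, the mean of the cut-off polynomial is
    itself an approximation error, so the correction is small.\<close>
  define m where "m = (\<integral>x. cutoff n x * P x \<partial>I01) / B"
  have cPs: "square_integrable (\<lambda>x. cutoff n x * P x)"
    by (intro continuous_square_integrable continuous_intros Pc cc)
  have "\<bar>\<integral>x. cutoff n x * P x \<partial>I01\<bar> = \<bar>\<integral>x. f n x \<partial>I01\<bar>"
    unfolding f_def using p(2) square_integrable_integrable[OF ps] square_integrable_integrable[OF cPs] by simp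
  also have "\<dots> \<le> (\<integral>x. \<bar>f n x\<bar> \<partial>I01)" by (rule integral_abs_bound)
  also have "\<dots> < 2 * e1" using integral_abs_le_norm[OF fs, of n] fn by linarith
  finally have m: "\<bar>m\<bar> \<le> 2 * e1 / B"
    using B by (simp add: m_def divide_right_mono)
  define \<eta> where "\<eta> x = cutoff n x * P x - m * b x" for x
  have \<eta>c: "continuous_on UNIV \<eta>" unfolding \<eta>_def b_def by (intro continuous_intros Pc cc)
  note \<eta>s = continuous_square_integrable[OF \<eta>c]
  have \<eta>sm: "smooth_upto k \<eta>" for k
  proof -
    have "smooth_upto k (\<lambda>x. cutoff n x * P x + (- m) * cutoff 4 x)"
      by (rule smooth_upto_add[OF smooth_upto_mult[OF smooth_upto_cutoff smooth_upto_polynomial[OF P(1)]]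
            smooth_upto_mult[OF smooth_upto_const smooth_upto_cutoff]])
    then show ?thesis by (simp add: \<eta>_def[abs_def] b_def)
  qed
  have \<eta>0: "(\<integral>x. \<eta> x \<partial>I01) = 0"
    using B square_integrable_integrable[OF cPs] square_integrable_integrable[OF bs]
    by (simp add: \<eta>_def m_def B_def)
  have p\<eta>: "norm (abs_l2 (\<lambda>x. p x - \<eta> x)) \<le> e"
  proof -
    have "(\<lambda>x. p x - \<eta> x) = (\<lambda>x. f n x + m * b x)" by (auto simp: \<eta>_def f_def)
    then have "abs_l2 (\<lambda>x. p x - \<eta> x) = abs_l2 (f n) + m *\<^sub>R abs_l2 b"
      using abs_l2_add[OF fs square_integrable_scale[OF bs]] abs_l2_scale[OF bs] by simp
    then have "norm (abs_l2 (\<lambda>x. p x - \<eta> x)) \<le> norm (abs_l2 (f n)) + \<bar>m\<bar> * norm (abs_l2 b)"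
      by (metis norm_scaleR norm_triangle_ineq)
    also have "\<dots> \<le> 2 * e1 + (2 * e1 / B) * 1"
    proof (intro add_mono mult_mono m)
      show "norm (abs_l2 b) \<le> 1" by (rule norm_abs_l2_le[OF bs]) (use b01 in auto)
    qed (use fn e1 B in auto)
    also have "\<dots> = e1 * (2 * (1 + 1 / B))" by (simp add: algebra_simps)
    also have "\<dots> = e" using B by (simp add: e1_def add_pos_pos less_imp_neq[symmetric])
    finally show ?thesis .
  qed
  obtain \<Phi> where \<Phi>: "\<And>x. (\<Phi> has_real_derivative \<eta> x) (at x)" using ex_antiderivative[OF \<eta>c] by blast
  define \<phi> where "\<phi> x = \<Phi> x - \<Phi> 0" for x
  have d\<phi>: "(\<phi> has_real_derivative \<eta> x) (at x)" for x
    unfolding \<phi>_def[abs_def] using \<Phi>[of x] by (auto intro!: derivative_eq_intros)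
  have \<phi>primitive: "primitive \<eta> x = \<phi> x" if "0 \<le> x" "x \<le> 1" for x
    using primitive_eq_primitive[OF d\<phi> \<eta>c that] by (simp add: \<phi>_def)
  have \<phi>1: "\<phi> 0 = 0" "\<phi> 1 = 0" by (simp add: \<phi>_def) (use \<phi>primitive[of 1] primitive_at_1[of 1 \<eta>] \<eta>0 in simp)
  \<comment> \<open>With \<open>n + 4\<close> in the denominator this margin fits the supports of
    both \<open>cutoff n\<close> and \<open>cutoff 4\<close>.\<close>
  define a where "a = 1 / real (n + 4)"
  have a: "0 < a" "a < 1" by (auto simp: a_def)
  have an: "a \<le> 1 / real k" if "0 < k" "k \<le> n + 4" for k
    unfolding a_def using that by (intro divide_left_mono) auto
  have supp: "a < x \<and> x < 1 - a" if "\<eta> x \<noteq> 0" for x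
  proof -
    have "cutoff n x \<noteq> 0 \<or> cutoff 4 x \<noteq> 0" using that by (auto simp: \<eta>_def b_def)
    then show ?thesis
    proof
      assume c: "cutoff n x \<noteq> 0"
      show ?thesis using cutoff_support[OF c] an[of n] by simp
    next
      assume c: "cutoff 4 x \<noteq> 0"
      show ?thesis using cutoff_support[OF c] an[of 4] by simp
    qed
  qed
  have \<phi>t: "\<phi> \<in> test_functions"
  proof (rule test_functionsI)
    show "smooth_upto k \<phi>" for k
      by (rule smooth_upto_mono[OF smooth_upto_SucI[OF d\<phi> \<eta>sm]])
    show "0 < a" "1 - a < 1" using a by auto
    fix x assume x: "\<phi> x \<noteq> 0"
    have z: "\<eta> y = 0" if "y \<le> a \<or> 1 - a \<le> y" for y using supp[of y] that by linarith
    show "a \<le> x \<and> x \<le> 1 - a"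
    proof (rule ccontr)
      assume "\<not> (a \<le> x \<and> x \<le> 1 - a)"
      then consider "x < a" | "1 - a < x" by linarith
      then show False
      proof cases
        case 1
        \<comment> \<open>Outside the support of its derivative, \<open>\<phi>\<close> is constant:
          on the left the constant is fixed by the value at 0, on the right by the value at 1, which
          is 0 because the derivative has mean zero.\<close>
        have "\<exists>c. \<forall>y\<in>{..a}. \<phi> y = c"
        proof (rule has_field_derivative_zero_constant)
          fix y assume "y \<in> {..a}"
          then have "\<eta> y = 0" using z[of y] by simp
          then show "(\<phi> has_real_derivative 0) (at y within {..a})"
            using has_field_derivative_at_within[OF d\<phi>[of y]] by simp
        qed simp
        then obtain c where c: "\<And>y. y \<in> {..a} \<Longrightarrow> \<phi> y = c" by blast
        show False using c[of x] c[of 0] 1 a x \<phi>1 by simp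
      next
        case 2
        have "\<exists>c. \<forall>y\<in>{1 - a..}. \<phi> y = c"
        proof (rule has_field_derivative_zero_constant)
          fix y assume "y \<in> {1 - a..}"
          then have "\<eta> y = 0" using z[of y] by simp
          then show "(\<phi> has_real_derivative 0) (at y within {1 - a..})"
            using has_field_derivative_at_within[OF d\<phi>[of y]] by simp
        qed simp
        then obtain c where c: "\<And>y. y \<in> {1 - a..} \<Longrightarrow> \<phi> y = c" by blast
        show False using c[of x] c[of 1] 2 a x \<phi>1 by simp
      qed
    qed
  qed
  have "deriv \<phi> = \<eta>" by (rule ext) (rule DERIV_imp_deriv[OF d\<phi>])
  then have n2: "norm (abs_l2 p - abs_l2 (deriv \<phi>)) \<le> e"
    using p\<eta> abs_l2_diff[OF ps \<eta>s] by simp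
  have \<phi>s: "square_integrable \<phi>" by (rule test_square_integrable(1)[OF \<phi>t])
  note Jps = primitive_square_integrable[OF square_integrable_integrable[OF ps]]
  have "norm (abs_l2 (\<lambda>x. primitive p x - \<phi> x)) \<le> e"
  proof (rule norm_abs_l2_le[OF square_integrable_diff[OF Jps \<phi>s]])
    fix x :: real assume x: "0 < x" "x < 1"
    have "primitive p x - \<phi> x = primitive (\<lambda>y. p y - \<eta> y) x"
      unfolding primitive_diff_fun[OF square_integrable_integrable[OF ps] square_integrable_integrable[OF \<eta>s], symmetric]
      using \<phi>primitive[of x] x by simp
    also have "\<bar>\<dots>\<bar> \<le> (\<integral>y. \<bar>p y - \<eta> y\<bar> \<partial>I01)"
      by (intro primitive_bound square_integrable_integrable square_integrable_diff ps \<eta>s)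
    also have "\<dots> \<le> norm (abs_l2 (\<lambda>y. p y - \<eta> y))"
      by (intro integral_abs_le_norm square_integrable_diff ps \<eta>s)
    finally show "\<bar>primitive p x - \<phi> x\<bar> \<le> e" using p\<eta> by linarith
  qed (use e in simp)
  then have "norm (abs_l2 (primitive p) - abs_l2 \<phi>) \<le> e" using abs_l2_diff[OF Jps \<phi>s] by simp
  then show ?thesis using \<phi>t n2 by blast
qed

text \<open>The solution operator of \<open>- v'' = g\<close>, \<open>v(0) = v(1) = 0\<close>: first \<open>v'\<close>, normalised to mean zero,
  then \<open>v\<close>.\<close>

definition green_deriv :: "l2 \<Rightarrow> real \<Rightarrow> real" where
  "green_deriv g x = (\<integral>y. primitive (rep_l2 g) y \<partial>I01) - primitive (rep_l2 g) x"

definition green_op :: "l2 \<Rightarrow> l2" where "green_op g = abs_l2 (primitive (green_deriv g))"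

lemma green_deriv_continuous: "continuous_on UNIV (green_deriv g)"
  unfolding green_deriv_def by (intro continuous_intros primitive_continuous integrable_rep)

lemma green_deriv_square_integrable: "square_integrable (green_deriv g)"
  by (rule continuous_square_integrable[OF green_deriv_continuous])

lemma primitive_rep_integrable: "integrable I01 (primitive (rep_l2 g))"
  by (intro square_integrable_integrable primitive_square_integrable integrable_rep)

lemma green_deriv_mean: "(\<integral>x. green_deriv g x \<partial>I01) = 0"
  unfolding green_deriv_def using primitive_rep_integrable by (simp add: space_I01)

lemma primitive_green_deriv_square_integrable: "square_integrable (primitive (green_deriv g))"
  by (intro primitive_square_integrable square_integrable_integrable green_deriv_square_integrable)

text \<open>The constant that normalises the mean drops out, since the derivative of a function
  vanishing at both ends integrates to zero.\<close>

lemma green_deriv_by_parts: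
  assumes "\<And>x. (\<psi> has_real_derivative \<psi>' x) (at x)" "continuous_on UNIV \<psi>'" "\<psi> 0 = 0" "\<psi> 1 = 0"
  shows "(\<integral>x. green_deriv g x * \<psi>' x \<partial>I01) = (\<integral>x. rep_l2 g x * \<psi> x \<partial>I01)"
proof -
  have s: "square_integrable \<psi>'" by (rule continuous_square_integrable[OF assms(2)])
  have "(\<integral>x. green_deriv g x * \<psi>' x \<partial>I01) = (\<integral>y. primitive (rep_l2 g) y \<partial>I01) * (\<integral>x. \<psi>' x \<partial>I01) - (\<integral>x. primitive (rep_l2 g) x * \<psi>' x \<partial>I01)"
    unfolding green_deriv_def left_diff_distrib
    using square_integrable_integrable[OF s] square_integrable_mult[OF primitive_square_integrable[OF integrable_rep] s, of g] by simp
  also have "\<dots> = (\<integral>x. rep_l2 g x * \<psi> x \<partial>I01)"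
    using primitive_by_parts[OF integrable_rep assms(1,2)] I01_integral_FTC_full[OF assms(1,2)] assms(3,4) by simp
  finally show ?thesis .
qed

lemma green_op_coeff: "lam k * inner (green_op g) (ek k) = inner g (ek k)"
proof -
  have c: "continuous_on UNIV (\<lambda>x. - (lam k * esin k x))" by (intro continuous_intros esin_continuous)
  have "(\<integral>x. primitive (green_deriv g) x * - (lam k * esin k x) \<partial>I01) = - (\<integral>x. green_deriv g x * ecos k x \<partial>I01)"
    using primitive_by_parts[OF square_integrable_integrable[OF green_deriv_square_integrable] ecos_deriv c, of g] green_deriv_mean by simp
  also have "(\<integral>x. green_deriv g x * ecos k x \<partial>I01) = inner g (ek k)"
    using green_deriv_by_parts[OF esin_deriv' ecos_continuous esin_boundary] by (simp add: inner_ek)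
  finally have "inner g (ek k) = (\<integral>x. lam k * (primitive (green_deriv g) x * esin k x) \<partial>I01)"
    by (simp add: mult_ac)
  also have "\<dots> = lam k * inner (green_op g) (ek k)"
    unfolding green_op_def ek_def by (simp add: inner_abs_abs primitive_green_deriv_square_integrable)
  finally show ?thesis by simp
qed

text \<open>Both sides have the same coefficients, as all eigenvalues are nonzero. This provides
  every element of the domain with a representative that is continuously differentiable inside the
  interval.\<close>

lemma dom_A_eq_green_op: "v \<in> dom_A \<Longrightarrow> v = green_op (op_A v)"
proof (rule ek_eqI)
  fix k assume "v \<in> dom_A"
  then have "lam k * inner v (ek k) = lam k * inner (green_op (op_A v)) (ek k)"
    using dom_A_coeff green_op_coeff by simp
  then show "inner v (ek k) = inner (green_op (op_A v)) (ek k)" using lam_pos[of k] by simp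
qed

text \<open>The converse direction, by which elements given through their coefficients are
  recognised as members of the domain.\<close>

lemma green_op_dom_A: "green_op g \<in> dom_A" "op_A (green_op g) = g"
proof -
  let ?p = "abs_l2 (green_deriv g)"
  have 1: "has_weak_deriv (green_op g) ?p"
    unfolding has_weak_deriv_inner green_op_def
  proof
    fix \<phi> assume \<phi>: "\<phi> \<in> test_functions"
    note t = test_functionD[OF \<phi>]
    show "inner (abs_l2 (primitive (green_deriv g))) (abs_l2 (deriv \<phi>)) = - inner (abs_l2 (green_deriv g)) (abs_l2 \<phi>)"
      using primitive_by_parts[OF square_integrable_integrable[OF green_deriv_square_integrable] t(2,4), of g] green_deriv_mean
      by (simp add: inner_abs_abs test_square_integrable[OF \<phi>] primitive_green_deriv_square_integrable green_deriv_square_integrable)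
  qed
  have 2: "has_weak_deriv ?p (- g)"
    unfolding has_weak_deriv_inner
  proof
    fix \<phi> assume \<phi>: "\<phi> \<in> test_functions"
    note t = test_functionD[OF \<phi>]
    have "(\<integral>x. green_deriv g x * deriv \<phi> x \<partial>I01) = (\<integral>x. rep_l2 g x * \<phi> x \<partial>I01)"
      using t(5) by (intro green_deriv_by_parts t(2,4)) auto
    then show "inner ?p (abs_l2 (deriv \<phi>)) = - inner (- g) (abs_l2 \<phi>)"
      unfolding inner_abs_abs[OF green_deriv_square_integrable test_square_integrable(2)[OF \<phi>]]
      by (simp add: inner_abs test_square_integrable[OF \<phi>])
  qed
  note w = weak_deriv_eq[OF 1] weak_deriv_eq[OF 2]
  have "green_op g \<in> H2" using 1 2 w by (auto simp: H2_def H1_def)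
  moreover have "green_op g \<in> H1_0"
    unfolding H1_0_def
  proof (intro CollectI conjI allI impI)
    show "green_op g \<in> H1" using 1 by (auto simp: H1_def)
    fix e :: real assume e: "0 < e"
    then have "0 < e / 2" by simp
    from test_approx[OF green_deriv_continuous green_deriv_mean this] obtain \<phi> where \<phi>: "\<phi> \<in> test_functions"
      "norm (green_op g - abs_l2 \<phi>) \<le> e / 2" "norm (?p - abs_l2 (deriv \<phi>)) \<le> e / 2"
      unfolding green_op_def by blast
    have wd: "weak_deriv (green_op g - abs_l2 \<phi>) = ?p - abs_l2 (deriv \<phi>)"
      by (intro weak_deriv_eq has_weak_deriv_diff 1 has_weak_deriv_test \<phi>)
    have "(norm (green_op g - abs_l2 \<phi>))\<^sup>2 + (norm (?p - abs_l2 (deriv \<phi>)))\<^sup>2 \<le> (e/2)\<^sup>2 + (e/2)\<^sup>2"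
      using \<phi> by (intro add_mono power_mono) auto
    also have "\<dots> < e\<^sup>2" using e by (simp add: power2_eq_square)
    finally have "H1_norm (green_op g - abs_l2 \<phi>) < e"
      unfolding H1_norm_def wd using e by (intro real_less_lsqrt) auto
    then show "\<exists>\<phi>\<in>test_functions. H1_norm (green_op g - abs_l2 \<phi>) < e" using \<phi>(1) by blast
  qed
  ultimately show "green_op g \<in> dom_A" by (simp add: dom_A_def)
  show "op_A (green_op g) = g" by (simp add: op_A_def w)
qed

text \<open>Each such point has a gap to its right; the gaps are disjoint, and each contains a
  rational number.\<close>

lemma right_isolated_countable:
  fixes Z :: "real set"
  shows "countable {x\<in>Z. \<exists>d>0. \<forall>y\<in>Z. x < y \<longrightarrow> x + d \<le> y}"
proof -
  define R where "R = {x\<in>Z. \<exists>d>0. \<forall>y\<in>Z. x < y \<longrightarrow> x + d \<le> y}"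
  have RZ: "R \<subseteq> Z" by (auto simp: R_def)
  have "\<exists>q. q \<in> \<rat> \<and> x < q \<and> (\<forall>y\<in>Z. x < y \<longrightarrow> q < y)" if "x \<in> R" for x
  proof -
    obtain d where d: "0 < d" "\<forall>y\<in>Z. x < y \<longrightarrow> x + d \<le> y" using \<open>x \<in> R\<close> by (auto simp: R_def)
    obtain q where "q \<in> \<rat>" "x < q" "q < x + d" using Rats_dense_in_real[of x "x + d"] d(1) by auto
    then show ?thesis using d(2) by (intro exI[of _ q]) (auto intro: less_le_trans)
  qed
  then obtain q where q: "\<forall>x\<in>R. q x \<in> \<rat> \<and> x < q x \<and> (\<forall>y\<in>Z. x < y \<longrightarrow> q x < y)"
    using bchoice[of R "\<lambda>x q. q \<in> \<rat> \<and> x < q \<and> (\<forall>y\<in>Z. x < y \<longrightarrow> q < y)"] by blast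
  have ne: "q x \<noteq> q y" if "x \<in> R" "y \<in> R" "x < y" for x y
  proof -
    have "q x < y" using q that RZ by blast
    also have "y < q y" using q that(2) by blast
    finally show ?thesis by simp
  qed
  have "inj_on q R"
    using ne by (intro linorder_inj_onI) auto
  moreover have "countable (q ` R)"
    by (rule countable_subset[OF _ countable_rat]) (use q in blast)
  ultimately have "countable R" by (rule countable_image_inj_on[rotated])
  then show ?thesis by (simp add: R_def)
qed

text \<open>On the zero set of a nonnegative \<open>v\<close> the first derivative vanishes; hence so does the second
  at almost every point, as almost every zero is a limit of zeros from the right.\<close>

lemma op_A_zero_on_zero_set:
  assumes v: "v \<in> dom_A" "v \<in> Hplus"
  shows "AE x in I01. rep_l2 v x = 0 \<longrightarrow> rep_l2 (op_A v) x = 0"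
proof -
  define g where "g = op_A v"
  let ?V = "primitive (green_deriv g)"
  have "v = green_op g" unfolding g_def by (rule dom_A_eq_green_op[OF v(1)])
  then have rV: "AE x in I01. rep_l2 v x = ?V x"
    unfolding green_op_def using rep_abs_l2[OF primitive_green_deriv_square_integrable] by simp
  have gi: "integrable I01 (green_deriv g)" by (rule square_integrable_integrable[OF green_deriv_square_integrable])
  have "AE x in I01. 0 \<le> rep_l2 v x" using v(2) by (simp add: Hplus_def)
  then have VAE: "AE x in I01. 0 \<le> ?V x" using rV by eventually_elim simp
  have V0: "0 \<le> ?V x" if "0 < x" "x < 1" for x
    by (rule continuous_AE_nonneg[OF primitive_continuous[OF gi] VAE that])
  define Z where "Z = {x. 0 < x \<and> x < 1 \<and> ?V x = 0}"
  \<comment> \<open>A zero of a nonnegative function is an interior minimum.\<close>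
  have p0: "green_deriv g x = 0" if "x \<in> Z" for x
  proof (rule DERIV_local_min)
    show "(?V has_real_derivative green_deriv g x) (at x)"
      using that by (intro primitive_has_derivative gi green_deriv_continuous) (auto simp: Z_def)
    show "0 < min x (1 - x)" using that by (auto simp: Z_def)
    show "\<forall>y. \<bar>x - y\<bar> < min x (1 - x) \<longrightarrow> ?V x \<le> ?V y" using that V0 by (auto simp: Z_def)
  qed
  let ?R = "{x\<in>Z. \<exists>d>0. \<forall>y\<in>Z. x < y \<longrightarrow> x + d \<le> y}"
  have "AE x in lborel. x \<notin> ?R"
    by (intro AE_not_in countable_imp_null_set_lborel right_isolated_countable)
  then have "AE x in I01. x \<notin> ?R" by (subst AE_restrict_space_iff) auto
  then have "AE x in I01. rep_l2 v x = 0 \<longrightarrow> rep_l2 g x = 0"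
    using primitive_right_derivative_AE[OF integrable_rep[of g]] rV AE_space[of I01]
  proof eventually_elim
    case (elim x)
    show ?case
    proof
      assume "rep_l2 v x = 0"
      then have xZ: "x \<in> Z" using elim by (auto simp: Z_def space_I01)
      have "\<bar>rep_l2 g x\<bar> < e" if e0: "0 < e" for e
      proof -
        obtain d where d: "0 < d" "\<And>s. 0 < s \<Longrightarrow> s < d \<Longrightarrow> \<bar>(primitive (rep_l2 g) (x + s) - primitive (rep_l2 g) x) / s - rep_l2 g x\<bar> < e"
          using elim(2)[rule_format, OF e0] by blast
        have "\<exists>y\<in>Z. x < y \<and> \<not> x + d \<le> y"
        proof (rule ccontr)
          assume "\<not> ?thesis"
          then have "x \<in> ?R" using xZ d(1) by (intro CollectI conjI exI[of _ d]) auto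
          then show False using elim(1) by contradiction
        qed
        then obtain y where y: "y \<in> Z" "x < y" "y < x + d" by auto
        \<comment> \<open>Both derivatives are 0, so the primitive of \<open>g\<close> has equal
          values at \<open>x\<close> and \<open>y\<close>; the difference quotient close to
          \<open>rep_l2 g x\<close> is therefore 0.\<close>
        have "green_deriv g x = green_deriv g y" using p0[OF xZ] p0[OF y(1)] by simp
        then have "primitive (rep_l2 g) y = primitive (rep_l2 g) x" by (simp add: green_deriv_def)
        then show ?thesis using d(2)[of "y - x"] y by simp
      qed
      from this[of "\<bar>rep_l2 g x\<bar>"] show "rep_l2 g x = 0" by fastforce
    qed
  qed
  then show ?thesis by (simp add: g_def)
qed

section \<open>Positivity of the Dirichlet heat kernel\<close>

definition decay :: "real \<Rightarrow> nat \<Rightarrow> real" where "decay \<tau> k = exp (- (lam k * \<tau>))"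

text \<open>Powers with square exponents, as in the theta function with nome
  \<open>exp (- (pi\<^sup>2 * \<tau>))\<close>.\<close>

lemma decay_eq: "decay \<tau> k = exp (- (pi\<^sup>2 * \<tau>)) ^ ((Suc k)\<^sup>2)"
  unfolding decay_def lam_def exp_of_nat_mult[symmetric]
  by (simp add: power_mult_distrib algebra_simps del: of_nat_Suc)

lemma decay_pos: "0 < decay \<tau> k" by (simp add: decay_def)

lemma decay_le_1: "0 \<le> \<tau> \<Longrightarrow> decay \<tau> k \<le> 1"
  using lam_pos[of k] by (simp add: decay_def)

lemma decay_antimono: "\<sigma> \<le> \<tau> \<Longrightarrow> decay \<tau> k \<le> decay \<sigma> k"
  using lam_pos[of k] by (simp add: decay_def mult_left_mono)

lemma decay_summable:
  assumes "0 < \<tau>" shows "summable (decay \<tau>)"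
proof (rule summable_comparison_test')
  let ?q = "exp (- (pi\<^sup>2 * \<tau>))"
  have q: "0 < ?q" "?q < 1" using assms by auto
  show "summable (\<lambda>k. ?q ^ Suc k)"
    using q by (simp add: summable_mult summable_geometric_iff)
  show "norm (decay \<tau> k) \<le> ?q ^ Suc k" for k
    unfolding decay_eq using q power_decreasing[of "Suc k" "(Suc k)\<^sup>2" ?q]
    by (simp add: power2_eq_square)
qed

definition hsum :: "real \<Rightarrow> nat \<Rightarrow> real \<Rightarrow> real \<Rightarrow> real" where
  "hsum \<tau> N x y = (\<Sum>k<N. decay \<tau> k * (esin k x * esin k y))"

text \<open>The Dirichlet heat kernel at time \<open>\<tau>\<close>; \<open>hsum\<close> is its
  truncation.\<close>

definition hker :: "real \<Rightarrow> real \<Rightarrow> real \<Rightarrow> real" where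
  "hker \<tau> x y = (\<Sum>k. decay \<tau> k * (esin k x * esin k y))"

text \<open>Bounds the truncation error of the kernel; the 2 is the bound of the products of two
  normalised eigenfunctions.\<close>

definition tail :: "real \<Rightarrow> nat \<Rightarrow> real" where
  "tail \<tau> N = 2 * (\<Sum>k. decay \<tau> (k + N))"

lemma esin_mult_le: "\<bar>esin k x * esin k y\<bar> \<le> 2"
proof -
  have "\<bar>esin k x * esin k y\<bar> \<le> sqrt 2 * sqrt 2"
    unfolding abs_mult by (intro mult_mono esin_bound) auto
  then show ?thesis by simp
qed

lemma hterm_le: "\<bar>decay \<tau> k * (esin k x * esin k y)\<bar> \<le> 2 * decay \<tau> k"
  unfolding abs_mult[of "decay \<tau> k"] using esin_mult_le[of k x y] decay_pos[of \<tau> k] by simp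

lemma hker_summable:
  assumes "0 < \<tau>" shows "summable (\<lambda>k. decay \<tau> k * (esin k x * esin k y))"
  by (rule summable_comparison_test'[OF summable_mult[OF decay_summable[OF assms], of 2]])
     (use hterm_le in simp)

lemma hsum_tendsto:
  assumes "0 < \<tau>" shows "(\<lambda>N. hsum \<tau> N x y) \<longlonglongrightarrow> hker \<tau> x y"
  unfolding hsum_def hker_def using hker_summable[OF assms] by (rule summable_LIMSEQ)

lemma hsum_bound:
  assumes "0 < \<tau>" shows "\<bar>hsum \<tau> N x y\<bar> \<le> 2 * (\<Sum>k. decay \<tau> k)"
proof -
  have "\<bar>hsum \<tau> N x y\<bar> \<le> (\<Sum>k<N. 2 * decay \<tau> k)"
    unfolding hsum_def by (rule order_trans[OF sum_abs]) (intro sum_mono hterm_le)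
  also have "\<dots> \<le> (\<Sum>k. 2 * decay \<tau> k)"
    using decay_summable[OF assms] decay_pos[of \<tau>] by (intro sum_le_suminf) (auto intro: less_imp_le summable_mult)
  finally show ?thesis using decay_summable[OF assms] by (simp add: suminf_mult)
qed

text \<open>The product of two sines is a difference of cosines, which makes the kernel a difference
  of theta values at \<open>pi * (x - y)\<close> and \<open>pi * (x + y)\<close>. The gap of the
  cosines is twice the product of \<open>sin (pi * x)\<close> and
  \<open>sin (pi * y)\<close>.\<close>

lemma hker_pos:
  assumes "0 < \<tau>" "0 < x" "x < 1" "0 < y" "y < 1" shows "0 < hker \<tau> x y"
proof -
  let ?q = "exp (- (pi\<^sup>2 * \<tau>))"
  have "cos (pi * (x - y)) - cos (pi * (x + y)) = 2 * (sin (pi * x) * sin (pi * y))"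
    by (simp add: cos_add cos_diff algebra_simps)
  moreover have "0 < sin (pi * x)" "0 < sin (pi * y)" using assms by (auto intro!: sin_gt_zero)
  ultimately have "0 < cos (pi * (x - y)) - cos (pi * (x + y))" by (metis mult_pos_pos zero_less_numeral)
  then have "cos (pi * (x + y)) < cos (pi * (x - y))" by simp
  from theta_kernel_pos[OF _ _ this, of ?q] have
    "0 < (\<Sum>k. ?q ^ ((Suc k)\<^sup>2) * (cos (real (Suc k) * (pi * (x - y))) - cos (real (Suc k) * (pi * (x + y)))))"
    using assms(1) by simp
  moreover have "cos (real (Suc k) * (pi * (x - y))) - cos (real (Suc k) * (pi * (x + y))) = esin k x * esin k y" for k
  proof -
    have *: "cos (A - B) - cos (A + B) = sqrt 2 * sin A * (sqrt 2 * sin B)" for A B :: real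
      by (simp add: cos_add cos_diff)
    show ?thesis unfolding esin_def *[symmetric] by (simp add: algebra_simps)
  qed
  ultimately show ?thesis unfolding hker_def decay_eq by simp
qed

lemma tail_tendsto: "0 < \<tau> \<Longrightarrow> tail \<tau> \<longlonglongrightarrow> 0"
  unfolding tail_def[abs_def] using tendsto_mult[OF tendsto_const suminf_exist_split2[OF decay_summable[of \<tau>]], of 2]
  by simp

lemma tail_antimono:
  assumes "0 < \<sigma>" "\<sigma> \<le> \<tau>" shows "tail \<tau> N \<le> tail \<sigma> N"
  unfolding tail_def using assms
  by (intro mult_left_mono suminf_le decay_antimono summable_ignore_initial_segment decay_summable) auto

text \<open>A truncated kernel may become negative, but it differs from the positive full kernel by
  at most the tail.\<close>

lemma hsum_lower:
  assumes "0 < \<tau>" "0 < x" "x < 1" "0 < y" "y < 1" shows "- tail \<tau> N \<le> hsum \<tau> N x y"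
proof -
  let ?f = "\<lambda>k. decay \<tau> k * (esin k x * esin k y)"
  have s: "summable (\<lambda>k. ?f (k + N))" by (intro summable_ignore_initial_segment hker_summable assms)
  have "hker \<tau> x y = (\<Sum>k. ?f (k + N)) + hsum \<tau> N x y"
    unfolding hker_def hsum_def by (rule suminf_split_initial_segment[OF hker_summable[OF assms(1)]])
  moreover have "(\<Sum>k. ?f (k + N)) \<le> (\<Sum>k. 2 * decay \<tau> (k + N))"
    by (intro suminf_le order_trans[OF abs_ge_self hterm_le] s summable_mult
        summable_ignore_initial_segment decay_summable assms(1))
  moreover have "(\<Sum>k. 2 * decay \<tau> (k + N)) = tail \<tau> N"
    unfolding tail_def by (intro suminf_mult summable_ignore_initial_segment decay_summable assms)
  ultimately show ?thesis using hker_pos[OF assms] by linarith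
qed

lemma coeff_nonneg_mono:
  assumes "v \<in> Hplus" "square_integrable f" "\<And>x. 0 < x \<Longrightarrow> x < 1 \<Longrightarrow> c \<le> f x"
  shows "c * (\<integral>x. rep_l2 v x \<partial>I01) \<le> (\<integral>x. rep_l2 v x * f x \<partial>I01)"
proof -
  have "(\<integral>x. rep_l2 v x * c \<partial>I01) \<le> (\<integral>x. rep_l2 v x * f x \<partial>I01)"
  proof (rule integral_mono_AE)
    have "AE x in I01. 0 \<le> rep_l2 v x" using assms(1) by (simp add: Hplus_def)
    then show "AE x in I01. rep_l2 v x * c \<le> rep_l2 v x * f x"
      using AE_space by eventually_elim (auto simp: space_I01 intro: mult_left_mono assms(3))
  qed (auto intro: integrable_rep_mult assms(2))
  then show ?thesis by (simp add: mult.commute)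
qed

lemma hsum_inner:
  "(\<integral>y. rep_l2 \<phi> y * hsum \<tau> N x y \<partial>I01) = (\<Sum>k<N. decay \<tau> k * inner \<phi> (ek k) * esin k x)"
proof -
  have "(\<integral>y. rep_l2 \<phi> y * hsum \<tau> N x y \<partial>I01) = (\<integral>y. (\<Sum>k<N. (decay \<tau> k * esin k x) * (rep_l2 \<phi> y * esin k y)) \<partial>I01)"
    unfolding hsum_def sum_distrib_left by (intro Bochner_Integration.integral_cong sum.cong refl) (simp add: mult_ac)
  also have "\<dots> = (\<Sum>k<N. (decay \<tau> k * esin k x) * inner \<phi> (ek k))"
    by (subst Bochner_Integration.integral_sum) (auto simp: inner_ek intro!: integrable_rep_mult)
  finally show ?thesis by (simp add: mult_ac)
qed

lemma hsum_inner2: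
  "(\<integral>x. rep_l2 v x * (\<Sum>k<N. decay \<tau> k * inner \<phi> (ek k) * esin k x) \<partial>I01) =
     (\<Sum>k<N. decay \<tau> k * (inner v (ek k) * inner \<phi> (ek k)))"
proof -
  have "(\<integral>x. rep_l2 v x * (\<Sum>k<N. decay \<tau> k * inner \<phi> (ek k) * esin k x) \<partial>I01) =
     (\<integral>x. (\<Sum>k<N. (decay \<tau> k * inner \<phi> (ek k)) * (rep_l2 v x * esin k x)) \<partial>I01)"
    unfolding sum_distrib_left by (intro Bochner_Integration.integral_cong sum.cong refl) (simp add: mult_ac)
  also have "\<dots> = (\<Sum>k<N. (decay \<tau> k * inner \<phi> (ek k)) * inner v (ek k))"
    by (subst Bochner_Integration.integral_sum) (auto simp: inner_ek intro!: integrable_rep_mult)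
  finally show ?thesis by (simp add: mult_ac)
qed

lemma hsum_continuous: "continuous_on UNIV (hsum \<tau> N x)"
  unfolding hsum_def by (intro continuous_intros esin_continuous)

lemma integral_rep_Hplus:
  assumes "v \<in> Hplus" shows "0 \<le> (\<integral>x. rep_l2 v x \<partial>I01)" "(\<integral>x. rep_l2 v x \<partial>I01) \<le> norm v"
proof -
  have n: "AE x in I01. 0 \<le> rep_l2 v x" using assms by (simp add: Hplus_def)
  show "0 \<le> (\<integral>x. rep_l2 v x \<partial>I01)" using n by (rule integral_nonneg_AE)
  have "(\<integral>x. rep_l2 v x \<partial>I01) = (\<integral>x. \<bar>rep_l2 v x\<bar> \<partial>I01)"
    using n by (intro integral_cong_AE) (auto intro: borel_measurable_abs)
  then show "(\<integral>x. rep_l2 v x \<partial>I01) \<le> norm v" using integral_abs_rep_le[of v] by simp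
qed

text \<open>The lower bound of the truncated kernel is integrated against \<open>\<phi>\<close> and
  then against \<open>v\<close>; for elements of the cone the integrals are bounded by the
  norms.\<close>

lemma kernel_sum_lower:
  assumes "0 < \<tau>" "v \<in> Hplus" "\<phi> \<in> Hplus"
  shows "- (tail \<tau> N * (norm v * norm \<phi>)) \<le> (\<Sum>k<N. decay \<tau> k * (inner v (ek k) * inner \<phi> (ek k)))"
proof -
  let ?S = "\<lambda>x. \<Sum>k<N. decay \<tau> k * inner \<phi> (ek k) * esin k x"
  let ?i = "\<lambda>v. \<integral>x. rep_l2 v x \<partial>I01"
  have t0: "0 \<le> tail \<tau> N"
    unfolding tail_def using decay_summable[OF assms(1)] decay_pos
    by (intro mult_nonneg_nonneg suminf_nonneg summable_ignore_initial_segment) (auto intro: less_imp_le)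
  have low: "- (tail \<tau> N * ?i \<phi>) \<le> ?S x" if "0 < x" "x < 1" for x
    using coeff_nonneg_mono[OF assms(3) continuous_square_integrable[OF hsum_continuous] hsum_lower[OF assms(1) that], of N]
    unfolding hsum_inner by simp
  have "square_integrable ?S" by (intro continuous_square_integrable continuous_intros esin_continuous)
  from coeff_nonneg_mono[OF assms(2) this low]
  have "- (tail \<tau> N * ?i \<phi>) * ?i v \<le> (\<Sum>k<N. decay \<tau> k * (inner v (ek k) * inner \<phi> (ek k)))"
    unfolding hsum_inner2 .
  moreover have "tail \<tau> N * (?i \<phi> * ?i v) \<le> tail \<tau> N * (norm \<phi> * norm v)"
    using integral_rep_Hplus[OF assms(2)] integral_rep_Hplus[OF assms(3)] t0
    by (intro mult_left_mono mult_mono) auto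
  ultimately show ?thesis by (simp add: mult_ac)
qed

text \<open>The inner product of S(\<open>\<tau>\<close>) \<open>v\<close> with
  \<open>\<phi>\<close>, where S is the Dirichlet heat semigroup.\<close>

definition heat_form :: "l2 \<Rightarrow> l2 \<Rightarrow> real \<Rightarrow> real" where
  "heat_form v \<phi> \<tau> = (\<Sum>k. decay \<tau> k * (inner v (ek k) * inner \<phi> (ek k)))"

lemma heat_form_term_le:
  "0 \<le> \<tau> \<Longrightarrow> \<bar>decay \<tau> k * (inner v (ek k) * inner \<phi> (ek k))\<bar> \<le> \<bar>inner v (ek k) * inner \<phi> (ek k)\<bar>"
  unfolding abs_mult[of "decay \<tau> k"] using decay_le_1[of \<tau> k] decay_pos[of \<tau> k]
  by (intro mult_left_le_one_le) auto

lemma heat_form_LIMSEQ: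
  assumes "0 \<le> \<tau>"
  shows "(\<lambda>N. \<Sum>k<N. decay \<tau> k * (inner v (ek k) * inner \<phi> (ek k))) \<longlonglongrightarrow> heat_form v \<phi> \<tau>"
  unfolding heat_form_def
  by (intro summable_LIMSEQ summable_comparison_test'[OF parseval_abs_summable[of v \<phi>]])
     (use heat_form_term_le[OF assms] in simp)

lemma heat_form_0: "heat_form v \<phi> 0 = inner v \<phi>"
  using sums_unique[OF parseval[of v \<phi>]] by (simp add: heat_form_def decay_def)

text \<open>The Parseval series of \<open>v\<close> and \<open>\<phi>\<close> is a majorant
  independent of \<open>\<tau>\<close>, so continuity extends to time 0.\<close>

lemma heat_form_continuous: "continuous_on {0..} (heat_form v \<phi>)"
proof -
  have "uniform_limit {0..} (\<lambda>N \<tau>. \<Sum>k<N. decay \<tau> k * (inner v (ek k) * inner \<phi> (ek k))) (heat_form v \<phi>) sequentially"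
    unfolding heat_form_def[abs_def]
    by (rule Weierstrass_m_test[OF _ parseval_abs_summable[of v \<phi>]]) (use heat_form_term_le in auto)
  then show ?thesis
    by (rule uniform_limit_theorem[rotated]) (auto intro!: always_eventually continuous_intros simp: decay_def)
qed

lemma Hplus_integral_pos:
  assumes "v \<in> Hplus" "v \<noteq> 0" "f \<in> borel_measurable I01" "\<And>x. 0 < x \<Longrightarrow> x < 1 \<Longrightarrow> 0 < f x \<and> f x \<le> C"
  shows "0 < (\<integral>x. rep_l2 v x * f x \<partial>I01)"
proof -
  have sf: "square_integrable f"
    using assms(3,4) by (intro square_integrable_bounded[of _ C]) force+
  have n: "AE x in I01. 0 \<le> rep_l2 v x" using assms(1) by (simp add: Hplus_def)
  have nn: "AE x in I01. 0 \<le> rep_l2 v x * f x"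
    using n AE_space by eventually_elim (use assms(4) in \<open>auto simp: space_I01 intro!: mult_nonneg_nonneg intro: less_imp_le\<close>)
  have "(\<integral>x. rep_l2 v x * f x \<partial>I01) \<noteq> 0"
  proof
    assume "(\<integral>x. rep_l2 v x * f x \<partial>I01) = 0"
    then have "AE x in I01. rep_l2 v x * f x = 0"
      using integral_nonneg_eq_0_iff_AE[OF integrable_rep_mult[OF sf] nn] by simp
    then have "AE x in I01. rep_l2 v x = 0"
      using AE_space by eventually_elim (use assms(4) in \<open>force simp: space_I01\<close>)
    then have "v = 0" unfolding l2_eq_iff using rep_0 by eventually_elim simp
    then show False using assms(2) by simp
  qed
  moreover have "0 \<le> (\<integral>x. rep_l2 v x * f x \<partial>I01)" using nn by (rule integral_nonneg_AE)
  ultimately show ?thesis by simp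
qed

text \<open>Dominated convergence turns the eigenfunction sums into integrals against the full
  kernel, once in each variable. A positive function integrated against a nonzero element of the
  cone gives a positive number.\<close>

lemma heat_form_pos:
  assumes \<tau>: "0 < \<tau>" and v: "v \<in> Hplus" "v \<noteq> 0" and \<phi>: "\<phi> \<in> Hplus" "\<phi> \<noteq> 0"
  shows "0 < heat_form v \<phi> \<tau>"
proof -
  define C where "C = 2 * (\<Sum>k. decay \<tau> k)"
  have hk: "\<bar>hker \<tau> x y\<bar> \<le> C" for x y
    unfolding C_def by (rule LIMSEQ_le_const2[OF tendsto_rabs[OF hsum_tendsto[OF \<tau>]]]) (use hsum_bound[OF \<tau>] in blast)
  have C0: "0 \<le> C" using hk[of 0 0] by linarith
  \<comment> \<open>A pointwise representative of the heat semigroup applied to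
    \<open>\<phi>\<close>, positive on the whole interval.\<close>
  define S where "S x = (\<integral>y. rep_l2 \<phi> y * hker \<tau> x y \<partial>I01)" for x
  let ?S = "\<lambda>N x. \<Sum>k<N. decay \<tau> k * inner \<phi> (ek k) * esin k x"
  have hm [measurable]: "hsum \<tau> N x \<in> borel_measurable I01" for N x
    by (intro measurable_I01 borel_measurable_continuous_onI hsum_continuous)
  have hkm [measurable]: "hker \<tau> x \<in> borel_measurable I01" for x
    by (rule borel_measurable_LIMSEQ_real[OF hsum_tendsto[OF \<tau>]]) (rule hm)
  have bd: "\<bar>rep_l2 \<phi> y * g\<bar> \<le> C * \<bar>rep_l2 \<phi> y\<bar>" if "\<bar>g\<bar> \<le> C" for g y
    unfolding abs_mult using that by (subst mult.commute) (intro mult_right_mono, auto)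
  have SN: "(\<lambda>N. ?S N x) \<longlonglongrightarrow> S x" for x
    unfolding hsum_inner[symmetric] S_def
  proof (rule integral_dominated_convergence[where w = "\<lambda>y. C * \<bar>rep_l2 \<phi> y\<bar>"])
    show "AE y in I01. (\<lambda>N. rep_l2 \<phi> y * hsum \<tau> N x y) \<longlonglongrightarrow> rep_l2 \<phi> y * hker \<tau> x y"
      by (intro AE_I2 tendsto_mult tendsto_const hsum_tendsto \<tau>)
    show "AE y in I01. norm (rep_l2 \<phi> y * hsum \<tau> N x y) \<le> C * \<bar>rep_l2 \<phi> y\<bar>" for N
      unfolding real_norm_def using hsum_bound[OF \<tau>] by (intro AE_I2 bd) (simp add: C_def)
  qed auto
  have Sm [measurable]: "S \<in> borel_measurable I01"
    by (rule borel_measurable_LIMSEQ_real[OF SN]) (intro measurable_I01 borel_measurable_continuous_onI continuous_intros esin_continuous)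
  have SNb: "\<bar>?S N x\<bar> \<le> C * norm \<phi>" for N x
  proof -
    have "\<bar>?S N x\<bar> \<le> (\<integral>y. \<bar>rep_l2 \<phi> y * hsum \<tau> N x y\<bar> \<partial>I01)"
      unfolding hsum_inner[symmetric] by (rule integral_abs_bound)
    also have "\<dots> \<le> (\<integral>y. C * \<bar>rep_l2 \<phi> y\<bar> \<partial>I01)"
    proof (rule integral_mono)
      show "integrable I01 (\<lambda>y. \<bar>rep_l2 \<phi> y * hsum \<tau> N x y\<bar>)"
        by (intro integrable_abs integrable_rep_mult continuous_square_integrable hsum_continuous)
      show "\<bar>rep_l2 \<phi> y * hsum \<tau> N x y\<bar> \<le> C * \<bar>rep_l2 \<phi> y\<bar>" for y
        using hsum_bound[OF \<tau>] by (intro bd) (simp add: C_def)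
    qed simp
    also have "\<dots> \<le> C * norm \<phi>" using integral_abs_rep_le[of \<phi>] C0 by (simp add: mult_left_mono)
    finally show ?thesis .
  qed
  have Sb: "\<bar>S x\<bar> \<le> C * norm \<phi>" for x
    by (rule LIMSEQ_le_const2[OF tendsto_rabs[OF SN]]) (use SNb in blast)
  have Spos: "0 < S x" if "0 < x" "x < 1" for x
    unfolding S_def by (rule Hplus_integral_pos[OF \<phi> hkm, of x C]) (use hker_pos[OF \<tau> that] hk[of x] abs_le_D1 in blast)
  have "(\<lambda>N. \<integral>x. rep_l2 v x * ?S N x \<partial>I01) \<longlonglongrightarrow> (\<integral>x. rep_l2 v x * S x \<partial>I01)"
  proof (rule integral_dominated_convergence[where w = "\<lambda>x. \<bar>rep_l2 v x\<bar> * (C * norm \<phi>)"])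
    have [measurable]: "?S N \<in> borel_measurable I01" for N
      by (intro measurable_I01 borel_measurable_continuous_onI continuous_intros esin_continuous)
    show "(\<lambda>x. rep_l2 v x * S x) \<in> borel_measurable I01" by measurable
    show "(\<lambda>x. rep_l2 v x * ?S N x) \<in> borel_measurable I01" for N by measurable
    show "AE x in I01. (\<lambda>N. rep_l2 v x * ?S N x) \<longlonglongrightarrow> rep_l2 v x * S x"
      by (intro AE_I2 tendsto_mult tendsto_const SN)
    show "AE x in I01. norm (rep_l2 v x * ?S N x) \<le> \<bar>rep_l2 v x\<bar> * (C * norm \<phi>)" for N
      unfolding real_norm_def abs_mult[of "rep_l2 v _"] by (intro AE_I2 mult_left_mono SNb) auto
  qed auto
  then have "heat_form v \<phi> \<tau> = (\<integral>x. rep_l2 v x * S x \<partial>I01)"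
    unfolding hsum_inner2 using heat_form_LIMSEQ[of \<tau> v \<phi>] \<tau> LIMSEQ_unique by (metis less_imp_le)
  also have "\<dots> > 0"
    by (rule Hplus_integral_pos[OF v Sm, of "C * norm \<phi>"]) (use Spos Sb abs_le_D1 in blast)
  finally show ?thesis .
qed

section \<open>Linear equations in modal form\<close>

lemma abs_continuous_on_inner:
  fixes u \<psi> :: "real \<Rightarrow> 'a::real_inner"
  assumes ac: "abs_continuous_on a b u"
    and u: "\<And>t. a \<le> t \<Longrightarrow> t \<le> b \<Longrightarrow> norm (u t) \<le> M"
    and \<psi>: "\<And>t. a \<le> t \<Longrightarrow> t \<le> b \<Longrightarrow> norm (\<psi> t) \<le> M'"
    and lip: "\<And>l r. a \<le> l \<Longrightarrow> l \<le> r \<Longrightarrow> r \<le> b \<Longrightarrow> norm (\<psi> r - \<psi> l) \<le> L * (r - l)"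
  shows "abs_continuous_on a b (\<lambda>t. inner (u t) (\<psi> t))"
  unfolding abs_continuous_on_def
proof (intro allI impI)
  fix e :: real assume e: "0 < e"
  \<comment> \<open>The summand 1 makes \<open>K\<close> positive and the final estimate
    strict.\<close>
  define K where "K = \<bar>M'\<bar> + \<bar>M\<bar> * \<bar>L\<bar> + 1"
  have K: "0 < K" by (simp add: K_def add_nonneg_pos)
  have KM: "\<bar>M'\<bar> + \<bar>M\<bar> * \<bar>L\<bar> < K"
    by (simp add: K_def)
  have eK: "0 < e / K" using e K by simp
  obtain d where d: "0 < d" and dd: "\<forall>(n::nat) l r. (\<forall>i<n. a \<le> l i \<and> l i \<le> r i \<and> r i \<le> b) \<and>
     disjoint_family_on (\<lambda>i. {l i<..<r i}) {..<n} \<and> (\<Sum>i<n. r i - l i) < d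
     \<longrightarrow> (\<Sum>i<n. norm (u (r i) - u (l i))) < e / K"
    using ac[unfolded abs_continuous_on_def, rule_format, OF eK] by blast
  show "\<exists>d>0. \<forall>(n::nat) l r. (\<forall>i<n. a \<le> l i \<and> l i \<le> r i \<and> r i \<le> b) \<and>
     disjoint_family_on (\<lambda>i. {l i<..<r i}) {..<n} \<and> (\<Sum>i<n. r i - l i) < d
     \<longrightarrow> (\<Sum>i<n. norm (inner (u (r i)) (\<psi> (r i)) - inner (u (l i)) (\<psi> (l i)))) < e"
  proof (intro exI[of _ "min d (e / K)"] conjI allI impI)
    show "0 < min d (e / K)" using d eK by simp
    fix n :: nat and l r :: "nat \<Rightarrow> real"
    assume H: "(\<forall>i<n. a \<le> l i \<and> l i \<le> r i \<and> r i \<le> b) \<and>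
     disjoint_family_on (\<lambda>i. {l i<..<r i}) {..<n} \<and> (\<Sum>i<n. r i - l i) < min d (e / K)"
    then have su: "(\<Sum>i<n. norm (u (r i) - u (l i))) < e / K"
      by (intro dd[rule_format]) simp
    have "norm (inner (u (r i)) (\<psi> (r i)) - inner (u (l i)) (\<psi> (l i))) \<le>
      \<bar>M'\<bar> * norm (u (r i) - u (l i)) + \<bar>M\<bar> * \<bar>L\<bar> * (r i - l i)" if "i < n" for i
    proof -
      have I: "a \<le> l i" "l i \<le> r i" "r i \<le> b" using H that by auto
      have "inner (u (r i)) (\<psi> (r i)) - inner (u (l i)) (\<psi> (l i)) =
        inner (u (r i) - u (l i)) (\<psi> (r i)) + inner (u (l i)) (\<psi> (r i) - \<psi> (l i))"
        by (simp add: inner_diff_left inner_diff_right)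
      then have "norm (inner (u (r i)) (\<psi> (r i)) - inner (u (l i)) (\<psi> (l i))) \<le>
        \<bar>inner (u (r i) - u (l i)) (\<psi> (r i))\<bar> + \<bar>inner (u (l i)) (\<psi> (r i) - \<psi> (l i))\<bar>" by simp
      also have "\<dots> \<le> norm (u (r i) - u (l i)) * norm (\<psi> (r i)) + norm (u (l i)) * norm (\<psi> (r i) - \<psi> (l i))"
        by (intro add_mono Cauchy_Schwarz_ineq2)
      also have "\<dots> \<le> norm (u (r i) - u (l i)) * \<bar>M'\<bar> + \<bar>M\<bar> * (\<bar>L\<bar> * (r i - l i))"
      proof (intro add_mono mult_mono order_refl)
        show "norm (\<psi> (r i)) \<le> \<bar>M'\<bar>" using \<psi>[of "r i"] I by simp
        show "norm (u (l i)) \<le> \<bar>M\<bar>" using u[of "l i"] I by simp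
        have "L * (r i - l i) \<le> \<bar>L\<bar> * (r i - l i)" using I by (intro mult_right_mono) auto
        then show "norm (\<psi> (r i) - \<psi> (l i)) \<le> \<bar>L\<bar> * (r i - l i)" using lip[OF I] by linarith
      qed auto
      finally show ?thesis by (simp add: mult_ac)
    qed
    then have "(\<Sum>i<n. norm (inner (u (r i)) (\<psi> (r i)) - inner (u (l i)) (\<psi> (l i)))) \<le>
      (\<Sum>i<n. \<bar>M'\<bar> * norm (u (r i) - u (l i)) + \<bar>M\<bar> * \<bar>L\<bar> * (r i - l i))" by (intro sum_mono) simp
    also have "\<dots> = \<bar>M'\<bar> * (\<Sum>i<n. norm (u (r i) - u (l i))) + \<bar>M\<bar> * \<bar>L\<bar> * (\<Sum>i<n. r i - l i)"
      by (simp only: sum.distrib sum_distrib_left)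
    also have "\<dots> \<le> \<bar>M'\<bar> * (e / K) + \<bar>M\<bar> * \<bar>L\<bar> * (e / K)"
      using su H by (intro add_mono mult_left_mono) auto
    also have "\<dots> = (\<bar>M'\<bar> + \<bar>M\<bar> * \<bar>L\<bar>) * (e / K)" by (rule distrib_right[symmetric])
    also have "\<dots> < K * (e / K)" by (rule mult_strict_right_mono[OF KM eK])
    also have "\<dots> = e" using K by simp
    finally show "(\<Sum>i<n. norm (inner (u (r i)) (\<psi> (r i)) - inner (u (l i)) (\<psi> (l i)))) < e" .
  qed
qed

lemma C1_lipschitz:
  fixes g :: "real \<Rightarrow> real"
  assumes "\<And>t. (g has_real_derivative g' t) (at t)" "continuous_on UNIV g'"
  obtains L where "0 \<le> L" "\<And>l r. a \<le> l \<Longrightarrow> l \<le> r \<Longrightarrow> r \<le> b \<Longrightarrow> \<bar>g r - g l\<bar> \<le> L * (r - l)"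
proof -
  have "bounded (g' ` {a..b})"
    by (intro compact_imp_bounded compact_continuous_image continuous_on_subset[OF assms(2)]) auto
  then obtain L where L: "\<forall>y\<in>g' ` {a..b}. norm y \<le> L" unfolding bounded_iff by blast
  show thesis
  proof (rule that[of "\<bar>L\<bar>"])
    fix l r assume lr: "a \<le> l" "l \<le> r" "r \<le> b"
    show "\<bar>g r - g l\<bar> \<le> \<bar>L\<bar> * (r - l)"
    proof (cases "l = r")
      case False
      with lr have "l < r" by simp
      from MVT2[OF this assms(1)] obtain z where z: "l < z" "z < r" "g r - g l = (r - l) * g' z" by blast
      have "z \<in> {a..b}" using z lr by simp
      then have "norm (g' z) \<le> L" using L by blast
      then have "\<bar>g' z\<bar> \<le> \<bar>L\<bar>" by simp
      then show ?thesis using z(3) lr by (simp add: abs_mult mult.commute mult_right_mono)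
    qed simp
  qed simp
qed

text \<open>The equation \<open>u' + A u = r + \<omega> u\<close> tested with the eigenfunctions.\<close>

definition modal_solution :: "(real \<Rightarrow> real) \<Rightarrow> real \<Rightarrow> (real \<Rightarrow> l2) \<Rightarrow> (real \<Rightarrow> l2) \<Rightarrow> bool" where
  "modal_solution \<omega> s r u \<longleftrightarrow> continuous_on {s..} u \<and>
     (\<forall>T1 T2. s < T1 \<and> T1 < T2 \<longrightarrow> abs_continuous_on T1 T2 u) \<and>
     (\<forall>k. AE t in lborel. s < t \<longrightarrow> ((\<lambda>t. inner (u t) (ek k)) has_real_derivative
        (inner (r t) (ek k) - (lam k - \<omega> t) * inner (u t) (ek k))) (at t))"

text \<open>The exponential weights are integrating factors: the derivative of the tested solution
  contains only the forcing. Finitely many modes give a real absolutely continuous function, to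
  which the increment bound applies.\<close>

lemma modal_solution_test_interior:
  assumes m: "modal_solution \<omega> s r u" and T: "s < T1" "T1 < T2"
    and \<Omega>: "\<And>t. (\<Omega> has_real_derivative \<omega> t) (at t)" and \<omega>c: "continuous_on UNIV \<omega>"
    and C: "AE t in lborel. T1 < t \<and> t < T2 \<longrightarrow> C \<le> (\<Sum>k<N. a k * exp (lam k * t - \<Omega> t) * inner (r t) (ek k))"
  shows "C * (T2 - T1) \<le> (\<Sum>k<N. a k * exp (lam k * T2 - \<Omega> T2) * inner (u T2) (ek k)) -
    (\<Sum>k<N. a k * exp (lam k * T1 - \<Omega> T1) * inner (u T1) (ek k))"
proof -
  define g where "g k t = a k * exp (lam k * t - \<Omega> t)" for k t
  define g' where "g' k t = g k t * (lam k - \<omega> t)" for k t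
  have dg: "(g k has_real_derivative g' k t) (at t)" for k t
    unfolding g_def[abs_def] g'_def by (auto intro!: derivative_eq_intros \<Omega> simp: g_def)
  have cg: "continuous_on UNIV (g k)" for k
    by (intro continuous_at_imp_continuous_on ballI DERIV_isCont[OF dg])
  have cg': "continuous_on UNIV (g' k)" for k
    unfolding g'_def by (intro continuous_intros cg \<omega>c)
  define \<psi> where "\<psi> t = (\<Sum>k<N. g k t *\<^sub>R ek k)" for t
  have uc: "continuous_on {T1..T2} u"
    using m T unfolding modal_solution_def by (auto elim: continuous_on_subset)
  have "bounded (u ` {T1..T2})" by (intro compact_imp_bounded compact_continuous_image uc) auto
  then obtain M where M: "\<forall>y\<in>u ` {T1..T2}. norm y \<le> M" unfolding bounded_iff by blast
  have "bounded (\<psi> ` {T1..T2})" unfolding \<psi>_def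
    by (intro compact_imp_bounded compact_continuous_image continuous_intros continuous_on_subset[OF cg]) auto
  then obtain M' where M': "\<forall>y\<in>\<psi> ` {T1..T2}. norm y \<le> M'" unfolding bounded_iff by blast
  have "\<exists>L. \<forall>l r. T1 \<le> l \<longrightarrow> l \<le> r \<longrightarrow> r \<le> T2 \<longrightarrow> \<bar>g k r - g k l\<bar> \<le> L * (r - l)" for k
    using C1_lipschitz[OF dg cg'] by metis
  then obtain L where L: "\<And>k l r. T1 \<le> l \<Longrightarrow> l \<le> r \<Longrightarrow> r \<le> T2 \<Longrightarrow> \<bar>g k r - g k l\<bar> \<le> L k * (r - l)" by metis
  have lip: "norm (\<psi> r - \<psi> l) \<le> (\<Sum>k<N. L k) * (r - l)" if "T1 \<le> l" "l \<le> r" "r \<le> T2" for l r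
  proof -
    have ne: "norm (ek k) = 1" for k using inner_ek_ek[of k k] by (simp add: norm_eq_sqrt_inner)
    have "\<psi> r - \<psi> l = (\<Sum>k<N. (g k r - g k l) *\<^sub>R ek k)" by (simp add: \<psi>_def sum_subtractf scaleR_left_diff_distrib)
    then have "norm (\<psi> r - \<psi> l) \<le> (\<Sum>k<N. norm ((g k r - g k l) *\<^sub>R ek k))" using norm_sum[of "\<lambda>k. (g k r - g k l) *\<^sub>R ek k" "{..<N}"] by simp
    also have "\<dots> \<le> (\<Sum>k<N. L k * (r - l))" using L[OF that] by (intro sum_mono) (simp add: ne)
    finally show ?thesis by (simp add: sum_distrib_right)
  qed
  have "abs_continuous_on T1 T2 u" using m T unfolding modal_solution_def by blast
  then have ac: "abs_continuous_on T1 T2 (\<lambda>t. inner (u t) (\<psi> t))"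
    by (rule abs_continuous_on_inner[of _ _ _ M _ M', OF _ _ _ lip]) (use M M' in auto)
  have "AE t in lborel. \<forall>k. s < t \<longrightarrow> ((\<lambda>t. inner (u t) (ek k)) has_real_derivative
        (inner (r t) (ek k) - (lam k - \<omega> t) * inner (u t) (ek k))) (at t)"
    using m unfolding modal_solution_def by (subst AE_all_countable) blast
  with C have "AE t in lborel. T1 < t \<and> t < T2 \<longrightarrow> (\<exists>D. ((\<lambda>t. inner (u t) (\<psi> t)) has_real_derivative D) (at t) \<and> C \<le> D)"
  proof eventually_elim
    case (elim t)
    show ?case
    proof
      assume t: "T1 < t \<and> t < T2"
      have "((\<lambda>t. \<Sum>k<N. g k t * inner (u t) (ek k)) has_real_derivative
         (\<Sum>k<N. g' k t * inner (u t) (ek k) + (inner (r t) (ek k) - (lam k - \<omega> t) * inner (u t) (ek k)) * g k t)) (at t)"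
        using elim(2) t T by (intro DERIV_sum DERIV_mult dg) auto
      moreover have "(\<Sum>k<N. g' k t * inner (u t) (ek k) + (inner (r t) (ek k) - (lam k - \<omega> t) * inner (u t) (ek k)) * g k t)
         = (\<Sum>k<N. g k t * inner (r t) (ek k))"
        by (intro sum.cong refl) (simp add: g'_def algebra_simps)
      ultimately have "((\<lambda>t. inner (u t) (\<psi> t)) has_real_derivative (\<Sum>k<N. g k t * inner (r t) (ek k))) (at t)"
        by (simp add: \<psi>_def inner_sum_right)
      then show "\<exists>D. ((\<lambda>t. inner (u t) (\<psi> t)) has_real_derivative D) (at t) \<and> C \<le> D"
        using elim(1) t by (intro exI conjI) (auto simp: g_def)
    qed
  qed
  from abs_continuous_on_increment_ge[OF ac less_imp_le[OF T(2)] this]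
  show ?thesis by (simp add: \<psi>_def inner_sum_right g_def)
qed

text \<open>Absolute continuity is given only away from the initial time \<open>s\<close>;
  continuity of \<open>u\<close> at \<open>s\<close> extends the estimate.\<close>

lemma modal_solution_test:
  assumes m: "modal_solution \<omega> s r u" and T: "s < T"
    and \<Omega>: "\<And>t. (\<Omega> has_real_derivative \<omega> t) (at t)" and \<omega>c: "continuous_on UNIV \<omega>"
    and C: "AE t in lborel. s < t \<and> t < T \<longrightarrow> C \<le> (\<Sum>k<N. a k * exp (lam k * t - \<Omega> t) * inner (r t) (ek k))"
  shows "C * (T - s) \<le> (\<Sum>k<N. a k * exp (lam k * T - \<Omega> T) * inner (u T) (ek k)) -
    (\<Sum>k<N. a k * exp (lam k * s - \<Omega> s) * inner (u s) (ek k))"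
proof -
  define h where "h t = (\<Sum>k<N. a k * exp (lam k * t - \<Omega> t) * inner (u t) (ek k))" for t
  have c\<Omega>: "continuous_on S \<Omega>" for S
    by (intro continuous_at_imp_continuous_on ballI DERIV_isCont[OF \<Omega>])
  have "continuous_on {s..} u" using m by (simp add: modal_solution_def)
  then have "continuous_on {s..} h" unfolding h_def by (intro continuous_intros c\<Omega>)
  then have "(h \<longlongrightarrow> h s) (at s within {s..})" by (simp add: continuous_on)
  then have lim: "(h \<longlongrightarrow> h s) (at_right s)" by (rule tendsto_within_subset) auto
  have "((\<lambda>t. C * (T - t) + h t) \<longlongrightarrow> C * (T - s) + h s) (at_right s)"
    by (intro tendsto_intros lim)
  moreover have "eventually (\<lambda>t. C * (T - t) + h t \<le> h T) (at_right s)"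
    using eventually_at_right_less[of s] eventually_at_right_real[OF T]
  proof eventually_elim
    case (elim t)
    have "AE t' in lborel. t < t' \<and> t' < T \<longrightarrow> C \<le> (\<Sum>k<N. a k * exp (lam k * t' - \<Omega> t') * inner (r t') (ek k))"
      using C by eventually_elim (use elim in auto)
    from modal_solution_test_interior[OF m _ _ \<Omega> \<omega>c this] elim show ?case by (simp add: h_def)
  qed
  ultimately have "C * (T - s) + h s \<le> h T"
    by (rule tendsto_upperbound) simp
  then show ?thesis by (simp add: h_def)
qed

text \<open>Testing one mode with the weights 1 and -1 gives both inequalities.\<close>

lemma modal_solution_homogeneous:
  assumes m: "modal_solution \<omega> s r u" and r: "AE t in lborel. s < t \<longrightarrow> r t = 0" and T: "s \<le> T"
    and \<Omega>: "\<And>t. (\<Omega> has_real_derivative \<omega> t) (at t)" and \<omega>c: "continuous_on UNIV \<omega>"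
  shows "exp (lam k * T - \<Omega> T) * inner (u T) (ek k) = exp (lam k * s - \<Omega> s) * inner (u s) (ek k)"
proof (cases "s = T")
  case False
  with T have T: "s < T" by simp
  have *: "(\<Sum>j<Suc k. (if j = k then c else 0) * x j * y j) = c * x k * y k" for c :: real and x y
    by simp
  have "AE t in lborel. s < t \<and> t < T \<longrightarrow> 0 \<le> (\<Sum>j<Suc k. (if j = k then c else 0) * exp (lam j * t - \<Omega> t) * inner (r t) (ek j))" for c :: real
    using r by eventually_elim simp
  from modal_solution_test[OF m T \<Omega> \<omega>c this[of 1]] modal_solution_test[OF m T \<Omega> \<omega>c this[of "-1"]]
  show ?thesis unfolding * by simp
qed simp

text \<open>Mode \<open>k\<close> is multiplied by exp(-\<open>lam k\<close> (T - s) +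
  \<open>\<Omega>\<close> T - \<open>\<Omega>\<close> s). The slowest rate is that of the smallest
  eigenvalue \<open>pi\<^sup>2\<close>, and \<open>\<Omega>\<close> grows at most at the rate
  \<open>\<omega>1\<close>; Parseval's identity collects the modes.\<close>

lemma modal_solution_decay:
  assumes m: "modal_solution \<omega> s r u" and r: "AE t in lborel. s < t \<longrightarrow> r t = 0" and T: "s \<le> T"
    and \<omega>c: "continuous_on UNIV \<omega>" and \<omega>1: "\<And>t. \<omega> t \<le> \<omega>1"
  shows "norm (u T) \<le> exp (- ((pi\<^sup>2 - \<omega>1) * (T - s))) * norm (u s)"
proof -
  obtain \<Omega> where \<Omega>: "\<And>t. (\<Omega> has_real_derivative \<omega> t) (at t)" using ex_antiderivative[OF \<omega>c] by blast
  define q where "q = exp (- ((pi\<^sup>2 - \<omega>1) * (T - s)))"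
  have \<Omega>le: "\<Omega> T - \<Omega> s \<le> \<omega>1 * (T - s)"
  proof (cases "s = T")
    case False
    with T have "s < T" by simp
    from MVT2[OF this \<Omega>] obtain z where "\<Omega> T - \<Omega> s = (T - s) * \<omega> z" by blast
    then show ?thesis using mult_right_mono[OF \<omega>1[of z], of "T - s"] T by (simp add: mult.commute)
  qed simp
  have "(inner (u T) (ek k))\<^sup>2 \<le> q\<^sup>2 * (inner (u s) (ek k))\<^sup>2" for k
  proof -
    have "inner (u T) (ek k) = exp (- (lam k * T - \<Omega> T)) * (exp (lam k * T - \<Omega> T) * inner (u T) (ek k))"
      by (simp add: mult.assoc[symmetric] mult_exp_exp)
    also have "\<dots> = exp (- (lam k * T - \<Omega> T)) * (exp (lam k * s - \<Omega> s) * inner (u s) (ek k))"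
      unfolding modal_solution_homogeneous[OF m r T \<Omega> \<omega>c] ..
    also have "\<dots> = exp (- (lam k * (T - s)) + (\<Omega> T - \<Omega> s)) * inner (u s) (ek k)"
      by (simp add: mult_exp_exp algebra_simps flip: mult.assoc)
    finally have e: "inner (u T) (ek k) = exp (- (lam k * (T - s)) + (\<Omega> T - \<Omega> s)) * inner (u s) (ek k)" .
    have "pi\<^sup>2 \<le> lam k" by (rule lam_ge)
    then have "pi\<^sup>2 * (T - s) \<le> lam k * (T - s)" using T by (intro mult_right_mono) auto
    then have "- (lam k * (T - s)) + (\<Omega> T - \<Omega> s) \<le> - ((pi\<^sup>2 - \<omega>1) * (T - s))"
      using \<Omega>le by (simp add: left_diff_distrib)
    then have "(exp (- (lam k * (T - s)) + (\<Omega> T - \<Omega> s)))\<^sup>2 \<le> q\<^sup>2"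
      unfolding q_def by (intro power_mono) auto
    then show ?thesis unfolding e power_mult_distrib by (intro mult_right_mono) auto
  qed
  then have "(norm (u T))\<^sup>2 \<le> q\<^sup>2 * (norm (u s))\<^sup>2"
    by (rule sums_le[OF _ parseval_norm sums_mult[OF parseval_norm]])
  then have "(norm (u T))\<^sup>2 \<le> (q * norm (u s))\<^sup>2" by (simp add: power_mult_distrib)
  then show ?thesis unfolding q_def by (rule power2_le_imp_le) simp
qed

text \<open>The comparison principle in Duhamel form: nonnegative forcing can only increase the
  solution above the propagated initial value. It is proved for truncated kernels with the time
  shifted by \<open>e\<close>; first the truncation is removed, then \<open>e\<close> tends to
  0.\<close>

lemma modal_solution_positivity:
  assumes m: "modal_solution \<omega> s r u" and T: "s < T" and \<phi>: "\<phi> \<in> Hplus"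
    and r: "AE t in lborel. s < t \<longrightarrow> r t \<in> Hplus \<and> norm (r t) \<le> R"
    and \<Omega>: "\<And>t. (\<Omega> has_real_derivative \<omega> t) (at t)" and \<omega>c: "continuous_on UNIV \<omega>" and \<omega>0: "\<And>t. 0 \<le> \<omega> t"
  shows "exp (- \<Omega> s) * heat_form (u s) \<phi> (T - s) \<le> exp (- \<Omega> T) * inner (u T) \<phi>"
proof -
  have \<Omega>m: "\<Omega> s \<le> \<Omega> t" if "s \<le> t" for t
    by (rule DERIV_nonneg_imp_nondecreasing[OF that]) (use \<Omega> \<omega>0 in blast)
  \<comment> \<open>The shift keeps the time argument of the kernel at least \<open>e\<close> up to
    the final time, so the truncation tail is small uniformly in \<open>t\<close>.\<close>
  have eps: "exp (- \<Omega> s) * heat_form (u s) \<phi> (T - s + e) \<le> exp (- \<Omega> T) * heat_form (u T) \<phi> e" if e: "0 < e" for e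
  proof -
    let ?D = "\<lambda>v \<tau> N. \<Sum>k<N. decay \<tau> k * (inner v (ek k) * inner \<phi> (ek k))"
    \<comment> \<open>Uniform in \<open>t\<close>, because \<open>\<Omega>\<close> is nondecreasing
      and the forcing is bounded by \<open>R\<close>.\<close>
    define X where "X = exp (- \<Omega> s) * (\<bar>R\<bar> * norm \<phi>)"
    have X0: "0 \<le> X" by (simp add: X_def)
    have step: "- (tail e N * X) * (T - s) \<le> exp (- \<Omega> T) * ?D (u T) e N - exp (- \<Omega> s) * ?D (u s) (T - s + e) N" for N
    proof -
      have t0: "0 \<le> tail e N"
        unfolding tail_def using decay_summable[OF e] decay_pos
        by (intro mult_nonneg_nonneg suminf_nonneg summable_ignore_initial_segment) (auto intro: less_imp_le)
      \<comment> \<open>With these weights the integrating factor leaves the heat propagator from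
        time \<open>t\<close> to \<open>T + e\<close>, times
        \<open>exp (- \<Omega> t)\<close>.\<close>
      define a where "a k = decay (T + e) k * inner \<phi> (ek k)" for k
      have ae: "a k * exp (lam k * t - \<Omega> t) * x = exp (- \<Omega> t) * (decay (T - t + e) k * (x * inner \<phi> (ek k)))" for k t x
      proof -
        have "decay (T + e) k * exp (lam k * t - \<Omega> t) = exp (- \<Omega> t) * decay (T - t + e) k"
          unfolding decay_def mult_exp_exp by (simp add: algebra_simps)
        then show ?thesis unfolding a_def by (metis mult.assoc mult.commute)
      qed
      have "AE t in lborel. s < t \<and> t < T \<longrightarrow> - (tail e N * X) \<le> (\<Sum>k<N. a k * exp (lam k * t - \<Omega> t) * inner (r t) (ek k))"
        using r
      proof eventually_elim
        case (elim t)
        show ?case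
        proof
          assume t: "s < t \<and> t < T"
          have "tail (T - t + e) N \<le> tail e N" using t e by (intro tail_antimono) auto
          then have "tail (T - t + e) N * (norm (r t) * norm \<phi>) \<le> tail e N * (\<bar>R\<bar> * norm \<phi>)"
            using elim t t0 by (intro mult_mono mult_right_mono) auto
          moreover have "- (tail (T - t + e) N * (norm (r t) * norm \<phi>)) \<le> ?D (r t) (T - t + e) N"
            using elim t e \<phi> by (intro kernel_sum_lower) auto
          ultimately have l: "- (tail e N * (\<bar>R\<bar> * norm \<phi>)) \<le> ?D (r t) (T - t + e) N" by linarith
          have "exp (- \<Omega> t) * (tail e N * (\<bar>R\<bar> * norm \<phi>)) \<le> exp (- \<Omega> s) * (tail e N * (\<bar>R\<bar> * norm \<phi>))"
            using \<Omega>m[of t] t t0 by (intro mult_right_mono) auto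
          then have "- (tail e N * X) \<le> exp (- \<Omega> t) * - (tail e N * (\<bar>R\<bar> * norm \<phi>))"
            by (simp add: X_def mult_ac)
          also have "\<dots> \<le> exp (- \<Omega> t) * ?D (r t) (T - t + e) N" using l by (intro mult_left_mono) auto
          finally show "- (tail e N * X) \<le> (\<Sum>k<N. a k * exp (lam k * t - \<Omega> t) * inner (r t) (ek k))"
            unfolding ae sum_distrib_left .
        qed
      qed
      from modal_solution_test[OF m T \<Omega> \<omega>c this] show ?thesis
        unfolding ae sum_distrib_left[symmetric] by simp
    qed
    have "(\<lambda>N. - (tail e N * X) * (T - s)) \<longlonglongrightarrow> - (0 * X) * (T - s)"
      by (intro tendsto_intros tail_tendsto e)
    moreover have "(\<lambda>N. exp (- \<Omega> T) * ?D (u T) e N - exp (- \<Omega> s) * ?D (u s) (T - s + e) N) \<longlonglongrightarrow>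
      exp (- \<Omega> T) * heat_form (u T) \<phi> e - exp (- \<Omega> s) * heat_form (u s) \<phi> (T - s + e)"
      using e T by (intro tendsto_intros heat_form_LIMSEQ) auto
    ultimately have "- (0 * X) * (T - s) \<le> exp (- \<Omega> T) * heat_form (u T) \<phi> e - exp (- \<Omega> s) * heat_form (u s) \<phi> (T - s + e)"
      by (rule LIMSEQ_le) (use step in blast)
    then show ?thesis by simp
  qed
  have lim: "((\<lambda>e. heat_form v \<phi> (c + e)) \<longlongrightarrow> heat_form v \<phi> c) (at_right 0)" if "0 \<le> c" for v c
  proof -
    have "continuous_on {0..} (\<lambda>e. heat_form v \<phi> (c + e))"
      by (rule continuous_on_compose2[OF heat_form_continuous]) (use that in \<open>auto intro!: continuous_intros\<close>)
    then have "((\<lambda>e. heat_form v \<phi> (c + e)) \<longlongrightarrow> heat_form v \<phi> (c + 0)) (at 0 within {0..})"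
      unfolding continuous_on by blast
    then show ?thesis by (auto intro: tendsto_within_subset[where S = "{0..}"])
  qed
  have "((\<lambda>e. exp (- \<Omega> T) * heat_form (u T) \<phi> (0 + e)) \<longlongrightarrow> exp (- \<Omega> T) * heat_form (u T) \<phi> 0) (at_right 0)"
    by (intro tendsto_intros lim) simp
  moreover have "((\<lambda>e. exp (- \<Omega> s) * heat_form (u s) \<phi> (T - s + e)) \<longlongrightarrow> exp (- \<Omega> s) * heat_form (u s) \<phi> (T - s)) (at_right 0)"
    using T by (intro tendsto_intros lim) simp
  ultimately have "exp (- \<Omega> s) * heat_form (u s) \<phi> (T - s) \<le> exp (- \<Omega> T) * heat_form (u T) \<phi> 0"
    by (rule tendsto_le[rotated]) (use eps in \<open>auto simp: eventually_at_filter intro!: always_eventually\<close>)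
  then show ?thesis by (simp add: heat_form_0)
qed

section \<open>The structure of nonnegative strong solutions\<close>

lemma modal_solution_restrict:
  assumes m: "modal_solution \<omega> \<tau> r u" and s: "\<tau> \<le> s" shows "modal_solution \<omega> s r u"
  unfolding modal_solution_def
proof (intro conjI allI impI)
  show "continuous_on {s..} u"
    using m s unfolding modal_solution_def by (elim conjE continuous_on_subset) simp
  show "abs_continuous_on T1 T2 u" if "s < T1 \<and> T1 < T2" for T1 T2
    using m s that unfolding modal_solution_def by (meson le_less_trans)
  fix k
  have "AE t in lborel. \<tau> < t \<longrightarrow> ((\<lambda>t. inner (u t) (ek k)) has_real_derivative
        (inner (r t) (ek k) - (lam k - \<omega> t) * inner (u t) (ek k))) (at t)"
    using m unfolding modal_solution_def by blast
  then show "AE t in lborel. s < t \<longrightarrow> ((\<lambda>t. inner (u t) (ek k)) has_real_derivative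
        (inner (r t) (ek k) - (lam k - \<omega> t) * inner (u t) (ek k))) (at t)"
    by eventually_elim (use s in simp)
qed

lemma abs_continuous_on_diff:
  fixes u v :: "real \<Rightarrow> 'a::real_normed_vector"
  assumes "abs_continuous_on a b u" "abs_continuous_on a b v"
  shows "abs_continuous_on a b (\<lambda>t. u t - v t)"
  unfolding abs_continuous_on_def
proof (intro allI impI)
  fix e :: real assume "0 < e"
  then have e: "0 < e / 2" by simp
  obtain d1 where d1: "0 < d1" "\<forall>(n::nat) l r. (\<forall>i<n. a \<le> l i \<and> l i \<le> r i \<and> r i \<le> b) \<and>
     disjoint_family_on (\<lambda>i. {l i<..<r i}) {..<n} \<and> (\<Sum>i<n. r i - l i) < d1
     \<longrightarrow> (\<Sum>i<n. norm (u (r i) - u (l i))) < e / 2"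
    using assms(1)[unfolded abs_continuous_on_def, rule_format, OF e] by blast
  obtain d2 where d2: "0 < d2" "\<forall>(n::nat) l r. (\<forall>i<n. a \<le> l i \<and> l i \<le> r i \<and> r i \<le> b) \<and>
     disjoint_family_on (\<lambda>i. {l i<..<r i}) {..<n} \<and> (\<Sum>i<n. r i - l i) < d2
     \<longrightarrow> (\<Sum>i<n. norm (v (r i) - v (l i))) < e / 2"
    using assms(2)[unfolded abs_continuous_on_def, rule_format, OF e] by blast
  show "\<exists>d>0. \<forall>(n::nat) l r. (\<forall>i<n. a \<le> l i \<and> l i \<le> r i \<and> r i \<le> b) \<and>
     disjoint_family_on (\<lambda>i. {l i<..<r i}) {..<n} \<and> (\<Sum>i<n. r i - l i) < d
     \<longrightarrow> (\<Sum>i<n. norm (u (r i) - v (r i) - (u (l i) - v (l i)))) < e"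
  proof (intro exI[of _ "min d1 d2"] conjI allI impI)
    show "0 < min d1 d2" using d1 d2 by simp
    fix n :: nat and l r :: "nat \<Rightarrow> real"
    assume H: "(\<forall>i<n. a \<le> l i \<and> l i \<le> r i \<and> r i \<le> b) \<and>
     disjoint_family_on (\<lambda>i. {l i<..<r i}) {..<n} \<and> (\<Sum>i<n. r i - l i) < min d1 d2"
    have "(\<Sum>i<n. norm (u (r i) - v (r i) - (u (l i) - v (l i)))) \<le>
      (\<Sum>i<n. norm (u (r i) - u (l i)) + norm (v (r i) - v (l i)))"
    proof (intro sum_mono)
      fix i
      have "u (r i) - v (r i) - (u (l i) - v (l i)) = (u (r i) - u (l i)) - (v (r i) - v (l i))" by simp
      then show "norm (u (r i) - v (r i) - (u (l i) - v (l i))) \<le> norm (u (r i) - u (l i)) + norm (v (r i) - v (l i))"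
        by (metis norm_triangle_ineq4)
    qed
    also have "\<dots> < e / 2 + e / 2"
      unfolding sum.distrib
    proof (intro add_strict_mono)
      show "(\<Sum>i<n. norm (u (r i) - u (l i))) < e / 2" using H by (intro d1(2)[rule_format]) simp
      show "(\<Sum>i<n. norm (v (r i) - v (l i))) < e / 2" using H by (intro d2(2)[rule_format]) simp
    qed
    finally show "(\<Sum>i<n. norm (u (r i) - v (r i) - (u (l i) - v (l i)))) < e" by simp
  qed
qed

lemma lipschitz_abs_continuous_on:
  fixes u :: "real \<Rightarrow> 'a::real_normed_vector"
  assumes "\<And>l r. l \<le> r \<Longrightarrow> norm (u r - u l) \<le> C * (r - l)"
  shows "abs_continuous_on a b u"
  unfolding abs_continuous_on_def
proof (intro allI impI)
  fix e :: real assume e: "0 < e"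
  have C: "norm (u r - u l) \<le> (\<bar>C\<bar> + 1) * (r - l)" if "l \<le> r" for l r
  proof -
    have "C * (r - l) \<le> (\<bar>C\<bar> + 1) * (r - l)" using that by (intro mult_right_mono) auto
    then show ?thesis using assms[OF that] by linarith
  qed
  show "\<exists>d>0. \<forall>(n::nat) l r. (\<forall>i<n. a \<le> l i \<and> l i \<le> r i \<and> r i \<le> b) \<and>
     disjoint_family_on (\<lambda>i. {l i<..<r i}) {..<n} \<and> (\<Sum>i<n. r i - l i) < d
     \<longrightarrow> (\<Sum>i<n. norm (u (r i) - u (l i))) < e"
  proof (intro exI[of _ "e / (\<bar>C\<bar> + 1)"] conjI allI impI)
    show "0 < e / (\<bar>C\<bar> + 1)" using e by (simp add: add_nonneg_pos)
    fix n :: nat and l r :: "nat \<Rightarrow> real"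
    assume H: "(\<forall>i<n. a \<le> l i \<and> l i \<le> r i \<and> r i \<le> b) \<and>
     disjoint_family_on (\<lambda>i. {l i<..<r i}) {..<n} \<and> (\<Sum>i<n. r i - l i) < e / (\<bar>C\<bar> + 1)"
    have "(\<Sum>i<n. norm (u (r i) - u (l i))) \<le> (\<Sum>i<n. (\<bar>C\<bar> + 1) * (r i - l i))"
      using H by (intro sum_mono C) simp
    also have "\<dots> = (\<bar>C\<bar> + 1) * (\<Sum>i<n. r i - l i)" by (simp only: sum_distrib_left)
    also have "\<dots> < (\<bar>C\<bar> + 1) * (e / (\<bar>C\<bar> + 1))"
      using H by (intro mult_strict_left_mono) (auto simp: add_nonneg_pos)
    also have "\<dots> = e" by (simp add: add_nonneg_eq_0_iff)
    finally show "(\<Sum>i<n. norm (u (r i) - u (l i))) < e" .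
  qed
qed

lemma modal_solution_diff:
  assumes "modal_solution \<omega> s r u" "modal_solution \<omega> s q v"
  shows "modal_solution \<omega> s (\<lambda>t. r t - q t) (\<lambda>t. u t - v t)"
  unfolding modal_solution_def
proof (intro conjI allI impI)
  show "continuous_on {s..} (\<lambda>t. u t - v t)"
    using assms unfolding modal_solution_def by (intro continuous_on_diff) auto
  show "abs_continuous_on T1 T2 (\<lambda>t. u t - v t)" if "s < T1 \<and> T1 < T2" for T1 T2
    using assms that unfolding modal_solution_def by (intro abs_continuous_on_diff) auto
  fix k
  have "AE t in lborel. s < t \<longrightarrow> ((\<lambda>t. inner (u t) (ek k)) has_real_derivative
        (inner (r t) (ek k) - (lam k - \<omega> t) * inner (u t) (ek k))) (at t)"
    using assms(1) unfolding modal_solution_def by blast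
  moreover have "AE t in lborel. s < t \<longrightarrow> ((\<lambda>t. inner (v t) (ek k)) has_real_derivative
        (inner (q t) (ek k) - (lam k - \<omega> t) * inner (v t) (ek k))) (at t)"
    using assms(2) unfolding modal_solution_def by blast
  ultimately show "AE t in lborel. s < t \<longrightarrow> ((\<lambda>t. inner (u t - v t) (ek k)) has_real_derivative
        (inner (r t - q t) (ek k) - (lam k - \<omega> t) * inner (u t - v t) (ek k))) (at t)"
  proof eventually_elim
    case (elim t)
    show ?case
    proof
      assume "s < t"
      with elim show "((\<lambda>t. inner (u t - v t) (ek k)) has_real_derivative
        (inner (r t - q t) (ek k) - (lam k - \<omega> t) * inner (u t - v t) (ek k))) (at t)"
        unfolding inner_diff_left by (intro DERIV_cong[OF DERIV_diff]) (auto simp: algebra_simps)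
    qed
  qed
qed

text \<open>The definition speaks of bounded windows that begin after \<open>\<tau>\<close>;
  countably many of them exhaust the half line, so their null sets can be united.\<close>

lemma strong_solution_dom_A:
  assumes "strong_solution b \<omega> \<tau> u0 u"
  shows "AE t in lborel. \<tau> < t \<longrightarrow> u t \<in> dom_A"
proof -
  define a where "a n = \<tau> + 1 / real (Suc n)" for n
  have "AE t in lborel. a n < t \<and> t < a n + real (Suc n) \<longrightarrow> u t \<in> dom_A" for n
  proof -
    have "\<tau> < a n \<and> a n < a n + real (Suc n)" by (simp add: a_def)
    then show ?thesis using assms unfolding strong_solution_def by blast
  qed
  then have "AE t in lborel. \<forall>n. a n < t \<and> t < a n + real (Suc n) \<longrightarrow> u t \<in> dom_A"
    unfolding AE_all_countable by blast
  then show ?thesis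
  proof eventually_elim
    case (elim t)
    show ?case
    proof
      assume t: "\<tau> < t"
      obtain m where m: "1 / real (Suc m) < t - \<tau>" using t reals_Archimedean[of "t - \<tau>"] by (auto simp: inverse_eq_divide)
      obtain p where p: "t - \<tau> < real p" using reals_Archimedean2 by blast
      define n where "n = m + p"
      have "1 / real (Suc n) \<le> 1 / real (Suc m)" by (intro divide_left_mono) (auto simp: n_def)
      then have "a n < t" using m by (simp add: a_def)
      moreover have "t < a n + real (Suc n)"
      proof -
        have "0 < 1 / real (Suc n)" "real p < real (Suc n)" by (simp_all add: n_def)
        then show ?thesis using p unfolding a_def by linarith
      qed
      ultimately show "u t \<in> dom_A" using elim by blast
    qed
  qed
qed

lemma strong_solution_modal:
  assumes u: "strong_solution b \<omega> \<tau> u0 u"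
    and r: "AE t in lborel. \<tau> < t \<longrightarrow>
           (\<exists>u'. (u has_vector_derivative u') (at t) \<and> u' + op_A (u t) = r t + \<omega> t *\<^sub>R u t)"
  shows "modal_solution \<omega> \<tau> r u"
  unfolding modal_solution_def
proof (intro conjI allI impI)
  show "continuous_on {\<tau>..} u" using u by (simp add: strong_solution_def)
  show "abs_continuous_on T1 T2 u" if "\<tau> < T1 \<and> T1 < T2" for T1 T2
    using u that unfolding strong_solution_def by blast
  fix k
  show "AE t in lborel. \<tau> < t \<longrightarrow> ((\<lambda>t. inner (u t) (ek k)) has_real_derivative
        (inner (r t) (ek k) - (lam k - \<omega> t) * inner (u t) (ek k))) (at t)"
    using r strong_solution_dom_A[OF u]
  proof eventually_elim
    case (elim t)
    show ?case
    proof
      assume t: "\<tau> < t"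
      then obtain u' where u': "(u has_vector_derivative u') (at t)" "u' + op_A (u t) = r t + \<omega> t *\<^sub>R u t"
        using elim by blast
      have "inner u' (ek k) + inner (op_A (u t)) (ek k) = inner (r t) (ek k) + \<omega> t * inner (u t) (ek k)"
        using arg_cong[OF u'(2), of "\<lambda>v. inner v (ek k)"] by (simp add: inner_add_left)
      then have "inner u' (ek k) = inner (r t) (ek k) - (lam k - \<omega> t) * inner (u t) (ek k)"
        using dom_A_coeff[of "u t" k] elim t by (simp add: algebra_simps)
      moreover have "((\<lambda>t. inner (u t) (ek k)) has_vector_derivative inner u' (ek k)) (at t)"
        using bounded_linear.has_vector_derivative[OF bounded_linear_inner_left u'(1)] .
      ultimately show "((\<lambda>t. inner (u t) (ek k)) has_real_derivative
        (inner (r t) (ek k) - (lam k - \<omega> t) * inner (u t) (ek k))) (at t)"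
        by (simp add: has_real_derivative_iff_has_vector_derivative)
    qed
  qed
qed

lemma HplusI:
  assumes f: "square_integrable f" and nn: "\<And>x. 0 < x \<Longrightarrow> x < 1 \<Longrightarrow> 0 \<le> f x"
  shows "abs_l2 f \<in> Hplus"
  unfolding Hplus_def mem_Collect_eq
  using rep_abs_l2[OF f] AE_space[of I01]
proof eventually_elim
  case (elim x)
  then show ?case using nn[of x] by (simp add: space_I01)
qed

text \<open>A curve in the positive cone has a minimum at \<open>t\<close> when tested against functions supported on
  the zero set of \<open>u t\<close>.\<close>

lemma derivative_zero_on_zero_set:
  assumes pos: "\<And>t. \<tau> \<le> t \<Longrightarrow> u t \<in> Hplus" and t: "\<tau> < t" and u': "(u has_vector_derivative u') (at t)"
  shows "AE x in I01. rep_l2 (u t) x = 0 \<longrightarrow> rep_l2 u' x = 0"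
proof -
  \<comment> \<open>The two signs treat the positive and the negative part of the derivative, each
    by a nonnegative test function.\<close>
  have "AE x in I01. rep_l2 (u t) x = 0 \<longrightarrow> c * rep_l2 u' x \<le> 0" if c: "\<bar>c\<bar> = 1" for c :: real
  proof -
    define f where "f x = (if rep_l2 (u t) x = 0 then max 0 (c * rep_l2 u' x) else 0)" for x
    have fm [measurable]: "f \<in> borel_measurable I01" unfolding f_def[abs_def] by measurable
    have fs: "square_integrable f"
      unfolding square_integrable_def
    proof (rule conjI[OF fm], rule Bochner_Integration.integrable_bound[of I01 "\<lambda>x. (rep_l2 u' x)\<^sup>2"])
      show "integrable I01 (\<lambda>x. (rep_l2 u' x)\<^sup>2)" using square_integrable_rep[of u'] by (simp add: square_integrable_def)
      have "\<bar>f x\<bar> \<le> \<bar>rep_l2 u' x\<bar>" for x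
      proof -
        have "0 \<le> f x" "f x \<le> \<bar>c * rep_l2 u' x\<bar>" by (simp_all add: f_def abs_ge_self)
        moreover have "\<bar>c * rep_l2 u' x\<bar> = \<bar>rep_l2 u' x\<bar>" using c by (simp add: abs_mult)
        ultimately show ?thesis by linarith
      qed
      then show "AE x in I01. norm ((f x)\<^sup>2) \<le> norm ((rep_l2 u' x)\<^sup>2)"
        by (intro AE_I2) (simp add: abs_le_square_iff[symmetric])
    qed measurable
    define \<phi> where "\<phi> = abs_l2 f"
    have \<phi>: "\<phi> \<in> Hplus" unfolding \<phi>_def by (rule HplusI[OF fs]) (simp add: f_def)
    have "inner (u t) \<phi> = (\<integral>x. 0 \<partial>I01)"
      unfolding \<phi>_def inner_abs[OF fs] by (intro Bochner_Integration.integral_cong) (auto simp: f_def)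
    then have z: "inner (u t) \<phi> = 0" by simp
    have "((\<lambda>t. inner (u t) \<phi>) has_real_derivative inner u' \<phi>) (at t)"
      using bounded_linear.has_vector_derivative[OF bounded_linear_inner_left u']
      by (simp add: has_real_derivative_iff_has_vector_derivative)
    then have "inner u' \<phi> = 0"
    proof (rule DERIV_local_min)
      show "0 < t - \<tau>" using t by simp
      show "\<forall>y. \<bar>t - y\<bar> < t - \<tau> \<longrightarrow> inner (u t) \<phi> \<le> inner (u y) \<phi>"
        unfolding z by (intro allI impI Hplus_inner_nonneg pos \<phi>) linarith
    qed
    \<comment> \<open>Where \<open>f\<close> is nonzero it equals \<open>c\<close> times the
      derivative, so testing reproduces its square up to the sign.\<close>
    moreover have "inner u' \<phi> = c * (\<integral>x. (f x)\<^sup>2 \<partial>I01)"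
    proof -
      have cc: "c * c = 1" using abs_mult_self_eq[of c] c by simp
      have "rep_l2 u' x * f x = c * (f x)\<^sup>2" for x
      proof (cases "f x = 0")
        case False
        then have "f x = c * rep_l2 u' x" unfolding f_def by (metis max_def)
        then have "c * f x = rep_l2 u' x" using cc by (simp add: mult.assoc[symmetric])
        then show ?thesis by (simp add: power2_eq_square mult.assoc[symmetric])
      qed simp
      then show ?thesis unfolding \<phi>_def inner_abs[OF fs] by simp
    qed
    moreover have "c \<noteq> 0" using c by force
    ultimately have "(\<integral>x. (f x)\<^sup>2 \<partial>I01) = 0" by simp
    then have "AE x in I01. (f x)\<^sup>2 = 0"
      using integral_nonneg_eq_0_iff_AE[of I01 "\<lambda>x. (f x)\<^sup>2"] fs by (simp add: square_integrable_def)
    then show ?thesis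
    proof eventually_elim
      case (elim x)
      then have "f x = 0" by simp
      then show ?case unfolding f_def by (metis max.cobounded2)
    qed
  qed
  from this[of 1] this[of "-1"] have "AE x in I01. rep_l2 (u t) x = 0 \<longrightarrow> 1 * rep_l2 u' x \<le> 0"
    "AE x in I01. rep_l2 (u t) x = 0 \<longrightarrow> (- 1) * rep_l2 u' x \<le> 0" by simp_all
  then show ?thesis by eventually_elim auto
qed

definition one_l2 :: l2 where "one_l2 = abs_l2 (\<lambda>x. 1)"

lemma one_square_integrable: "square_integrable (\<lambda>x. 1)"
  by (rule continuous_square_integrable) simp

lemma rep_one: "AE x in I01. rep_l2 one_l2 x = 1"
  unfolding one_l2_def by (rule rep_abs_l2[OF one_square_integrable])

lemma rep_scale_one: "AE x in I01. rep_l2 (c *\<^sub>R one_l2) x = c"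
  using rep_scaleR[of c one_l2] rep_one by eventually_elim simp

lemma norm_one: "norm one_l2 = 1"
proof -
  have "(norm one_l2)\<^sup>2 = 1\<^sup>2" unfolding one_l2_def norm_abs_l2[OF one_square_integrable] by (simp add: space_I01)
  then show ?thesis by (subst (asm) power2_eq_iff_nonneg) auto
qed

text \<open>Where \<open>u\<close> is positive, the inclusion leaves the single value
  \<open>b t\<close>. On the zero set it allows a whole interval, but there both the time derivative
  and \<open>op_A\<close> vanish, and the equation forces the value 0.\<close>

lemma inclusion_forcing:
  assumes incl: "inclusion_ae b \<tau> u r" and b: "\<And>t. 0 < b t"
    and pos: "\<And>t. \<tau> \<le> t \<Longrightarrow> u t \<in> Hplus"
    and dom: "AE t in lborel. \<tau> < t \<longrightarrow> u t \<in> dom_A"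
    and eq: "AE t in lborel. \<tau> < t \<longrightarrow>
           (\<exists>u'. (u has_vector_derivative u') (at t) \<and> u' + op_A (u t) = r t + \<omega> t *\<^sub>R u t)"
  shows "AE t in lborel. \<tau> < t \<longrightarrow> (AE x in I01. rep_l2 (r t) x = (if rep_l2 (u t) x = 0 then 0 else b t))"
proof -
  obtain fu fr where f: "space_time_rep \<tau> u fu" "space_time_rep \<tau> r fr"
    "AE (t, x) in lborel. \<tau> < t \<and> 0 < x \<and> x < 1 \<longrightarrow> fr (t, x) \<in> (\<lambda>y. b t * y) ` H0 (fu (t, x))"
    using incl unfolding inclusion_ae_def by blast
  have "AE p in lborel \<Otimes>\<^sub>M lborel. \<tau> < fst p \<and> 0 < snd p \<and> snd p < 1 \<longrightarrow> fr p \<in> (\<lambda>y. b (fst p) * y) ` H0 (fu p)"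
    using f(3) unfolding lborel_prod by (simp add: case_prod_unfold)
  then have "AE t in lborel. AE x in lborel. \<tau> < t \<and> 0 < x \<and> x < 1 \<longrightarrow> fr (t, x) \<in> (\<lambda>y. b t * y) ` H0 (fu (t, x))"
    by (drule_tac lborel_pair.AE_pair) simp
  moreover have "AE t in lborel. \<tau> < t \<longrightarrow> (AE x in I01. rep_l2 (u t) x = fu (t, x))"
    "AE t in lborel. \<tau> < t \<longrightarrow> (AE x in I01. rep_l2 (r t) x = fr (t, x))"
    using f(1,2) by (auto simp: space_time_rep_def)
  ultimately show ?thesis using dom eq
  proof eventually_elim
    case (elim t)
    show ?case
    proof
      assume t: "\<tau> < t"
      obtain u' where u': "(u has_vector_derivative u') (at t)" "u' + op_A (u t) = r t + \<omega> t *\<^sub>R u t"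
        using elim t by blast
      have "AE x in I01. \<tau> < t \<and> 0 < x \<and> x < 1 \<longrightarrow> fr (t, x) \<in> (\<lambda>y. b t * y) ` H0 (fu (t, x))"
        using elim(1) by (subst AE_restrict_space_iff) (auto elim: eventually_mono)
      moreover have "AE x in I01. rep_l2 (u t) x = fu (t, x)" "AE x in I01. rep_l2 (r t) x = fr (t, x)"
        using elim t by auto
      moreover have "AE x in I01. rep_l2 (u t) x = 0 \<longrightarrow> rep_l2 u' x = 0"
        by (rule derivative_zero_on_zero_set[OF pos t u'(1)])
      moreover have "AE x in I01. rep_l2 (u t) x = 0 \<longrightarrow> rep_l2 (op_A (u t)) x = 0"
        using op_A_zero_on_zero_set[of "u t"] elim t pos[of t] by simp
      moreover have "AE x in I01. rep_l2 u' x + rep_l2 (op_A (u t)) x = rep_l2 (r t) x + \<omega> t * rep_l2 (u t) x"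
        using rep_add[of u' "op_A (u t)"] rep_add[of "r t" "\<omega> t *\<^sub>R u t"] rep_scaleR[of "\<omega> t" "u t"]
        unfolding u'(2) by eventually_elim simp
      moreover have "AE x in I01. 0 \<le> rep_l2 (u t) x" using pos[of t] t by (simp add: Hplus_def)
      moreover note AE_space[of I01]
      ultimately show "AE x in I01. rep_l2 (r t) x = (if rep_l2 (u t) x = 0 then 0 else b t)"
      proof eventually_elim
        case (elim x)
        show ?case
        proof (cases "rep_l2 (u t) x = 0")
          case False
          then have "0 < fu (t, x)" using elim by simp
          then show ?thesis using elim t False by (simp add: H0_def space_I01)
        qed (use elim in simp)
      qed
    qed
  qed
qed

text \<open>By positivity of the heat kernel a nonnegative solution that is once nonzero is afterwards
  positive almost everywhere, so the inclusion becomes a linear equation.\<close>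

lemma forcing_after_nonzero:
  assumes m: "modal_solution \<omega> \<tau> r u" and b: "\<And>t. 0 < b t" "\<And>t. b t \<le> b1"
    and pos: "\<And>t. \<tau> \<le> t \<Longrightarrow> u t \<in> Hplus"
    and r: "AE t in lborel. \<tau> < t \<longrightarrow> (AE x in I01. rep_l2 (r t) x = (if rep_l2 (u t) x = 0 then 0 else b t))"
    and \<omega>: "continuous_on UNIV \<omega>" "\<And>t. 0 \<le> \<omega> t"
    and s: "\<tau> \<le> s" "u s \<noteq> 0"
  shows "AE t in lborel. s < t \<longrightarrow> r t = b t *\<^sub>R one_l2"
proof -
  obtain \<Omega> where \<Omega>: "\<And>t. (\<Omega> has_real_derivative \<omega> t) (at t)" using ex_antiderivative[OF \<omega>(1)] by blast
  \<comment> \<open>The forcing is nonnegative and bounded, which the comparison principle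
    requires.\<close>
  have rH: "AE t in lborel. s < t \<longrightarrow> r t \<in> Hplus \<and> norm (r t) \<le> b1"
    using r
  proof eventually_elim
    case (elim t)
    show ?case
    proof
      assume "s < t"
      then have e: "AE x in I01. rep_l2 (r t) x = (if rep_l2 (u t) x = 0 then 0 else b t)" using elim s by simp
      let ?f = "\<lambda>x. if rep_l2 (u t) x = 0 then 0 else b t"
      have fm: "?f \<in> borel_measurable I01" by measurable
      have fb: "\<bar>?f x\<bar> \<le> b1" for x using b(1)[of t] b(2)[of t] by auto
      have fs: "square_integrable ?f" by (rule square_integrable_bounded[OF fm fb])
      have rf: "abs_l2 ?f = r t" by (rule abs_l2_eqI[OF e fs])
      have "abs_l2 ?f \<in> Hplus" by (rule HplusI[OF fs]) (use b(1)[of t] in auto)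
      moreover have "norm (abs_l2 ?f) \<le> b1"
        by (rule norm_abs_l2_le[OF fs fb]) (use b(1)[of t] b(2)[of t] in linarith)
      ultimately show "r t \<in> Hplus \<and> norm (r t) \<le> b1" by (simp add: rf)
    qed
  qed
  \<comment> \<open>The zero set of \<open>u t\<close> is tested by its own indicator: the inner
    product is 0, whereas the comparison principle would make it positive if the indicator were
    nonzero.\<close>
  have nz: "AE x in I01. rep_l2 (u t) x \<noteq> 0" if t: "s < t" for t
  proof -
    let ?f = "\<lambda>x. if rep_l2 (u t) x = 0 then 1 else 0 :: real"
    have fm: "?f \<in> borel_measurable I01" by measurable
    have fs: "square_integrable ?f" by (rule square_integrable_bounded[OF fm, of 1]) auto
    have \<phi>: "abs_l2 ?f \<in> Hplus" by (rule HplusI[OF fs]) auto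
    have "inner (u t) (abs_l2 ?f) = (\<integral>x. 0 \<partial>I01)"
      unfolding inner_abs[OF fs] by (intro Bochner_Integration.integral_cong) auto
    then have z: "inner (u t) (abs_l2 ?f) = 0" by simp
    have "exp (- \<Omega> s) * heat_form (u s) (abs_l2 ?f) (t - s) \<le> 0"
      using modal_solution_positivity[OF modal_solution_restrict[OF m s(1)] t \<phi> rH \<Omega> \<omega>] z by simp
    then have "\<not> 0 < heat_form (u s) (abs_l2 ?f) (t - s)"
      by (simp add: mult_le_0_iff not_less)
    then have "abs_l2 ?f = 0" using heat_form_pos[of "t - s" "u s" "abs_l2 ?f"] t s pos[OF s(1)] \<phi> by auto
    then have "AE x in I01. rep_l2 (abs_l2 ?f) x = 0" using rep_0 by simp
    then show ?thesis using rep_abs_l2[OF fs] by eventually_elim (auto split: if_splits)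
  qed
  show ?thesis using r
  proof eventually_elim
    case (elim t)
    show ?case
    proof
      assume t: "s < t"
      then have "AE x in I01. rep_l2 (r t) x = (if rep_l2 (u t) x = 0 then 0 else b t)" using elim s by simp
      then show "r t = b t *\<^sub>R one_l2"
        unfolding l2_eq_iff using nz[OF t] rep_scale_one[of "b t"] by eventually_elim simp
    qed
  qed
qed

section \<open>The positive solution starting from zero\<close>

text \<open>The cone is self-dual; testing with the negative part of \<open>v\<close> gives minus
  the integral of its square.\<close>

lemma Hplus_dual:
  assumes "\<And>\<phi>. \<phi> \<in> Hplus \<Longrightarrow> 0 \<le> inner v \<phi>" shows "v \<in> Hplus"
proof -
  let ?f = "\<lambda>x. max 0 (- rep_l2 v x)"
  have fm: "?f \<in> borel_measurable I01" by measurable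
  have le: "(?f x)\<^sup>2 \<le> (rep_l2 v x)\<^sup>2" for x by (auto simp: max_def)
  have fi: "integrable I01 (\<lambda>x. (?f x)\<^sup>2)"
  proof (rule Bochner_Integration.integrable_bound)
    show "integrable I01 (\<lambda>x. (rep_l2 v x)\<^sup>2)" using square_integrable_rep[of v] by (simp add: square_integrable_def)
    show "(\<lambda>x. (?f x)\<^sup>2) \<in> borel_measurable I01" by measurable
    show "AE x in I01. norm ((?f x)\<^sup>2) \<le> norm ((rep_l2 v x)\<^sup>2)" using le by (intro AE_I2) simp
  qed
  have fs: "square_integrable ?f" using fm fi by (simp add: square_integrable_def)
  have "0 \<le> inner v (abs_l2 ?f)" by (intro assms HplusI[OF fs]) simp
  also have "inner v (abs_l2 ?f) = (\<integral>x. - (?f x)\<^sup>2 \<partial>I01)"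
    unfolding inner_abs[OF fs] by (intro Bochner_Integration.integral_cong) (auto simp: max_def power2_eq_square)
  finally have "(\<integral>x. (?f x)\<^sup>2 \<partial>I01) \<le> 0" by simp
  moreover have "0 \<le> (\<integral>x. (?f x)\<^sup>2 \<partial>I01)" by (rule integral_nonneg_AE) simp
  ultimately have "AE x in I01. (?f x)\<^sup>2 = 0"
    using integral_nonneg_eq_0_iff_AE[OF fi] by simp
  then show ?thesis unfolding Hplus_def by (auto simp: max_def elim!: eventually_mono split: if_splits)
qed

text \<open>The solution of \<open>z' + A z = b + \<omega> z\<close>, \<open>z(s) = 0\<close>, as an eigenfunction series. Since the forcing
  does not depend on \<open>x\<close>, the series of time derivatives is dominated by that of the constant
  function 1.\<close>

locale forced_heat =
  fixes b \<omega> :: "real \<Rightarrow> real" and b1 \<omega>1 s :: real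
  assumes b_cont: "continuous_on UNIV b" and \<omega>_cont: "continuous_on UNIV \<omega>"
    and b_pos: "\<And>t. 0 < b t" and b_le: "\<And>t. b t \<le> b1"
    and \<omega>_nonneg: "\<And>t. 0 \<le> \<omega> t" and \<omega>_le: "\<And>t. \<omega> t \<le> \<omega>1" and \<omega>1_less: "\<omega>1 < pi\<^sup>2"
begin

definition Om :: "real \<Rightarrow> real" where
  "Om = (SOME F. \<forall>t. (F has_real_derivative \<omega> t) (at t))"

lemma Om_deriv: "(Om has_real_derivative \<omega> t) (at t)"
  using someI_ex[OF ex_antiderivative[OF \<omega>_cont]] unfolding Om_def by blast

lemma Om_cont: "continuous_on S Om"
  by (intro continuous_at_imp_continuous_on ballI DERIV_isCont[OF Om_deriv])

definition prim :: "nat \<Rightarrow> real \<Rightarrow> real" where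
  "prim k = (SOME F. (\<forall>t. (F has_real_derivative exp (lam k * t - Om t) * b t) (at t)) \<and> F s = 0)"

lemma prim: "(prim k has_real_derivative exp (lam k * t - Om t) * b t) (at t)" "prim k s = 0"
proof -
  have "continuous_on UNIV (\<lambda>t. exp (lam k * t - Om t) * b t)"
    by (intro continuous_intros Om_cont b_cont)
  then obtain F where F: "\<And>t. (F has_real_derivative exp (lam k * t - Om t) * b t) (at t)"
    using ex_antiderivative by blast
  have "\<exists>F. (\<forall>t. (F has_real_derivative exp (lam k * t - Om t) * b t) (at t)) \<and> F s = 0"
  proof (intro exI[of _ "\<lambda>t. F t - F s"] conjI allI)
    show "((\<lambda>t. F t - F s) has_real_derivative exp (lam k * t - Om t) * b t) (at t)" for t
      using DERIV_diff[OF F DERIV_const] by simp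
  qed simp
  from someI_ex[OF this] show "(prim k has_real_derivative exp (lam k * t - Om t) * b t) (at t)" "prim k s = 0"
    unfolding prim_def by blast+
qed

text \<open>The time factor of the \<open>k\<close>-th coefficient of \<open>z\<close>, solving
  \<open>m' = b - (lam k - \<omega>) * m\<close> with \<open>m s = 0\<close>. The coefficient of the
  constant function 1 is split off, so that the bounds below hold uniformly in
  \<open>k\<close>.\<close>

definition mode :: "nat \<Rightarrow> real \<Rightarrow> real" where
  "mode k t = exp (- (lam k * t - Om t)) * prim k t"

definition dmode :: "nat \<Rightarrow> real \<Rightarrow> real" where
  "dmode k t = b t - (lam k - \<omega> t) * mode k t"

lemma mode_s: "mode k s = 0" by (simp add: mode_def prim(2))

lemma mode_deriv: "(mode k has_real_derivative dmode k t) (at t)"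
proof -
  have "((\<lambda>t. exp (- (lam k * t - Om t))) has_real_derivative exp (- (lam k * t - Om t)) * - (lam k * 1 - \<omega> t)) (at t)"
    by (intro DERIV_chain2[OF DERIV_exp] DERIV_minus DERIV_diff DERIV_cmult DERIV_ident Om_deriv)
  note D = DERIV_mult[OF this prim(1)[of k t]]
  have e: "exp (- (lam k * t - Om t)) * (exp (lam k * t - Om t) * b t) = b t"
    by (simp add: mult.assoc[symmetric] mult_exp_exp)
  show ?thesis
    unfolding mode_def[abs_def]
    by (rule DERIV_cong[OF D]) (use e in \<open>simp add: dmode_def mode_def algebra_simps\<close>)
qed

lemma mode_cont: "continuous_on S (mode k)"
  by (intro continuous_at_imp_continuous_on ballI DERIV_isCont[OF mode_deriv])

lemma \<omega>1_nonneg: "0 \<le> \<omega>1" using \<omega>_nonneg[of 0] \<omega>_le[of 0] by linarith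

lemma b1_pos: "0 < b1" using b_pos[of 0] b_le[of 0] by linarith

lemma mode_bounds:
  assumes "s \<le> t" shows "0 \<le> mode k t" "(lam k - \<omega>1) * mode k t \<le> b1"
proof -
  have g: "0 < lam k - \<omega>1" using lam_ge[of k] \<omega>1_less by linarith
  have "prim k s \<le> prim k t"
    by (rule DERIV_nonneg_imp_nondecreasing[OF assms]) (use prim(1) b_pos in \<open>fastforce intro: less_imp_le\<close>)
  then show "0 \<le> mode k t" by (simp add: mode_def prim(2))
  \<comment> \<open>The constant \<open>b1 / (lam k - \<omega>1)\<close> is a supersolution.
    Multiplied by the integrating factor, the gap between it and the mode is nondecreasing, and at
    time \<open>s\<close> it is nonnegative.\<close>
  let ?F = "\<lambda>t. exp (lam k * t - Om t) * b1 - (lam k - \<omega>1) * prim k t"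
  have "?F s \<le> ?F t"
  proof (rule DERIV_nonneg_imp_nondecreasing[OF assms])
    fix x assume "s \<le> x" "x \<le> t"
    let ?d = "exp (lam k * x - Om x) * (lam k * 1 - \<omega> x) * b1 - (lam k - \<omega>1) * (exp (lam k * x - Om x) * b x)"
    have "(?F has_real_derivative ?d) (at x)"
      by (intro DERIV_diff DERIV_cmult DERIV_cmult_right DERIV_chain2[OF DERIV_exp] DERIV_ident Om_deriv prim(1))
    moreover have "0 \<le> ?d"
    proof -
      have "(lam k - \<omega>1) * b x \<le> (lam k - \<omega> x) * b1"
        using g \<omega>_le[of x] b_le[of x] b_pos[of x] by (intro mult_mono) auto
      then have "exp (lam k * x - Om x) * ((lam k - \<omega>1) * b x) \<le> exp (lam k * x - Om x) * ((lam k - \<omega> x) * b1)"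
        by (intro mult_left_mono) auto
      then show ?thesis by (simp add: mult_ac)
    qed
    ultimately show "\<exists>y. (?F has_real_derivative y) (at x) \<and> 0 \<le> y" by blast
  qed
  moreover have "0 \<le> ?F s" using b1_pos by (simp add: prim(2))
  ultimately have "0 \<le> exp (- (lam k * t - Om t)) * ?F t" by (intro mult_nonneg_nonneg) auto
  also have "\<dots> = b1 - (lam k - \<omega>1) * mode k t"
    by (simp add: mode_def right_diff_distrib mult.assoc[symmetric] mult_exp_exp) (simp add: algebra_simps)
  finally show "(lam k - \<omega>1) * mode k t \<le> b1" by simp
qed

text \<open>Bounds all \<open>dmode k\<close>: \<open>b1\<close> for the forcing, and for
  \<open>lam k * mode k\<close> the bound of the mode with
  \<open>lam k / (lam k - \<omega>1)\<close> estimated by its value at the first eigenvalue.\<close>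

definition Cd :: real where "Cd = b1 + b1 * pi\<^sup>2 / (pi\<^sup>2 - \<omega>1)"

lemma Cd_pos: "0 < Cd"
  using b1_pos \<omega>1_less by (simp add: Cd_def add_pos_pos)

lemma dmode_bound:
  assumes "s \<le> t" shows "\<bar>dmode k t\<bar> \<le> Cd"
proof -
  note m = mode_bounds[OF assms, of k]
  have d: "0 < pi\<^sup>2 - \<omega>1" using \<omega>1_less by simp
  have "\<omega>1 * pi\<^sup>2 \<le> \<omega>1 * lam k" using lam_ge \<omega>1_nonneg by (intro mult_left_mono)
  then have "lam k * (pi\<^sup>2 - \<omega>1) \<le> pi\<^sup>2 * (lam k - \<omega>1)" by (simp add: algebra_simps)
  then have "lam k * (pi\<^sup>2 - \<omega>1) * mode k t \<le> pi\<^sup>2 * (lam k - \<omega>1) * mode k t"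
    using m(1) by (rule mult_right_mono)
  also have "\<dots> \<le> pi\<^sup>2 * b1" unfolding mult.assoc using m(2) by (intro mult_left_mono) auto
  finally have "lam k * mode k t \<le> b1 * pi\<^sup>2 / (pi\<^sup>2 - \<omega>1)"
    using d by (simp add: pos_le_divide_eq mult_ac)
  moreover have "(lam k - \<omega> t) * mode k t \<le> lam k * mode k t"
    using \<omega>_nonneg[of t] m(1) by (intro mult_right_mono) auto
  moreover have "0 \<le> (lam k - \<omega> t) * mode k t"
    using lam_ge[of k] \<omega>_le[of t] \<omega>1_less m(1) by (intro mult_nonneg_nonneg) auto
  moreover have "0 \<le> b1 * pi\<^sup>2 / (pi\<^sup>2 - \<omega>1)" using d b1_pos by simp
  ultimately show ?thesis unfolding dmode_def Cd_def using b_pos[of t] b_le[of t] by linarith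
qed

definition beta :: "nat \<Rightarrow> real" where "beta k = inner one_l2 (ek k)"

text \<open>Comes from \<open>lam k - \<omega>1\<close> being at least
  \<open>(real (Suc k))\<^sup>2 * (pi\<^sup>2 - \<omega>1)\<close>.\<close>

definition Cm :: real where "Cm = b1 / (pi\<^sup>2 - \<omega>1)"

lemma mode_le:
  assumes "s \<le> t" shows "mode k t \<le> Cm / (real (Suc k))\<^sup>2"
proof -
  let ?n = "(real (Suc k))\<^sup>2"
  have d: "0 < pi\<^sup>2 - \<omega>1" using \<omega>1_less by simp
  have n: "1 \<le> ?n" by (intro one_le_power) auto
  have "\<omega>1 * 1 \<le> \<omega>1 * ?n" using n \<omega>1_nonneg by (intro mult_left_mono)
  then have "?n * (pi\<^sup>2 - \<omega>1) \<le> lam k - \<omega>1"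
    by (simp add: lam_def power_mult_distrib algebra_simps del: of_nat_Suc)
  then have "?n * (pi\<^sup>2 - \<omega>1) * mode k t \<le> (lam k - \<omega>1) * mode k t"
    using mode_bounds(1)[OF assms] by (intro mult_right_mono)
  also have "\<dots> \<le> b1" by (rule mode_bounds(2)[OF assms])
  finally have "mode k t * ?n \<le> Cm" unfolding Cm_def using d by (simp add: pos_le_divide_eq mult_ac)
  then show ?thesis using n by (simp add: pos_le_divide_eq del: of_nat_Suc)
qed

lemma beta_summable: "summable (\<lambda>k. (beta k)\<^sup>2)"
  unfolding beta_def by (rule bessel)

text \<open>Absolute summability makes the eigenfunction series converge uniformly in space; its
  pointwise sum will serve as the jointly measurable representative of \<open>z\<close>.\<close>

lemma coeff_abs_summable:
  assumes "s \<le> t" shows "summable (\<lambda>k. \<bar>beta k * mode k t\<bar>)"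
proof (rule summable_comparison_test')
  have "summable (\<lambda>k. inverse (real (Suc k) ^ 2))"
    using inverse_power_summable[of 2, where 'a = real] by (subst summable_Suc_iff) simp
  then have "summable (\<lambda>k. Cm\<^sup>2 * inverse (real (Suc k) ^ 2))" by (rule summable_mult)
  then show "summable (\<lambda>k. (beta k)\<^sup>2 + Cm\<^sup>2 * inverse (real (Suc k) ^ 2))"
    by (intro summable_add beta_summable)
  fix k
  have n: "1 \<le> (real (Suc k))\<^sup>2" by (intro one_le_power) auto
  have "(mode k t)\<^sup>2 \<le> (Cm / (real (Suc k))\<^sup>2)\<^sup>2"
    using mode_le[OF assms, of k] mode_bounds(1)[OF assms, of k] by (intro power_mono)
  also have "\<dots> = Cm\<^sup>2 * inverse ((real (Suc k))\<^sup>2) * inverse ((real (Suc k))\<^sup>2)"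
    by (simp add: power_divide divide_inverse power2_eq_square del: of_nat_Suc)
  also have "\<dots> \<le> Cm\<^sup>2 * inverse ((real (Suc k))\<^sup>2) * 1"
    using n by (intro mult_left_mono) (auto simp: inverse_le_1_iff simp del: of_nat_Suc)
  finally have a: "(mode k t)\<^sup>2 \<le> Cm\<^sup>2 * inverse ((real (Suc k))\<^sup>2)" by simp
  have "2 * (\<bar>beta k\<bar> * \<bar>mode k t\<bar>) \<le> (beta k)\<^sup>2 + (mode k t)\<^sup>2"
    using sum_squares_bound[of "\<bar>beta k\<bar>" "\<bar>mode k t\<bar>"] by (simp add: mult.assoc)
  moreover have "0 \<le> \<bar>beta k\<bar> * \<bar>mode k t\<bar>" by simp
  ultimately show "norm \<bar>beta k * mode k t\<bar> \<le> (beta k)\<^sup>2 + Cm\<^sup>2 * inverse (real (Suc k) ^ 2)"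
    unfolding real_norm_def abs_abs abs_mult using a by linarith
qed

lemma coeff_square_summable:
  assumes "s \<le> t" shows "summable (\<lambda>k. (beta k * mode k t)\<^sup>2)"
proof (rule summable_comparison_test'[OF summable_mult[OF beta_summable, of "Cm\<^sup>2"]])
  fix k
  have c0: "0 \<le> Cm" using b1_pos \<omega>1_less by (simp add: Cm_def)
  have n: "1 \<le> (real (Suc k))\<^sup>2" by (intro one_le_power) auto
  have "Cm / (real (Suc k))\<^sup>2 \<le> Cm / 1" using n c0 by (intro divide_left_mono) auto
  then have "(mode k t)\<^sup>2 \<le> Cm\<^sup>2"
    using mode_le[OF assms, of k] mode_bounds(1)[OF assms, of k] by (intro power_mono) auto
  then show "norm ((beta k * mode k t)\<^sup>2) \<le> Cm\<^sup>2 * (beta k)\<^sup>2"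
    by (simp add: power_mult_distrib mult.commute mult_right_mono mult_left_mono)
qed

text \<open>The case distinction matters: the \<open>mode k\<close> continue backwards beyond
  \<open>s\<close>, where they do not vanish.\<close>

definition z :: "real \<Rightarrow> l2" where
  "z t = (if t \<le> s then 0 else \<Sum>k. (beta k * mode k t) *\<^sub>R ek k)"

definition dz :: "real \<Rightarrow> l2" where "dz t = (\<Sum>k. (beta k * dmode k t) *\<^sub>R ek k)"

lemma z_before: "t \<le> s \<Longrightarrow> z t = 0" by (simp add: z_def)

lemma z_sums: "s \<le> t \<Longrightarrow> (\<lambda>k. (beta k * mode k t) *\<^sub>R ek k) sums z t"
  using summable_sums[OF ek_series_summable[OF coeff_square_summable]]
  by (cases "t = s") (auto simp: z_def mode_s)

lemma z_coeff: "s \<le> t \<Longrightarrow> inner (z t) (ek k) = beta k * mode k t"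
  by (rule ek_series_coeff[OF z_sums])

lemma dz_sums: assumes "s \<le> t" shows "(\<lambda>k. (beta k * dmode k t) *\<^sub>R ek k) sums dz t"
  unfolding dz_def
proof (intro summable_sums ek_series_summable)
  show "summable (\<lambda>k. (beta k * dmode k t)\<^sup>2)"
  proof (rule summable_comparison_test'[OF summable_mult[OF beta_summable, of "Cd\<^sup>2"]])
    fix k
    have "(dmode k t)\<^sup>2 \<le> Cd\<^sup>2" using power_mono[OF dmode_bound[OF assms, of k], of 2] by simp
    then show "norm ((beta k * dmode k t)\<^sup>2) \<le> Cd\<^sup>2 * (beta k)\<^sup>2"
      by (simp add: power_mult_distrib mult.commute mult_right_mono mult_left_mono)
  qed
qed

lemma dz_coeff: "s \<le> t \<Longrightarrow> inner (dz t) (ek k) = beta k * dmode k t"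
  by (rule ek_series_coeff[OF dz_sums])

text \<open>The mean value theorem in each mode with the common bound \<open>Cd\<close>; Parseval's
  identity then leaves the norm of the constant function 1.\<close>

lemma z_lipschitz_after:
  assumes "s \<le> l" "l \<le> r" shows "norm (z r - z l) \<le> Cd * (r - l)"
proof (rule power2_le_imp_le)
  have "(inner (z r - z l) (ek k))\<^sup>2 \<le> (Cd * (r - l))\<^sup>2 * (inner one_l2 (ek k))\<^sup>2" for k
  proof -
    have "\<bar>mode k r - mode k l\<bar> \<le> Cd * (r - l)"
    proof (cases "l = r")
      case False
      with assms have "l < r" by simp
      from MVT2[OF this mode_deriv] obtain y where y: "l < y" "y < r" "mode k r - mode k l = (r - l) * dmode k y" by blast
      have "\<bar>dmode k y\<bar> \<le> Cd" using y assms by (intro dmode_bound) simp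
      then show ?thesis using y(3) assms by (simp add: abs_mult mult.commute mult_right_mono mult_left_mono)
    qed simp
    then have "(mode k r - mode k l)\<^sup>2 \<le> (Cd * (r - l))\<^sup>2"
      using power_mono[of "\<bar>mode k r - mode k l\<bar>" "Cd * (r - l)" 2] by simp
    moreover have "inner (z r - z l) (ek k) = (mode k r - mode k l) * beta k"
      using assms by (simp add: inner_diff_left z_coeff algebra_simps)
    ultimately show ?thesis by (simp add: power_mult_distrib beta_def mult_right_mono mult_left_mono)
  qed
  then have "(norm (z r - z l))\<^sup>2 \<le> (Cd * (r - l))\<^sup>2 * (norm one_l2)\<^sup>2"
    by (rule sums_le[OF _ parseval_norm sums_mult[OF parseval_norm]])
  then show "(norm (z r - z l))\<^sup>2 \<le> (Cd * (r - l))\<^sup>2" by (simp add: norm_one)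
  show "0 \<le> Cd * (r - l)" using Cd_pos assms by simp
qed

lemma z_lipschitz:
  assumes "l \<le> r" shows "norm (z r - z l) \<le> Cd * (r - l)"
proof -
  consider "r \<le> s" | "l \<le> s" "s \<le> r" | "s \<le> l" using assms by linarith
  then show ?thesis
  proof cases
    case 1
    then show ?thesis using assms Cd_pos by (simp add: z_before)
  next
    case 2
    then have "norm (z r - z s) \<le> Cd * (r - s)" by (intro z_lipschitz_after) auto
    also have "\<dots> \<le> Cd * (r - l)" using 2 Cd_pos by (intro mult_left_mono) auto
    finally show ?thesis using 2 by (simp add: z_before)
  qed (intro z_lipschitz_after assms)
qed

lemma z_continuous: "continuous_on S z"
proof (rule continuous_at_imp_continuous_on, intro ballI)
  fix t
  have "norm (z y - z t) \<le> Cd * \<bar>y - t\<bar>" for y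
    using z_lipschitz[of t y] z_lipschitz[of y t] by (cases "t \<le> y") (auto simp: norm_minus_commute abs_if)
  moreover have "((\<lambda>y. Cd * \<bar>y - t\<bar>) \<longlongrightarrow> Cd * \<bar>t - t\<bar>) (at t)" by (intro tendsto_intros)
  ultimately have "((\<lambda>y. z y - z t) \<longlongrightarrow> 0) (at t)"
    by (intro Lim_null_comparison[of "\<lambda>y. z y - z t" "\<lambda>y. Cd * \<bar>y - t\<bar>"]) (auto intro: always_eventually)
  then show "isCont z t" unfolding isCont_def by (simp add: LIM_zero_iff)
qed

lemma z_abs_continuous: "abs_continuous_on T1 T2 z"
  by (rule lipschitz_abs_continuous_on[OF z_lipschitz])

text \<open>Termwise differentiation is justified because the remainders of the series of
  derivatives are bounded by \<open>Cd\<close> times the remainder for the constant function,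
  uniformly in time.\<close>

lemma z_deriv:
  assumes "s < t" shows "(z has_vector_derivative dz t) (at t)"
proof -
  let ?f = "\<lambda>k t. (beta k * mode k t) *\<^sub>R ek k"
  let ?f' = "\<lambda>k t h. h *\<^sub>R ((beta k * dmode k t) *\<^sub>R ek k)"
  have "\<exists>g. \<forall>x\<in>{s<..}. (\<lambda>n. ?f n x) sums (g x) \<and> (g has_derivative (\<lambda>h. h *\<^sub>R dz x)) (at x within {s<..})"
  proof (rule has_derivative_series[where f' = ?f'])
    show "convex {s<..}" by simp
    show "(?f k has_derivative ?f' k x) (at x within {s<..})" for k x
    proof -
      have "((\<lambda>t. beta k * mode k t) has_real_derivative beta k * dmode k x) (at x within {s<..})"
        by (intro DERIV_cmult has_field_derivative_at_within[OF mode_deriv])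
      then have "((\<lambda>t. beta k * mode k t) has_vector_derivative beta k * dmode k x) (at x within {s<..})"
        by (simp add: has_real_derivative_iff_has_vector_derivative)
      from bounded_linear.has_vector_derivative[OF bounded_linear_scaleR_left this, of "ek k"]
      show ?thesis by (simp add: has_vector_derivative_def)
    qed
    show "t \<in> {s<..}" "(\<lambda>n. ?f n t) sums z t" using assms z_sums by auto
    fix e :: real assume e: "0 < e"
    have "(\<lambda>n. Cd\<^sup>2 * (\<Sum>k. (beta (k + n))\<^sup>2)) \<longlonglongrightarrow> Cd\<^sup>2 * 0"
      by (intro tendsto_mult tendsto_const suminf_exist_split2[OF beta_summable])
    then have "eventually (\<lambda>n. Cd\<^sup>2 * (\<Sum>k. (beta (k + n))\<^sup>2) < e\<^sup>2) sequentially"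
      by (rule order_tendstoD(2)) (use e in simp)
    then show "\<forall>\<^sub>F n in sequentially. \<forall>x\<in>{s<..}. \<forall>h. norm (sum (\<lambda>i. ?f' i x h) {..<n} - h *\<^sub>R dz x) \<le> e * norm h"
    proof eventually_elim
      case (elim n)
      show ?case
      proof (intro ballI allI)
        fix x h assume "x \<in> {s<..}"
        then have x: "s \<le> x" by simp
        let ?S = "\<Sum>i<n. (beta i * dmode i x) *\<^sub>R ek i"
        \<comment> \<open>Subtracting the partial sum removes exactly the first \<open>n\<close>
          coefficients.\<close>
        have co: "inner (dz x - ?S) (ek k) = (if k < n then 0 else beta k * dmode k x)" for k
          unfolding inner_diff_left dz_coeff[OF x] inner_sum_left
          by (simp add: inner_ek_ek if_distrib cong: if_cong)
        have "(norm (dz x - ?S))\<^sup>2 = (\<Sum>k. (inner (dz x - ?S) (ek k))\<^sup>2)"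
          by (rule sums_unique[OF parseval_norm])
        also have "\<dots> = (\<Sum>k. (inner (dz x - ?S) (ek (k + n)))\<^sup>2) + (\<Sum>k<n. (inner (dz x - ?S) (ek k))\<^sup>2)"
          by (rule suminf_split_initial_segment[OF bessel])
        also have "(\<Sum>k<n. (inner (dz x - ?S) (ek k))\<^sup>2) = 0" by (simp add: co)
        also have "(\<Sum>k. (inner (dz x - ?S) (ek (k + n)))\<^sup>2) \<le> (\<Sum>k. Cd\<^sup>2 * (beta (k + n))\<^sup>2)"
        proof (rule suminf_le)
          fix k
          have "(dmode (k + n) x)\<^sup>2 \<le> Cd\<^sup>2" using power_mono[OF dmode_bound[OF x, of "k + n"], of 2] by simp
          then have "(beta (k + n))\<^sup>2 * (dmode (k + n) x)\<^sup>2 \<le> (beta (k + n))\<^sup>2 * Cd\<^sup>2"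
            by (rule mult_left_mono) simp
          then show "(inner (dz x - ?S) (ek (k + n)))\<^sup>2 \<le> Cd\<^sup>2 * (beta (k + n))\<^sup>2"
            unfolding co by (simp add: power_mult_distrib mult.commute)
        next
          show "summable (\<lambda>k. (inner (dz x - ?S) (ek (k + n)))\<^sup>2)"
            by (rule summable_ignore_initial_segment[OF bessel])
          show "summable (\<lambda>k. Cd\<^sup>2 * (beta (k + n))\<^sup>2)"
            by (intro summable_mult summable_ignore_initial_segment[OF beta_summable])
        qed
        also have "(\<Sum>k. Cd\<^sup>2 * (beta (k + n))\<^sup>2) = Cd\<^sup>2 * (\<Sum>k. (beta (k + n))\<^sup>2)"
          by (intro suminf_mult summable_ignore_initial_segment[OF beta_summable])
        finally have "(norm (dz x - ?S))\<^sup>2 \<le> e\<^sup>2" using elim by simp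
        then have n: "norm (dz x - ?S) \<le> e" by (rule power2_le_imp_le) (use e in simp)
        have "sum (\<lambda>i. ?f' i x h) {..<n} - h *\<^sub>R dz x = - (h *\<^sub>R (dz x - ?S))"
          by (simp add: scaleR_sum_right scaleR_diff_right)
        then have "norm (sum (\<lambda>i. ?f' i x h) {..<n} - h *\<^sub>R dz x) = \<bar>h\<bar> * norm (dz x - ?S)" by simp
        then show "norm (sum (\<lambda>i. ?f' i x h) {..<n} - h *\<^sub>R dz x) \<le> e * norm h"
          using mult_left_mono[OF n, of "\<bar>h\<bar>"] by (simp add: mult.commute)
      qed
    qed
  qed
  then obtain g where g: "\<And>x. s < x \<Longrightarrow> (\<lambda>n. ?f n x) sums (g x)"
    "\<And>x. s < x \<Longrightarrow> (g has_derivative (\<lambda>h. h *\<^sub>R dz x)) (at x within {s<..})" by force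
  have gz: "g x = z x" if "s < x" for x
    using sums_unique2[OF g(1)[OF that] z_sums[OF less_imp_le[OF that]]] .
  have "(g has_vector_derivative dz t) (at t)"
    using g(2)[OF assms] assms unfolding has_vector_derivative_def
    by (simp add: at_within_open[of t "{s<..}"])
  then show ?thesis
    by (rule has_vector_derivative_transform_within_open[where S = "{s<..}"]) (use assms gz in auto)
qed

text \<open>By the modal equations the right-hand side inside \<open>green_op\<close> has the
  coefficients of \<open>z t\<close> times \<open>lam k\<close>. As a Green image,
  \<open>z t\<close> lies in the domain of the operator.\<close>

lemma z_eq_green_op: assumes "s < t" shows "z t = green_op (b t *\<^sub>R one_l2 + \<omega> t *\<^sub>R z t - dz t)"
proof (rule ek_eqI)
  fix k
  have "inner (b t *\<^sub>R one_l2 + \<omega> t *\<^sub>R z t - dz t) (ek k) = lam k * inner (z t) (ek k)"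
    using assms by (simp add: inner_add_left inner_diff_left z_coeff dz_coeff dmode_def beta_def[symmetric] algebra_simps)
  then have "lam k * inner (green_op (b t *\<^sub>R one_l2 + \<omega> t *\<^sub>R z t - dz t)) (ek k) = lam k * inner (z t) (ek k)"
    using green_op_coeff by simp
  then show "inner (z t) (ek k) = inner (green_op (b t *\<^sub>R one_l2 + \<omega> t *\<^sub>R z t - dz t)) (ek k)"
    using lam_pos[of k] by simp
qed

lemma z_dom_A: assumes "s < t" shows "z t \<in> dom_A" "dz t + op_A (z t) = b t *\<^sub>R one_l2 + \<omega> t *\<^sub>R z t"
proof -
  let ?g = "b t *\<^sub>R one_l2 + \<omega> t *\<^sub>R z t - dz t"
  show "z t \<in> dom_A" using green_op_dom_A(1)[of ?g] z_eq_green_op[OF assms] by simp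
  have "op_A (z t) = ?g" using green_op_dom_A(2)[of ?g] z_eq_green_op[OF assms] by simp
  then show "dz t + op_A (z t) = b t *\<^sub>R one_l2 + \<omega> t *\<^sub>R z t" by simp
qed

lemma z_modal: "modal_solution \<omega> s (\<lambda>t. b t *\<^sub>R one_l2) z"
  unfolding modal_solution_def
proof (intro conjI allI impI z_continuous z_abs_continuous AE_I2)
  fix k t assume t: "s < t"
  have "((\<lambda>t. inner (z t) (ek k)) has_vector_derivative inner (dz t) (ek k)) (at t)"
    by (rule bounded_linear.has_vector_derivative[OF bounded_linear_inner_left z_deriv[OF t]])
  then show "((\<lambda>t. inner (z t) (ek k)) has_real_derivative
        inner (b t *\<^sub>R one_l2) (ek k) - (lam k - \<omega> t) * inner (z t) (ek k)) (at t)"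
    using t by (simp add: has_real_derivative_iff_has_vector_derivative dz_coeff z_coeff dmode_def beta_def[symmetric] algebra_simps)
qed

text \<open>The comparison principle with initial value 0 makes all inner products with the cone
  nonnegative.\<close>

lemma z_nonneg: "z t \<in> Hplus"
proof (cases "t \<le> s")
  case True
  then show ?thesis using rep_0 by (simp add: z_before Hplus_def) (auto elim!: eventually_mono)
next
  case False
  then have t: "s < t" by simp
  have r: "AE t in lborel. s < t \<longrightarrow> b t *\<^sub>R one_l2 \<in> Hplus \<and> norm (b t *\<^sub>R one_l2) \<le> b1"
  proof (intro AE_I2 impI conjI)
    fix t
    show "b t *\<^sub>R one_l2 \<in> Hplus" unfolding Hplus_def mem_Collect_eq
      using rep_scale_one[of "b t"] by eventually_elim (use b_pos[of t] in simp)
    show "norm (b t *\<^sub>R one_l2) \<le> b1" using b_pos[of t] b_le[of t] by (simp add: norm_one)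
  qed
  show ?thesis
  proof (rule Hplus_dual)
    fix \<phi> assume "\<phi> \<in> Hplus"
    from modal_solution_positivity[OF z_modal t this r Om_deriv \<omega>_cont \<omega>_nonneg]
    have "exp (- Om s) * heat_form (z s) \<phi> (t - s) \<le> exp (- Om t) * inner (z t) \<phi>" .
    then have "0 \<le> exp (- Om t) * inner (z t) \<phi>" by (simp add: z_before heat_form_def)
    then show "0 \<le> inner (z t) \<phi>" by (simp add: zero_le_mult_iff)
  qed
qed

end

text \<open>Absolute summability gives uniform convergence, hence convergence in the norm as well,
  and the two limits must agree.\<close>

lemma rep_ek_series:
  assumes v: "(\<lambda>k. a k *\<^sub>R ek k) sums v" and a: "summable (\<lambda>k. \<bar>a k\<bar>)"
  shows "AE x in I01. rep_l2 v x = (\<Sum>k. a k * esin k x)"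
proof -
  define S where "S x = (\<Sum>k. a k * esin k x)" for x
  have le: "\<bar>a k * esin k x\<bar> \<le> \<bar>a k\<bar> * sqrt 2" for k x
    unfolding abs_mult by (intro mult_left_mono esin_bound) simp
  have sa: "summable (\<lambda>k. \<bar>a k\<bar> * sqrt 2)" using a by (rule summable_mult2)
  have ss: "summable (\<lambda>k. a k * esin k x)" for x
    by (rule summable_comparison_test'[OF sa]) (use le in simp)
  have Sm: "S \<in> borel_measurable I01"
    unfolding S_def by (intro borel_measurable_suminf measurable_I01 borel_measurable_continuous_onI continuous_intros esin_continuous)
  define P where "P n x = (\<Sum>k<n. a k * esin k x)" for n x
  have Ps: "square_integrable (P n)" for n
    unfolding P_def by (intro continuous_square_integrable continuous_intros esin_continuous)
  have diff: "\<bar>S x - P n x\<bar> \<le> (\<Sum>k. \<bar>a (k + n)\<bar> * sqrt 2)" for x n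
  proof -
    have sn: "summable (\<lambda>k. \<bar>a (k + n) * esin (k + n) x\<bar>)"
      by (rule summable_comparison_test'[OF summable_ignore_initial_segment[OF sa, of n]]) (use le in simp)
    have "S x - P n x = (\<Sum>k. a (k + n) * esin (k + n) x)"
      unfolding S_def P_def using suminf_split_initial_segment[OF ss, of x n] by simp
    also have "\<bar>\<dots>\<bar> \<le> (\<Sum>k. \<bar>a (k + n) * esin (k + n) x\<bar>)" by (rule summable_rabs[OF sn])
    also have "\<dots> \<le> (\<Sum>k. \<bar>a (k + n)\<bar> * sqrt 2)"
      by (rule suminf_le[OF le sn summable_ignore_initial_segment[OF sa]])
    finally show ?thesis .
  qed
  have "\<bar>S x\<bar> \<le> (\<Sum>k. \<bar>a k\<bar> * sqrt 2)" for x using diff[of x 0] by (simp add: P_def)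
  then have Ss: "square_integrable S" by (intro square_integrable_bounded[OF Sm]) auto
  have "(\<lambda>n. abs_l2 (P n)) \<longlonglongrightarrow> abs_l2 S"
  proof (rule LIM_zero_cancel, rule Lim_null_comparison)
    show "(\<lambda>n. \<Sum>k. \<bar>a (k + n)\<bar> * sqrt 2) \<longlonglongrightarrow> 0" by (rule suminf_exist_split2[OF sa])
    have "norm (abs_l2 (P n) - abs_l2 S) \<le> (\<Sum>k. \<bar>a (k + n)\<bar> * sqrt 2)" for n
    proof -
      have "norm (abs_l2 (\<lambda>x. S x - P n x)) \<le> (\<Sum>k. \<bar>a (k + n)\<bar> * sqrt 2)"
        by (rule norm_abs_l2_le[OF square_integrable_diff[OF Ss Ps] diff])
           (intro suminf_nonneg summable_ignore_initial_segment[OF sa], simp)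
      then show ?thesis using abs_l2_diff[OF Ss Ps, of n] by (simp add: norm_minus_commute)
    qed
    then show "\<forall>\<^sub>F n in sequentially. norm (abs_l2 (P n) - abs_l2 S) \<le> (\<Sum>k. \<bar>a (k + n)\<bar> * sqrt 2)"
      by simp
  qed
  moreover have "abs_l2 (P n) = (\<Sum>k<n. a k *\<^sub>R ek k)" for n
  proof -
    have "abs_l2 (P n) = (\<Sum>k<n. abs_l2 (\<lambda>x. a k * esin k x))"
      unfolding P_def by (rule abs_l2_sum) (intro square_integrable_scale esin_square_integrable)
    then show ?thesis by (simp add: abs_l2_scale ek_def)
  qed
  ultimately have "abs_l2 S = v" using v LIMSEQ_unique unfolding sums_def by auto
  then show ?thesis using rep_abs_l2[OF Ss] by (simp add: S_def)
qed

lemma zero_in_Hplus: "0 \<in> Hplus"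
  unfolding Hplus_def mem_Collect_eq using rep_0 by eventually_elim simp

lemma zero_dom_A: "0 \<in> dom_A" "op_A 0 = 0"
proof -
  have "green_op 0 = 0" using green_op_coeff[of _ 0] lam_pos by (intro ek_total) (auto simp: less_le)
  then show "0 \<in> dom_A" "op_A 0 = 0" using green_op_dom_A[of 0] by simp_all
qed

section \<open>The extended \<open>z\<close> as a strong solution from every earlier time\<close>

context forced_heat
begin

text \<open>Before \<open>s\<close> the solution rests at zero, which the inclusion permits because
  0 belongs to \<open>H0 0\<close>.\<close>

definition force :: "real \<Rightarrow> real" where "force t = (if t \<le> s then 0 else b t)"

lemma force_measurable [measurable]: "force \<in> borel_measurable borel"
proof -
  have [measurable]: "b \<in> borel_measurable borel" by (rule borel_measurable_continuous_onI[OF b_cont])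
  show ?thesis unfolding force_def[abs_def] by measurable
qed

lemma force_bounds: "0 \<le> force t" "force t \<le> b1"
  using b_pos[of t] b_le[of t] by (auto simp: force_def)

lemma force_L2_loc: "L2_loc \<tau> (\<lambda>t. force t *\<^sub>R one_l2)"
  unfolding L2_loc_def
proof (intro conjI allI impI)
  have "(\<lambda>c::real. c *\<^sub>R one_l2) \<in> borel_measurable borel"
    by (intro borel_measurable_continuous_onI continuous_intros)
  moreover have "(\<lambda>t. indicator {\<tau>..} t * force t) \<in> borel_measurable lborel"
    using force_measurable by (intro borel_measurable_times) auto
  ultimately have "(\<lambda>t. (indicator {\<tau>..} t * force t) *\<^sub>R one_l2) \<in> borel_measurable lborel"
    by (rule measurable_compose[rotated])
  then show "set_borel_measurable lborel {\<tau>..} (\<lambda>t. force t *\<^sub>R one_l2)"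
    by (simp add: set_borel_measurable_def)
  fix T assume "\<tau> < T"
  have "integrable lborel (\<lambda>t. indicator {\<tau>..T} t * b1\<^sup>2)"
    using \<open>\<tau> < T\<close> by (intro integrable_mult_left integrable_real_indicator) auto
  then have "integrable lborel (\<lambda>t. indicator {\<tau>..T} t * (force t)\<^sup>2)"
  proof (rule Bochner_Integration.integrable_bound)
    show "(\<lambda>t. indicator {\<tau>..T} t * (force t)\<^sup>2) \<in> borel_measurable lborel"
      using force_measurable by (intro borel_measurable_times borel_measurable_power) auto
    show "AE t in lborel. norm (indicator {\<tau>..T} t * (force t)\<^sup>2) \<le> norm (indicator {\<tau>..T} t * b1\<^sup>2)"
      using force_bounds by (intro AE_I2) (auto simp: indicator_def intro: power_mono)
  qed
  then show "set_integrable lborel {\<tau>..T} (\<lambda>t. (norm (force t *\<^sub>R one_l2))\<^sup>2)"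
    by (simp add: set_integrable_def norm_one)
qed

lemma z_inclusion: "inclusion_ae b \<tau> z (\<lambda>t. force t *\<^sub>R one_l2)"
proof -
  \<comment> \<open>The maximum with 0 makes the representative nonnegative at every point and
    changes it only on null sets, since \<open>z\<close> is nonnegative.\<close>
  define fu where "fu p = (if fst p \<le> s then 0 else max 0 (\<Sum>k. beta k * mode k (fst p) * esin k (snd p)))" for p :: "real \<times> real"
  define fr where "fr p = force (fst p)" for p :: "real \<times> real"
  have [measurable]: "mode k \<in> borel_measurable borel" "esin k \<in> borel_measurable borel" for k
    by (intro borel_measurable_continuous_onI mode_cont esin_continuous)+
  have "fu \<in> borel_measurable (borel \<Otimes>\<^sub>M borel)" "fr \<in> borel_measurable (borel \<Otimes>\<^sub>M borel)"
    unfolding fu_def[abs_def] fr_def[abs_def] by measurable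
  then have m: "fu \<in> borel_measurable borel" "fr \<in> borel_measurable borel" by (simp_all add: borel_prod)
  have "AE x in I01. rep_l2 (z t) x = fu (t, x)" for t
  proof (cases "t \<le> s")
    case True
    then show ?thesis using rep_0 by (simp add: z_before fu_def)
  next
    case False
    then have t: "s \<le> t" by simp
    have "AE x in I01. 0 \<le> rep_l2 (z t) x" using z_nonneg by (simp add: Hplus_def)
    with rep_ek_series[OF z_sums[OF t] coeff_abs_summable[OF t]] show ?thesis
      by eventually_elim (use False in \<open>simp add: fu_def max_absorb2\<close>)
  qed
  then have "space_time_rep \<tau> z fu" using m by (simp add: space_time_rep_def)
  moreover have "space_time_rep \<tau> (\<lambda>t. force t *\<^sub>R one_l2) fr"
    using m rep_scale_one by (simp add: space_time_rep_def fr_def)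
  moreover have "fr (t, x) \<in> (\<lambda>y. b t * y) ` H0 (fu (t, x))" for t x
  proof (cases "t \<le> s")
    case True
    then show ?thesis by (auto simp: fr_def fu_def force_def H0_def intro!: image_eqI[of _ _ 0])
  next
    case False
    then have "0 \<le> fu (t, x)" by (simp add: fu_def)
    \<comment> \<open>The value 1 is admissible at zeros of \<open>fu\<close> as well, so strict
      positivity of \<open>z\<close> is no issue here.\<close>
    then have "1 \<in> H0 (fu (t, x))" by (auto simp: H0_def)
    then show ?thesis using False by (auto simp: fr_def force_def intro!: image_eqI[of _ _ 1])
  qed
  ultimately show ?thesis unfolding inclusion_ae_def by (intro exI[of _ fu] exI[of _ fr]) simp
qed

lemma z_solution:
  assumes "t0 \<le> s" shows "nonneg_strong_solution b \<omega> t0 0 z"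
  unfolding nonneg_strong_solution_def strong_solution_def
proof (intro conjI allI impI exI[of _ "\<lambda>t. force t *\<^sub>R one_l2"] z_continuous z_abs_continuous force_L2_loc z_inclusion z_nonneg)
  show "z t0 = 0" using assms by (rule z_before)
  have dom: "z t \<in> dom_A" for t
    using z_dom_A(1)[of t] zero_dom_A z_before[of t] by (cases "t \<le> s") auto
  then show "AE t in lborel. T1 < t \<and> t < T2 \<longrightarrow> z t \<in> dom_A" for T1 T2 by simp
  \<comment> \<open>The switching time is discarded as a null set; on either side of it
    \<open>z\<close> is differentiable.\<close>
  have "AE t in lborel. t \<noteq> s" by (rule AE_lborel_singleton)
  then show "AE t in lborel. t0 < t \<longrightarrow> (\<exists>z'. (z has_vector_derivative z') (at t) \<and>
      z' + op_A (z t) = force t *\<^sub>R one_l2 + \<omega> t *\<^sub>R z t)"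
  proof eventually_elim
    case (elim t)
    show ?case
    proof (cases "t < s")
      case True
      have "(z has_vector_derivative 0) (at t)"
        by (rule has_vector_derivative_transform_within_open[OF has_vector_derivative_const, where S = "{..<s}"])
           (use True in \<open>auto simp: z_before\<close>)
      then show ?thesis using True zero_dom_A by (auto simp: z_before force_def)
    next
      case False
      with elim have t: "s < t" by simp
      then show ?thesis using z_deriv[OF t] z_dom_A(2)[OF t] by (auto simp: force_def)
    qed
  qed
qed

end

section \<open>Attraction\<close>

lemma pullback_attractor_member:
  fixes U :: "real \<Rightarrow> real \<Rightarrow> 'a::metric_space \<Rightarrow> 'a set"
  assumes A: "pullback_attractor X U \<A>" and x: "x \<in> X" and v: "\<And>t0. t0 \<le> s \<Longrightarrow> v \<in> U t t0 x"
  shows "v \<in> \<A> t"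
proof -
  define I where "I = (INF a\<in>\<A> t. ennreal (dist v a))"
  have lim: "((\<lambda>t0. semidist (\<Union>y\<in>{x}. U t t0 y) (\<A> t)) \<longlongrightarrow> 0) at_bot"
  proof -
    have "\<forall>B t. bounded B \<and> B \<subseteq> X \<longrightarrow> ((\<lambda>t0. semidist (\<Union>y\<in>B. U t t0 y) (\<A> t)) \<longlongrightarrow> 0) at_bot"
      using A unfolding pullback_attractor_def pullback_attracting_def by blast
    from this[rule_format, of "{x}" t] x show ?thesis by simp
  qed
  \<comment> \<open>The point \<open>v\<close> is reached from every early start, so its distance to
    the attractor is below a quantity that tends to 0; closedness then gives membership.\<close>
  have "eventually (\<lambda>t0. I \<le> semidist (\<Union>y\<in>{x}. U t t0 y) (\<A> t)) at_bot"
    using eventually_le_at_bot[of s]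
    by eventually_elim (use v in \<open>auto simp: semidist_def I_def intro!: SUP_upper\<close>)
  from tendsto_lowerbound[OF lim this] have "I = 0" by (simp add: trivial_limit_at_bot_linorder)
  have "v \<in> closure (\<A> t)"
    unfolding closure_approachable
  proof (intro allI impI)
    fix e :: real assume "0 < e"
    then have "I < ennreal e" using \<open>I = 0\<close> by simp
    then obtain a where "a \<in> \<A> t" "ennreal (dist v a) < ennreal e" unfolding I_def by (auto simp: INF_less_iff)
    then show "\<exists>y\<in>\<A> t. dist y v < e"
      using \<open>0 < e\<close> by (auto simp: ennreal_less_iff dist_commute)
  qed
  moreover have "closed (\<A> t)" using A by (auto simp: pullback_attractor_def intro: compact_imp_closed)
  ultimately show ?thesis by simp
qed

text \<open>The exceptional null set depends on the starting time, so the infimum is approached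
  along a sequence, which involves only countably many null sets.\<close>

lemma forcing_after_infimum:
  fixes u :: "real \<Rightarrow> l2" and r :: "real \<Rightarrow> l2"
  assumes X: "X \<noteq> {}" "bdd_below X" and r: "\<And>s. s \<in> X \<Longrightarrow> AE t in lborel. s < t \<longrightarrow> r t = q t"
  shows "AE t in lborel. Inf X < t \<longrightarrow> r t = q t"
proof -
  have "\<exists>s\<in>X. s < Inf X + 1 / real (Suc n)" for n
    using cInf_lessD[OF X(1), of "Inf X + 1 / real (Suc n)"] by auto
  then obtain s where s: "\<And>n. s n \<in> X" "\<And>n. s n < Inf X + 1 / real (Suc n)" by metis
  have "AE t in lborel. \<forall>n. s n < t \<longrightarrow> r t = q t"
    unfolding AE_all_countable using r s(1) by blast
  then show ?thesis
  proof eventually_elim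
    case (elim t)
    show ?case
    proof
      assume "Inf X < t"
      then obtain n where "1 / real (Suc n) < t - Inf X"
        using reals_Archimedean[of "t - Inf X"] by (auto simp: inverse_eq_divide)
      then have "s n < t" using s(2)[of n] by linarith
      then show "r t = q t" using elim by blast
    qed
  qed
qed

text \<open>The solution is compared with the \<open>z\<close> that starts at the time
  \<open>s\<close> when it leaves zero. From \<open>s\<close> on their difference solves the
  homogeneous equation with initial value \<open>u s\<close>.\<close>

lemma solution_near_attractor:
  fixes b \<omega> :: "real \<Rightarrow> real"
  assumes b: "continuous_on UNIV b" "\<And>t. 0 < b t" "\<And>t. b t \<le> b1"
    and \<omega>: "continuous_on UNIV \<omega>" "\<And>t. 0 \<le> \<omega> t" "\<And>t. \<omega> t \<le> \<omega>1" "\<omega>1 < pi\<^sup>2"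
    and A: "pullback_attractor Hplus (Uplus b \<omega>) \<A>"
    and u: "nonneg_strong_solution b \<omega> t0 u0 u" and t: "t0 \<le> t"
  shows "\<exists>a\<in>\<A> t. dist (u t) a \<le> exp (- ((pi\<^sup>2 - \<omega>1) * (t - t0))) * norm u0"
proof -
  have fh: "forced_heat b \<omega> b1 \<omega>1" by standard (use b \<omega> in auto)
  have mem: "forced_heat.z b \<omega> s t \<in> \<A> t" for s
  proof (rule pullback_attractor_member[OF A zero_in_Hplus])
    show "forced_heat.z b \<omega> s t \<in> Uplus b \<omega> t t0 0" if "t0 \<le> s" for t0
      using forced_heat.z_solution[OF fh that] by (auto simp: Uplus_def)
  qed
  have ss: "strong_solution b \<omega> t0 u0 u" and pos: "\<And>t. t0 \<le> t \<Longrightarrow> u t \<in> Hplus"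
    using u by (auto simp: nonneg_strong_solution_def)
  have u0: "u t0 = u0" and uc: "continuous_on {t0..} u" using ss by (auto simp: strong_solution_def)
  define X where "X = {x. t0 \<le> x \<and> u x \<noteq> 0}"
  have Xb: "bdd_below X" by (auto simp: X_def)
  show ?thesis
  proof (cases "\<exists>x\<in>X. x \<le> t")
    case False
    then have "u t = 0" using t by (auto simp: X_def)
    \<comment> \<open>Zero is the value at time \<open>t\<close> of the solution that starts to grow
      only at \<open>t\<close>.\<close>
    moreover have "0 \<in> \<A> t" using mem[of t] forced_heat.z_before[OF fh, of t t] by simp
    ultimately show ?thesis by (intro bexI[of _ 0]) auto
  next
    case True
    then obtain x where x: "x \<in> X" "x \<le> t" by blast
    have Xne: "X \<noteq> {}" using x by auto
    define s where "s = Inf X"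
    have s: "t0 \<le> s" "s \<le> t"
      using cInf_greatest[OF Xne, of t0] cInf_lower[OF x(1) Xb] x(2) by (auto simp: s_def X_def)
    \<comment> \<open>By continuity from the left, as \<open>u\<close> vanishes before the
      infimum.\<close>
    have us: "u s = 0" if "t0 < s"
    proof (rule ccontr)
      assume "u s \<noteq> 0"
      then have "0 < norm (u s)" by simp
      then obtain d where d: "0 < d" "\<And>y. t0 \<le> y \<Longrightarrow> dist y s < d \<Longrightarrow> dist (u y) (u s) < norm (u s)"
        using uc s(1) unfolding continuous_on_iff by (metis atLeast_iff)
      define y where "y = max t0 (s - d / 2)"
      have y: "t0 \<le> y" "y < s" "dist y s < d" using that d(1) by (auto simp: y_def dist_real_def)
      have "y \<notin> X" using cInf_lower[OF _ Xb, of y] y(2) by (auto simp: s_def)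
      then have "u y = 0" using y(1) by (simp add: X_def)
      then show False using d(2)[OF y(1,3)] by simp
    qed
    obtain r where r: "inclusion_ae b t0 u r" "AE t in lborel. t0 < t \<longrightarrow>
           (\<exists>u'. (u has_vector_derivative u') (at t) \<and> u' + op_A (u t) = r t + \<omega> t *\<^sub>R u t)"
      using ss unfolding strong_solution_def by blast
    have m: "modal_solution \<omega> t0 r u" by (rule strong_solution_modal[OF ss r(2)])
    have f: "AE t in lborel. t0 < t \<longrightarrow> (AE x in I01. rep_l2 (r t) x = (if rep_l2 (u t) x = 0 then 0 else b t))"
      by (rule inclusion_forcing[OF r(1) b(2) pos strong_solution_dom_A[OF ss] r(2)])
    have "AE t in lborel. Inf X < t \<longrightarrow> r t = b t *\<^sub>R one_l2"
      by (rule forcing_after_infimum[OF Xne Xb]) 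
         (rule forcing_after_nonzero[OF m b(2,3) pos f \<omega>(1,2)], auto simp: X_def)
    then have d0: "AE t in lborel. s < t \<longrightarrow> r t - b t *\<^sub>R one_l2 = 0" by (simp add: s_def)
    let ?z = "forced_heat.z b \<omega> s"
    have "modal_solution \<omega> s (\<lambda>t. r t - b t *\<^sub>R one_l2) (\<lambda>t. u t - ?z t)"
      by (rule modal_solution_diff[OF modal_solution_restrict[OF m s(1)] forced_heat.z_modal[OF fh]])
    from modal_solution_decay[OF this d0 s(2) \<omega>(1,3)]
    have n: "norm (u t - ?z t) \<le> exp (- ((pi\<^sup>2 - \<omega>1) * (t - s))) * norm (u s)"
      using forced_heat.z_before[OF fh, of s s] by simp
    \<comment> \<open>If \<open>s\<close> is later than the start, then \<open>u s = 0\<close> and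
      the left side is 0; otherwise the two sides are equal.\<close>
    also have "\<dots> \<le> exp (- ((pi\<^sup>2 - \<omega>1) * (t - t0))) * norm u0"
      using us s(1) u0 by (cases "s = t0") auto
    finally show ?thesis using mem[of s] by (auto simp: dist_norm)
  qed
qed

theorem theorem43:
  fixes b \<omega> :: "real \<Rightarrow> real" and b0 b1 \<omega>0 \<omega>1 :: real and \<A> :: "real \<Rightarrow> l2 set"
  assumes "continuous_on UNIV b" and "continuous_on UNIV \<omega>"
    and "0 < b0" and "\<forall>t. b0 \<le> b t \<and> b t \<le> b1"
    and "0 \<le> \<omega>0" and "\<forall>t. \<omega>0 \<le> \<omega> t \<and> \<omega> t \<le> \<omega>1"
    and "\<omega>1 < pi\<^sup>2"
    and "pullback_attractor Hplus (Uplus b \<omega>) \<A>"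
  shows "forward_attractor Hplus (Uplus b \<omega>) \<A>"
proof -
  have b: "\<And>t. 0 < b t" "\<And>t. b t \<le> b1" and \<omega>: "\<And>t. 0 \<le> \<omega> t" "\<And>t. \<omega> t \<le> \<omega>1"
    using assms(3-6) by (auto intro: less_le_trans order_trans)
  have "((\<lambda>t. semidist (\<Union>x\<in>B. Uplus b \<omega> t t0 x) (\<A> t)) \<longlongrightarrow> 0) at_top"
    if B: "bounded B" for B t0
  proof -
    obtain C where C: "\<And>x. x \<in> B \<Longrightarrow> norm x \<le> C" using B by (auto simp: bounded_iff)
    \<comment> \<open>The rate is the same for all solutions, and \<open>C\<close> bounds all
      initial values in \<open>B\<close>; hence the majorant is uniform.\<close>
    define h where "h t = exp (- ((pi\<^sup>2 - \<omega>1) * (t - t0))) * C" for t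
    have le: "semidist (\<Union>x\<in>B. Uplus b \<omega> t t0 x) (\<A> t) \<le> ennreal (h t)" if t: "t0 \<le> t" for t
      unfolding semidist_def
    proof (rule SUP_least)
      fix y assume "y \<in> (\<Union>x\<in>B. Uplus b \<omega> t t0 x)"
      then obtain x u where x: "x \<in> B" "nonneg_strong_solution b \<omega> t0 x u" "y = u t"
        by (auto simp: Uplus_def)
      obtain a where a: "a \<in> \<A> t" "dist (u t) a \<le> exp (- ((pi\<^sup>2 - \<omega>1) * (t - t0))) * norm x"
        using solution_near_attractor[OF assms(1) b assms(2) \<omega> assms(7,8) x(2) t] by blast
      have "exp (- ((pi\<^sup>2 - \<omega>1) * (t - t0))) * norm x \<le> h t"
        unfolding h_def by (intro mult_left_mono C x(1)) simp
      then have "ennreal (dist y a) \<le> ennreal (h t)" using a(2) x(3) by (intro ennreal_leI) simp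
      then show "(INF x\<in>\<A> t. ennreal (dist y x)) \<le> ennreal (h t)" by (rule INF_lower2[OF a(1)])
    qed
    have "filterlim (\<lambda>t. - t0 + t) at_top at_top"
      by (intro filterlim_tendsto_add_at_top[OF tendsto_const] filterlim_ident)
    then have "filterlim (\<lambda>t. (pi\<^sup>2 - \<omega>1) * (- t0 + t)) at_top at_top"
      using assms(7) by (intro filterlim_tendsto_pos_mult_at_top[OF tendsto_const]) auto
    then have "((\<lambda>t. exp (- ((pi\<^sup>2 - \<omega>1) * (- t0 + t)))) \<longlongrightarrow> 0) at_top"
      by (intro filterlim_compose[OF exp_at_bot]) (simp add: filterlim_uminus_at_bot)
    then have "((\<lambda>t. ennreal (exp (- ((pi\<^sup>2 - \<omega>1) * (- t0 + t))) * C)) \<longlongrightarrow> ennreal (0 * C)) at_top"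
      by (intro tendsto_ennrealI tendsto_mult tendsto_const)
    then have "((\<lambda>t. ennreal (h t)) \<longlongrightarrow> 0) at_top" by (simp add: h_def)
    then show ?thesis
    proof (rule tendsto_sandwich[rotated 3])
      show "eventually (\<lambda>t. semidist (\<Union>x\<in>B. Uplus b \<omega> t t0 x) (\<A> t) \<le> ennreal (h t)) at_top"
        using eventually_ge_at_top[of t0] by eventually_elim (rule le)
    qed auto
  qed
  then show ?thesis
    using assms(8) by (simp add: forward_attractor_def pullback_attractor_def forward_attracting_def)
qed

end
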